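(* Let $n$ be a positive integer. Suppose that $f$ is an entire function of hyper-order strictly less than $1$, and $a,b,c$ are small entire functions of $f$ such that $\lambda(f-c)<\rho(f)$, $\rho(c)<1$ and $a\not\equiv b$. If $f$ and $\Delta^n f$ (with $\Delta^n f\not\equiv 0$) share the set $\{a,b\}$ CM, then $f(z)=c(z)+pe^{\gamma z}$, where $p,\gamma$ are non-zero constants, and one of the following cases holds. (i) $(e^{\gamma}-1)^n=1$, $c=0$ and $\Delta^n f=f$. (ii) $(e^{\gamma}-1)^n=-1$, $\Delta^n(f-c)=-(f-c)$ and $\Delta^n c+c=a+b$.
   Context: Standard Nevanlinna theory notation is used: $T(r,f)$ is the Nevanlinna characteristic. For a meromorphic $f$, $\rho(f)=\limsup_{r\to\infty}\frac{\log^+T(r,f)}{\log r}$ is the order, $\rho_2(f)=\limsup_{r\to\infty}\frac{\log^+\log^+T(r,f)}{\log r}$ is the hyper-order, and $\lambda(f)$ is the exponent of convergence of the zeros of $f$. A meromorphic function $g$ is a small function of $f$ if $T(r,g)=o(T(r,f))$ as $r\to\infty$ outside a possible exceptional set of finite linear measure. The difference operators are $\Delta f(z)=f(z+1)-f(z)$ and $\Delta^n f=\Delta(\Delta^{n-1}f)$, i.e. $\Delta^n f(z)=\sum_{i=0}^n(-1)^{n-i}\binom{n}{i}f(z+i)$. For a set $S$ of functions and a meromorphic $F$, let $E(S,F)=\bigcup_{s\in S}\{z: F(z)-s(z)=0\}$, counting multiplicities; $F$ and $G$ share the set $S$ CM if $E(S,F)=E(S,G)$. *)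

theory Defs
  imports "HOL-Complex_Analysis.Complex_Analysis"
begin

definition lnp :: "real \<Rightarrow> real" where
  "lnp x = (if x \<le> 1 then 0 else ln x)"

text \<open>Nevanlinna characteristic of an entire function: for entire f the
  counting function of poles vanishes, so T(r,f) = m(r,f), the proximity function.\<close>
definition nev_T :: "real \<Rightarrow> (complex \<Rightarrow> complex) \<Rightarrow> real" where
  "nev_T r f = integral {0..2*pi} (\<lambda>t. lnp (cmod (f (of_real r * cis t)))) / (2*pi)"

definition nev_order :: "(complex \<Rightarrow> complex) \<Rightarrow> ereal" where
  "nev_order f = Limsup at_top (\<lambda>r. ereal (lnp (nev_T r f) / ln r))"

definition hyper_order :: "(complex \<Rightarrow> complex) \<Rightarrow> ereal" where
  "hyper_order f = Limsup at_top (\<lambda>r. ereal (lnp (lnp (nev_T r f)) / ln r))"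

definition zero_mult :: "(complex \<Rightarrow> complex) \<Rightarrow> complex \<Rightarrow> enat" where
  "zero_mult h z = (if h z \<noteq> 0 then 0
      else if h = (\<lambda>_. 0) then \<infinity> else enat (nat (zorder h z)))"

definition zero_count :: "real \<Rightarrow> (complex \<Rightarrow> complex) \<Rightarrow> real" where
  "zero_count r h = (\<Sum>z\<in>{z. cmod z \<le> r \<and> h z = 0}. real (nat (zorder h z)))"

definition zero_exponent :: "(complex \<Rightarrow> complex) \<Rightarrow> ereal" where
  "zero_exponent h = Limsup at_top (\<lambda>r. ereal (lnp (zero_count r h) / ln r))"

definition small_fun :: "(complex \<Rightarrow> complex) \<Rightarrow> (complex \<Rightarrow> complex) \<Rightarrow> bool" where
  "small_fun g f \<longleftrightarrow> (\<exists>E. E \<in> sets lebesgue \<and> emeasure lebesgue E < \<infinity> \<and>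
      (\<forall>\<epsilon>>0. \<exists>R. \<forall>r\<ge>R. r \<notin> E \<longrightarrow> nev_T r g \<le> \<epsilon> * nev_T r f))"

fun fdiff :: "nat \<Rightarrow> (complex \<Rightarrow> complex) \<Rightarrow> complex \<Rightarrow> complex" where
  "fdiff 0 f = f"
| "fdiff (Suc n) f = (\<lambda>z. fdiff n f (z + 1) - fdiff n f z)"

text \<open>F and G share the (finite) set S of functions CM: E(S,F) = E(S,G) as multisets.\<close>
definition share_CM :: "(complex \<Rightarrow> complex) set \<Rightarrow> (complex \<Rightarrow> complex) \<Rightarrow> (complex \<Rightarrow> complex) \<Rightarrow> bool" where
  "share_CM S F G \<longleftrightarrow> (\<forall>z. (\<Sum>s\<in>S. zero_mult (\<lambda>w. F w - s w) z) = (\<Sum>s\<in>S. zero_mult (\<lambda>w. G w - s w) z))"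

end

theory Submission
  imports Defs "HOL-Computational_Algebra.Fundamental_Theorem_Algebra" "HOL-Library.Landau_Symbols"
begin

text \<open>
  Write \<open>f - c = H exp g\<close> with a canonical product \<open>H\<close> whose growth exponent is below the order of
  \<open>f\<close>, and put \<open>u = exp g\<close>, \<open>N r = T(r, u)\<close>. Since \<open>N\<close> has hyper-order less than one, there are
  arbitrarily large \<open>r\<close> for which \<open>N\<close> at most doubles between \<open>r\<close> and \<open>r + r powr \<beta>\<close>. Along
  these radii \<open>a\<close>, \<open>b\<close>, \<open>c\<close>, \<open>H\<close> and all quotients \<open>exp (g (z + t) - g z)\<close> have characteristic
  \<open>o(N r)\<close>, the latter by Poisson's formula, and by Jensen's inequality \<open>u\<close> satisfies no nontrivial
  polynomial equation with such coefficients.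

  With \<open>M u\<close> for the \<open>n\<close>-th difference of \<open>H u\<close>, sharing \<open>{a, b}\<close> means
  \<open>(M u + d - A) (M u + d - B) = exp Q (H u - A) (H u - B)\<close>, where \<open>A = a - c\<close>, \<open>B = b - c\<close> and
  \<open>d\<close> is the \<open>n\<close>-th difference of \<open>c\<close> minus \<open>c\<close>. Multiplying this crosswise with its own shift
  leaves only small coefficients. The leading one gives \<open>M^2 = K exp Q H^2\<close> with a constant \<open>K\<close>, so
  \<open>exp Q\<close> can be eliminated; the remaining ones give \<open>M = H\<close>, \<open>d = 0\<close> or \<open>M = - H\<close>,
  \<open>d = A + B\<close>.

  Hence \<open>H u\<close> solves a linear difference equation with constant coefficients. The same argument
  with \<open>exp (g (z + 1) - g z)\<close> in place of \<open>u\<close> shows that \<open>g\<close> is a polynomial, and Jensen's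
  inequality for \<open>H\<close> excludes degrees above one. For \<open>g\<close> linear, \<open>H\<close> has order less than one and
  satisfies such an equation with simple characteristic roots, so it is constant; likewise an
  \<open>n\<close>-th difference equal to \<open>c\<close> forces \<open>c = 0\<close>.
\<close>

section \<open>Circle means and the Poisson kernel\<close>

text \<open>Comparing with \<open>exp g\<close> instead of \<open>f\<close> keeps every object
  entire: the quotients \<open>exp (g (z + t) - g z)\<close> have no poles, so the proximity mean
  alone measures growth. There are two obstacles. Smallness with respect to \<open>f\<close> is
  known only off a set of finite measure, and shifts move the circles of integration; both are met
  by asking for smallness at all radii \<open>r + \<theta> * r powr \<beta>\<close> with
  \<open>0 < \<theta> < 1\<close> instead of at \<open>r\<close>. Moreover, nothing is known about
  \<open>exp Q\<close> except the identity in which it occurs. It is an entire quotient of two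
  quadratic expressions in \<open>u\<close>, so Jensen's inequality bounds its characteristic by O(N
  r), which is enough for its shift quotients to be o(N r). The lower bound for \<open>N\<close>
  comes from a single Taylor coefficient of \<open>g\<close>. Its index \<open>k\<close> exceeds the
  growth exponent \<open>s\<close> of \<open>H\<close>, since otherwise \<open>f\<close> would have
  order at most \<open>s\<close>. Hence \<open>N r\<close> is at least a constant multiple of
  \<open>r ^ k\<close>, and \<open>H\<close> is small.\<close>

definition circ_mean :: "real \<Rightarrow> (complex \<Rightarrow> real) \<Rightarrow> real" where
  "circ_mean r \<phi> = integral {0..2*pi} (\<lambda>t. \<phi> (of_real r * cis t)) / (2*pi)"

lemma nev_T_circ_mean: "nev_T r f = circ_mean r (\<lambda>z. lnp (cmod (f z)))"
  by (simp add: nev_T_def circ_mean_def)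

lemma continuous_on_circle:
  fixes \<phi> :: "complex \<Rightarrow> 'a::topological_space"
  assumes "continuous_on (sphere 0 r) \<phi>" "r \<ge> 0"
  shows "continuous_on A (\<lambda>t. \<phi> (of_real r * cis t))"
  by (rule continuous_on_compose2[OF assms(1)])
     (use assms(2) in \<open>auto intro!: continuous_intros simp: norm_mult\<close>)

lemma circ_mean_integrable:
  assumes "continuous_on (sphere 0 r) \<phi>" "r \<ge> 0"
  shows "(\<lambda>t. \<phi> (of_real r * cis t) :: real) integrable_on {0..2*pi}"
  using continuous_on_circle[OF assms] by (rule integrable_continuous_real)

lemma circ_mean_mono:
  assumes "continuous_on (sphere 0 r) \<phi>" "continuous_on (sphere 0 r) \<psi>" "r \<ge> 0"
    and "\<And>z. cmod z = r \<Longrightarrow> \<phi> z \<le> \<psi> z"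
  shows "circ_mean r \<phi> \<le> circ_mean r \<psi>"
  unfolding circ_mean_def
  by (intro divide_right_mono integral_le circ_mean_integrable assms)
     (use assms(3) in \<open>auto simp: norm_mult\<close>)

lemma circ_mean_const [simp]: "circ_mean r (\<lambda>_. k) = k"
  by (simp add: circ_mean_def)

lemma circ_mean_add:
  assumes "continuous_on (sphere 0 r) \<phi>" "continuous_on (sphere 0 r) \<psi>" "r \<ge> 0"
  shows "circ_mean r (\<lambda>z. \<phi> z + \<psi> z) = circ_mean r \<phi> + circ_mean r \<psi>"
  unfolding circ_mean_def
  by (subst integral_add) (auto intro!: circ_mean_integrable assms simp: add_divide_distrib)

lemma circ_mean_diff:
  assumes "continuous_on (sphere 0 r) \<phi>" "continuous_on (sphere 0 r) \<psi>" "r \<ge> 0"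
  shows "circ_mean r (\<lambda>z. \<phi> z - \<psi> z) = circ_mean r \<phi> - circ_mean r \<psi>"
  unfolding circ_mean_def
  by (subst integral_diff) (auto intro!: circ_mean_integrable assms simp: diff_divide_distrib)

lemma circ_mean_cmult: "circ_mean r (\<lambda>z. k * \<phi> z) = k * circ_mean r \<phi>"
  unfolding circ_mean_def by simp

lemma circ_mean_sum:
  assumes "\<And>i. i \<in> I \<Longrightarrow> continuous_on (sphere 0 r) (\<phi> i)" "r \<ge> 0"
  shows "circ_mean r (\<lambda>z. \<Sum>i\<in>I. \<phi> i z) = (\<Sum>i\<in>I. circ_mean r (\<phi> i))"
proof (cases "finite I")
  case True
  then show ?thesis
    unfolding circ_mean_def
    by (subst integral_sum) (auto intro!: circ_mean_integrable assms simp: sum_divide_distrib)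
qed auto

lemma circ_mean_cong:
  assumes "r \<ge> 0" "\<And>z. cmod z = r \<Longrightarrow> \<phi> z = \<psi> z"
  shows "circ_mean r \<phi> = circ_mean r \<psi>"
proof -
  have "\<phi> (of_real r * cis t) = \<psi> (of_real r * cis t)" for t
    using assms by (simp add: norm_mult)
  then show ?thesis by (simp add: circ_mean_def)
qed

lemma circ_mean_nonneg:
  assumes "continuous_on (sphere 0 r) \<phi>" "r \<ge> 0" "\<And>z. cmod z = r \<Longrightarrow> \<phi> z \<ge> 0"
  shows "circ_mean r \<phi> \<ge> 0"
  using circ_mean_mono[of r "\<lambda>_. 0" \<phi>] assms by auto

lemma circ_mean_swap:
  fixes K :: "complex \<Rightarrow> complex \<Rightarrow> real"
  assumes "continuous_on (sphere 0 r \<times> sphere 0 R) (\<lambda>(z,w). K z w)" "r \<ge> 0" "R \<ge> 0"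
  shows "circ_mean r (\<lambda>z. circ_mean R (\<lambda>w. K z w)) = circ_mean R (\<lambda>w. circ_mean r (\<lambda>z. K z w))"
proof -
  have "continuous_on (cbox (0,0) (2*pi,2*pi)) (\<lambda>(s,t). K (of_real r * cis s) (of_real R * cis t))"
    unfolding case_prod_unfold
    by (rule continuous_on_compose2[OF assms(1)[unfolded case_prod_unfold],
          where f = "\<lambda>p. (of_real r * cis (fst p), of_real R * cis (snd p))", simplified])
       (use assms(2,3) in \<open>auto intro!: continuous_intros simp: norm_mult\<close>)
  from integral_swap_continuous[OF this] show ?thesis
    by (simp add: circ_mean_def field_simps)
qed

section \<open>Cauchy's and Poisson's formulas as integrals over an angle\<close>

lemma cauchy_circle_integral:
  assumes "f holomorphic_on S" "open S" "cball z0 R \<subseteq> S" "cmod (w - z0) < R"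
  shows "((\<lambda>t. f (z0 + of_real R * cis t) * (of_real R * cis t) / (z0 + of_real R * cis t - w))
           has_integral 2 * of_real pi * f w) {0..2*pi}"
proof -
  have "((\<lambda>u. f u / (u - w)) has_contour_integral (2 * of_real pi * \<i> * f w)) (circlepath z0 R)"
  proof (rule Cauchy_integral_circlepath)
    show "continuous_on (cball z0 R) f" "f holomorphic_on ball z0 R"
      using assms holomorphic_on_imp_continuous_on holomorphic_on_subset ball_subset_cball
      by (metis (no_types, lifting) subset_trans)+
  qed (use assms in \<open>auto simp: norm_minus_commute\<close>)
  then have "((\<lambda>t. f (z0 + R * cis t) / (z0 + R * cis t - w) * R * \<i> * cis t)
     has_integral 2 * of_real pi * \<i> * f w) {0..2*pi}"
    unfolding circlepath_def by (subst (asm) has_contour_integral_part_circlepath_iff) auto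
  from has_integral_mult_right[OF this, of "-\<i>"] show ?thesis
    by (simp add: field_simps)
qed

lemma mean_value_holomorphic:
  assumes "f holomorphic_on S" "open S" "cball z0 R \<subseteq> S" "R > 0"
  shows "((\<lambda>t. f (z0 + of_real R * cis t)) has_integral 2 * of_real pi * f z0) {0..2*pi}"
  using cauchy_circle_integral[OF assms(1-3), of z0] assms(4) by simp

lemma circ_mean_Re_holomorphic:
  assumes "f holomorphic_on S" "open S" "cball z0 R \<subseteq> S" "R > 0"
  shows "circ_mean R (\<lambda>z. Re (f (z0 + z))) = Re (f z0)"
  using has_integral_Re[OF mean_value_holomorphic[OF assms]]
  by (simp add: circ_mean_def integral_unique)

text \<open>The first argument is the interior point, the second the boundary point, whose modulus
  plays the part of the radius. The factor 1/(2 pi) is left to \<open>circ_mean\<close>.\<close>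

definition poisson_kernel :: "complex \<Rightarrow> complex \<Rightarrow> real" where
  "poisson_kernel z w = ((cmod w)\<^sup>2 - (cmod z)\<^sup>2) / (cmod (w - z))\<^sup>2"

lemma poisson_kernel_Re:
  assumes "w \<noteq> z"
  shows "poisson_kernel z w = Re ((w + z) / (w - z))"
proof -
  have "(w + z) / (w - z) = (w + z) * cnj (w - z) / of_real ((cmod (w - z))\<^sup>2)"
    unfolding complex_norm_square using assms by simp
  then have "Re ((w + z) / (w - z)) = Re ((w + z) * cnj (w - z)) / (cmod (w - z))\<^sup>2"
    by (metis Re_divide_of_real)
  also have "Re ((w + z) * cnj (w - z)) = (cmod w)\<^sup>2 - (cmod z)\<^sup>2"
    unfolding cmod_power2 by (simp add: algebra_simps power2_eq_square)
  finally show ?thesis by (simp add: poisson_kernel_def)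
qed

lemma continuous_on_poisson_kernel [continuous_intros]:
  assumes "continuous_on A f" "continuous_on A g" "\<And>x. x \<in> A \<Longrightarrow> f x \<noteq> g x"
  shows "continuous_on A (\<lambda>x. poisson_kernel (f x) (g x))"
  unfolding poisson_kernel_def by (intro continuous_intros assms) (use assms(3) in force)

lemma poisson_kernel_nonneg: "cmod z \<le> cmod w \<Longrightarrow> poisson_kernel z w \<ge> 0"
  by (simp add: poisson_kernel_def power_mono)

lemma poisson_kernel_le:
  assumes "cmod z < R" "cmod w = R"
  shows "poisson_kernel z w \<le> (R + cmod z) / (R - cmod z)"
proof -
  have "R - cmod z \<le> cmod (w - z)"
    using assms norm_triangle_ineq2[of w z] by simp
  then have "(R - cmod z)\<^sup>2 \<le> (cmod (w - z))\<^sup>2"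
    using assms by (intro power_mono) auto
  then have "poisson_kernel z w \<le> (R\<^sup>2 - (cmod z)\<^sup>2) / (R - cmod z)\<^sup>2"
    unfolding poisson_kernel_def using assms
    by (auto intro!: divide_left_mono power_mono mult_pos_pos)
  also have "R\<^sup>2 - (cmod z)\<^sup>2 = (R + cmod z) * (R - cmod z)"
    by (simp add: power2_eq_square algebra_simps)
  also have "\<dots> / (R - cmod z)\<^sup>2 = (R + cmod z) / (R - cmod z)"
    using assms by (simp add: power2_eq_square)
  finally show ?thesis .
qed

text \<open>Cauchy's formula at \<open>z\<close> is added to a vanishing integral whose pole is the
  reflection of \<open>z\<close> in the circle, hence outside the closed disc. On the circle the two
  kernels sum to the Poisson kernel.\<close>

lemma poisson_integral_entire:
  assumes "G holomorphic_on UNIV" "cmod z < R"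
  shows "circ_mean R (\<lambda>w. poisson_kernel z w * Re (G w)) = Re (G z)"
proof -
  have R: "R > 0" using assms(2) norm_ge_zero[of z] by linarith
  \<comment> \<open>The complement of the reflected point; this form also covers
    \<open>z = 0\<close>, where there is no such point.\<close>
  define S :: "complex set" where "S = {w. cnj z * w \<noteq> of_real (R\<^sup>2)}"
  have "open S" unfolding S_def by (intro open_Collect_neq continuous_intros)
  have "cball 0 R \<subseteq> S"
  proof
    fix w :: complex assume "w \<in> cball 0 R"
    then have "cmod (cnj z * w) \<le> cmod z * R"
      by (simp add: norm_mult mult_left_mono)
    also have "\<dots> < R * R" using assms(2) R by (intro mult_strict_right_mono) auto
    finally have "cmod (cnj z * w) < R\<^sup>2" by (simp add: power2_eq_square)
    then show "w \<in> S" unfolding S_def using R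
      by (metis abs_of_pos less_irrefl mem_Collect_eq norm_of_real zero_less_power)
  qed
  have "(\<lambda>w. G w * cnj z * w / (of_real (R\<^sup>2) - cnj z * w)) holomorphic_on S"
    by (intro holomorphic_intros holomorphic_on_subset[OF assms(1)]) (auto simp: S_def)
  from mean_value_holomorphic[OF this \<open>open S\<close> \<open>cball 0 R \<subseteq> S\<close> R]
  have 1: "((\<lambda>t. G (R * cis t) * cnj z * (R * cis t) / (of_real (R\<^sup>2) - cnj z * (R * cis t)))
      has_integral 0) {0..2*pi}"
    by simp
  have 2: "((\<lambda>t. G (R * cis t) * (R * cis t) / (R * cis t - z))
      has_integral 2 * of_real pi * G z) {0..2*pi}"
    using cauchy_circle_integral[OF assms(1) open_UNIV, of 0 R z] assms(2) by simp
  have *: "G w * w / (w - z) + G w * cnj z * w / (of_real (R\<^sup>2) - cnj z * w) =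
     of_real (poisson_kernel z w) * G w" if "cmod w = R" for w
  proof -
    have w: "w \<noteq> z" "w \<noteq> 0" using that assms(2) R by auto
    have RR: "complex_of_real (R\<^sup>2) = w * cnj w" using that by (simp add: complex_norm_square[symmetric])
    have "complex_of_real (poisson_kernel z w) = (w * cnj w - z * cnj z) / ((w - z) * (cnj w - cnj z))"
      unfolding poisson_kernel_def of_real_divide of_real_diff complex_norm_square by simp
    moreover have "w * cnj w - cnj z * w = w * (cnj w - cnj z)" by (simp add: algebra_simps)
    ultimately have "w / (w - z) + cnj z * w / (of_real (R\<^sup>2) - cnj z * w) =
        complex_of_real (poisson_kernel z w)"
      unfolding RR using w by (simp add: divide_simps) (simp add: algebra_simps)
    then have "(w / (w - z) + cnj z * w / (of_real (R\<^sup>2) - cnj z * w)) * G w =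
        complex_of_real (poisson_kernel z w) * G w" by simp
    then show ?thesis by (simp add: algebra_simps)
  qed
  have "((\<lambda>t. of_real (poisson_kernel z (R * cis t)) * G (R * cis t))
      has_integral 2 * of_real pi * G z) {0..2*pi}"
    using has_integral_add[OF 2 1] R by (subst (asm) *) (auto simp: norm_mult)
  from has_integral_Re[OF this] show ?thesis
    by (simp add: circ_mean_def integral_unique)
qed

lemma circ_mean_poisson_kernel:
  assumes "cmod z < R"
  shows "circ_mean R (\<lambda>w. poisson_kernel z w) = 1"
  using poisson_integral_entire[of "\<lambda>_. 1" z R] assms by simp

text \<open>For fixed \<open>w\<close> the kernel is the real part of a function of \<open>z\<close>
  that is holomorphic for |z| < R, so the mean over the circle about \<open>t\<close> is the value
  at \<open>t\<close>.\<close>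

lemma circ_mean_poisson_kernel_shift:
  assumes "cmod t + r < R" "r > 0" "cmod w = R"
  shows "circ_mean r (\<lambda>z. poisson_kernel (z + t) w) = poisson_kernel t w"
proof -
  have ne: "w \<noteq> z" if "cmod z < R" for z using that assms by auto
  have "circ_mean r (\<lambda>z. Re ((w + (t + z)) / (w - (t + z)))) = Re ((w + t) / (w - t))"
  proof (rule circ_mean_Re_holomorphic)
    show "(\<lambda>z. (w + z) / (w - z)) holomorphic_on ball 0 R"
      using ne by (intro holomorphic_intros) auto
    show "cball t r \<subseteq> ball 0 R"
    proof
      fix x assume "x \<in> cball t r"
      then show "x \<in> ball 0 R"
        using norm_triangle_ineq[of t "x - t"] assms(1) by (simp add: dist_norm norm_minus_commute)
    qed
  qed (use assms in auto)
  moreover have "cmod (z + t) < R" if "cmod z = r" for z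
    using that assms(1) norm_triangle_ineq[of z t] by simp
  ultimately show ?thesis
    using poisson_kernel_Re ne assms norm_ge_zero[of t]
    by (subst circ_mean_cong[where \<psi> = "\<lambda>z. Re ((w + (t + z)) / (w - (t + z)))"])
       (auto simp: poisson_kernel_Re add.commute)
qed


section \<open>Subharmonicity and the Nevanlinna characteristic\<close>

lemma lnp_max: "lnp x = ln (max 1 x)"
  by (simp add: lnp_def max_def)

lemma lnp_nonneg [simp]: "lnp x \<ge> 0"
  by (simp add: lnp_max)

lemma lnp_mono: "x \<le> y \<Longrightarrow> lnp x \<le> lnp y"
  by (auto simp: lnp_max)

lemma le_exp_lnp: "x \<le> exp (lnp x)"
  by (simp add: lnp_max)

lemma lnp_exp [simp]: "lnp (exp x) = max 0 x"
  by (auto simp: lnp_def max_def)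

lemma lnp_le_iff: "c \<ge> 0 \<Longrightarrow> lnp x \<le> c \<longleftrightarrow> x \<le> exp c"
  by (metis le_exp_lnp lnp_exp lnp_mono max_def order_trans exp_le_cancel_iff)

lemma lnp_mult: "x \<ge> 0 \<Longrightarrow> y \<ge> 0 \<Longrightarrow> lnp (x * y) \<le> lnp x + lnp y"
  by (subst lnp_le_iff) (auto simp: exp_add intro!: mult_mono le_exp_lnp)

lemma lnp_add: "x \<ge> 0 \<Longrightarrow> y \<ge> 0 \<Longrightarrow> lnp (x + y) \<le> lnp x + lnp y + ln 2"
proof -
  have "x \<le> exp (lnp x + lnp y)" "y \<le> exp (lnp x + lnp y)"
    using le_exp_lnp[of x] le_exp_lnp[of y]
    by (meson add_increasing add_increasing2 exp_le_cancel_iff lnp_nonneg order_refl order_trans)+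
  then have "x + y \<le> exp (lnp x + lnp y + ln 2)" by (simp add: exp_add)
  then show ?thesis by (subst lnp_le_iff) (auto simp: add_nonneg_nonneg)
qed

lemma continuous_on_lnp [continuous_intros]:
  "continuous_on A f \<Longrightarrow> continuous_on A (\<lambda>x. lnp (f x))"
  unfolding lnp_max by (intro continuous_intros) auto

lemma entire_continuous_on:
  assumes "A holomorphic_on UNIV"
  shows "continuous_on S A"
  using assms by (meson continuous_on_subset holomorphic_on_imp_continuous_on top_greatest)

lemma entire_shift:
  assumes "A holomorphic_on UNIV"
  shows "(\<lambda>z. A (z + t)) holomorphic_on S"
  by (rule holomorphic_on_compose_gen[of "\<lambda>z. z + t" S A UNIV, unfolded o_def])
     (auto intro!: holomorphic_intros assms)

lemma continuous_on_lnp_entire [continuous_intros]: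
  "A holomorphic_on UNIV \<Longrightarrow> continuous_on S (\<lambda>z. lnp (cmod (A z)))"
  by (intro continuous_intros entire_continuous_on)

lemma nev_T_nonneg: "A holomorphic_on UNIV \<Longrightarrow> r \<ge> 0 \<Longrightarrow> nev_T r A \<ge> 0"
  unfolding nev_T_circ_mean by (intro circ_mean_nonneg continuous_intros) auto

text \<open>On the circle \<open>z * cnj z\<close> is the constant \<open>R\<^sup>2\<close>, so the
  product of the two non-constant parts loses one degree in each factor. The mixed terms are real
  parts of polynomials after conjugating a coefficient.\<close>

lemma Re_poly_mult_cnj_on_circle:
  "\<exists>s. \<forall>z. cmod z = R \<longrightarrow> Re (poly p z * cnj (poly q z)) = Re (poly s z)"
proof (induction p arbitrary: q)
  case 0
  show ?case by (rule exI[of _ 0]) simp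
next
  case (pCons a p)
  obtain b q' where q: "q = pCons b q'" by (cases q)
  obtain s where s: "\<And>z. cmod z = R \<Longrightarrow> Re (poly p z * cnj (poly q' z)) = Re (poly s z)"
    using pCons.IH by blast
  define S where "S = smult (cnj a) q + pCons 0 (smult (cnj b) p) + smult (of_real (R\<^sup>2)) s"
  have "Re (poly (pCons a p) z * cnj (poly q z)) = Re (poly S z)" if z: "cmod z = R" for z
  proof -
    have "poly (pCons a p) z * cnj (poly q z) =
       a * cnj (poly q z) + cnj b * (z * poly p z) + (z * cnj z) * (poly p z * cnj (poly q' z))"
      by (simp add: q algebra_simps)
    also have "z * cnj z = of_real (R\<^sup>2)" using z by (simp add: complex_norm_square[symmetric])
    finally have "Re (poly (pCons a p) z * cnj (poly q z)) =
       Re (a * cnj (poly q z)) + Re (cnj b * (z * poly p z)) + R\<^sup>2 * Re (poly p z * cnj (poly q' z))"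
      by (simp del: of_real_power)
    also have "Re (a * cnj (poly q z)) = Re (cnj a * poly q z)" by simp
    finally show ?thesis unfolding s[OF z] S_def
      by (simp add: algebra_simps del: of_real_power)
  qed
  then show ?case by blast
qed

text \<open>Links Stone-Weierstrass to Poisson's formula: the functions it supplies agree on the
  circle with real parts of entire functions, whose Poisson integrals are known exactly.\<close>

lemma real_polynomial_function_on_circle:
  fixes f :: "complex \<Rightarrow> real"
  assumes "real_polynomial_function f"
  shows "\<exists>p. \<forall>z. cmod z = R \<longrightarrow> f z = Re (poly p z)"
  using assms
proof (induction rule: real_polynomial_function.induct)
  case (linear f)
  interpret bounded_linear f by fact
  have "f z = Re (poly [:0, Complex (f 1) (- f \<i>):] z)" for z
  proof -
    have "f z = f (Re z *\<^sub>R 1 + Im z *\<^sub>R \<i>)"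
      by (intro arg_cong[where f = f]) (simp add: complex_eq_iff)
    also have "\<dots> = Re z * f 1 + Im z * f \<i>"
      by (simp only: add scaleR real_scaleR_def)
    finally show ?thesis by simp
  qed
  then show ?case by blast
next
  case (const c)
  show ?case by (rule exI[of _ "[:of_real c:]"]) simp
next
  case (add f g)
  then obtain p q where "\<And>z. cmod z = R \<Longrightarrow> f z = Re (poly p z)" "\<And>z. cmod z = R \<Longrightarrow> g z = Re (poly q z)"
    by blast
  then show ?case by (intro exI[of _ "p + q"]) simp
next
  case (mult f g)
  then obtain p q where pq: "\<And>z. cmod z = R \<Longrightarrow> f z = Re (poly p z)" "\<And>z. cmod z = R \<Longrightarrow> g z = Re (poly q z)"
    by blast
  obtain s where s: "\<And>z. cmod z = R \<Longrightarrow> Re (poly p z * cnj (poly q z)) = Re (poly s z)"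
    using Re_poly_mult_cnj_on_circle by blast
  \<comment> \<open>Re u * Re v is half the sum of Re (u v) and Re (u cnj v); \<open>s\<close>
    represents the second term.\<close>
  have "f z * g z = Re (poly (smult (1/2) (p * q + s)) z)" if "cmod z = R" for z
  proof -
    have "Re (poly (smult (1/2) (p * q + s)) z) = (Re (poly p z * poly q z) + Re (poly s z)) / 2"
      by simp
    also have "\<dots> = f z * g z"
      unfolding s[OF that, symmetric] pq[OF that] by simp
    finally show ?thesis ..
  qed
  then show ?case by blast
qed

text \<open>Approximate \<open>\<phi>\<close> from above by the real part of a polynomial \<open>p\<close> and apply the maximum
  modulus principle to \<open>A exp (- p)\<close>.\<close>
lemma poisson_majorant:
  assumes A: "A holomorphic_on UNIV" and \<phi>: "continuous_on (sphere 0 R) \<phi>" and z: "cmod z < R"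
    and le: "\<And>w. cmod w = R \<Longrightarrow> cmod (A w) \<le> exp (\<phi> w)"
  shows "cmod (A z) \<le> exp (circ_mean R (\<lambda>w. poisson_kernel z w * \<phi> w))"
proof (cases "A z = 0")
  case False
  have R: "R > 0" using z norm_ge_zero[of z] by linarith
  have K: "continuous_on (sphere 0 R) (poisson_kernel z)"
    using z by (intro continuous_intros) auto
  let ?m = "circ_mean R (\<lambda>w. poisson_kernel z w * \<phi> w)"
  have "ln (cmod (A z)) \<le> ?m + e" if e: "e > 0" for e
  proof -
    obtain g where g: "real_polynomial_function g" "\<And>x. x \<in> sphere 0 R \<Longrightarrow> \<bar>\<phi> x - g x\<bar> < e/2"
      using Stone_Weierstrass_real_polynomial_function[OF _ \<phi>, of "e/2"] e by auto
    obtain p where p: "\<And>w. cmod w = R \<Longrightarrow> g w = Re (poly p w)"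
      using real_polynomial_function_on_circle[OF g(1)] by blast
    \<comment> \<open>Raising by e/2 places Re (P w) between \<phi> w and \<phi> w + e on the
      circle.\<close>
    define P where "P w = poly p w + of_real (e/2)" for w
    have P: "P holomorphic_on UNIV" unfolding P_def by (intro holomorphic_intros)
    have P1: "\<phi> w \<le> Re (P w)" "Re (P w) \<le> \<phi> w + e" if "cmod w = R" for w
      using g(2)[of w] p[OF that] that by (auto simp: P_def abs_if split: if_splits)
    have "cmod (A z * exp (- P z)) \<le> 1"
    proof (rule maximum_modulus_frontier[where S = "cball 0 R" and f = "\<lambda>z. A z * exp (- P z)"])
      have H: "(\<lambda>z. A z * exp (- P z)) holomorphic_on UNIV"
        by (intro holomorphic_intros A P)
      then show "(\<lambda>z. A z * exp (- P z)) holomorphic_on interior (cball 0 R)"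
        "continuous_on (closure (cball 0 R)) (\<lambda>z. A z * exp (- P z))"
        by (auto intro: entire_continuous_on holomorphic_on_subset)
      fix w :: complex assume "w \<in> frontier (cball 0 R)"
      then have w: "cmod w = R" using R by (auto simp: frontier_cball)
      have "cmod (A w * exp (- P w)) = cmod (A w) * exp (- Re (P w))" by (simp add: norm_mult)
      also have "\<dots> \<le> exp (Re (P w)) * exp (- Re (P w))"
        using le[OF w] P1(1)[OF w] by (intro mult_right_mono) (auto intro: order_trans)
      finally show "cmod (A w * exp (- P w)) \<le> 1" by (simp add: exp_minus)
    qed (use z in auto)
    then have "cmod (A z) \<le> exp (Re (P z))"
      by (simp add: exp_minus norm_divide divide_le_eq flip: divide_inverse)
    then have "ln (cmod (A z)) \<le> Re (P z)"
      using False by (metis exp_ge_zero ln_exp ln_mono zero_less_norm_iff order_less_le_trans)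
    also have "\<dots> = circ_mean R (\<lambda>w. poisson_kernel z w * Re (P w))"
      using poisson_integral_entire[OF P z] by simp
    also have "\<dots> \<le> circ_mean R (\<lambda>w. poisson_kernel z w * \<phi> w + e * poisson_kernel z w)"
    proof (rule circ_mean_mono)
      fix w assume w: "cmod w = R"
      have "poisson_kernel z w * Re (P w) \<le> poisson_kernel z w * (\<phi> w + e)"
        using P1(2)[OF w] z w by (intro mult_left_mono poisson_kernel_nonneg) auto
      then show "poisson_kernel z w * Re (P w) \<le> poisson_kernel z w * \<phi> w + e * poisson_kernel z w"
        by (simp add: algebra_simps)
    qed (use R in \<open>auto intro!: continuous_intros K \<phi> entire_continuous_on P\<close>)
    also have "\<dots> = ?m + e"
      using circ_mean_poisson_kernel[OF z] R
      by (subst circ_mean_add) (auto intro!: continuous_intros K \<phi> simp: circ_mean_cmult)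
    finally show ?thesis .
  qed
  then have "ln (cmod (A z)) \<le> ?m" by (rule field_le_epsilon)
  then show ?thesis using False by (metis exp_le_cancel_iff exp_ln zero_less_norm_iff)
qed simp

text \<open>Subharmonicity of log+ |A|. The function itself serves as the continuous majorant, and
  its Poisson integral is non-negative, so the bound for |A z| is also one for its positive
  logarithm.\<close>

lemma lnp_le_poisson:
  assumes "A holomorphic_on UNIV" "cmod z < R"
  shows "lnp (cmod (A z)) \<le> circ_mean R (\<lambda>w. poisson_kernel z w * lnp (cmod (A w)))"
proof (subst lnp_le_iff)
  show "0 \<le> circ_mean R (\<lambda>w. poisson_kernel z w * lnp (cmod (A w)))"
    using assms order_trans[OF norm_ge_zero less_imp_le[OF assms(2)]]
    by (intro circ_mean_nonneg continuous_intros entire_continuous_on)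
       (auto intro!: mult_nonneg_nonneg poisson_kernel_nonneg)
  show "cmod (A z) \<le> exp (circ_mean R (\<lambda>w. poisson_kernel z w * lnp (cmod (A w))))"
    by (intro poisson_majorant assms continuous_on_lnp_entire le_exp_lnp)
qed

lemma lnp_le_nev_T:
  assumes "A holomorphic_on UNIV" "cmod z < R"
  shows "lnp (cmod (A z)) \<le> (R + cmod z) / (R - cmod z) * nev_T R A"
proof -
  have R: "R \<ge> 0" using assms(2) norm_ge_zero[of z] by linarith
  have "lnp (cmod (A z)) \<le> circ_mean R (\<lambda>w. poisson_kernel z w * lnp (cmod (A w)))"
    by (rule lnp_le_poisson[OF assms])
  also have "\<dots> \<le> circ_mean R (\<lambda>w. (R + cmod z) / (R - cmod z) * lnp (cmod (A w)))"
    using assms R by (intro circ_mean_mono continuous_intros mult_right_mono poisson_kernel_le) auto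
  finally show ?thesis unfolding circ_mean_cmult nev_T_circ_mean .
qed

text \<open>The mean value property of Poisson integrals, on a circle about \<open>t\<close>:
  interchange the two means and average the kernel in its first argument.\<close>

lemma circ_mean_poisson_integral:
  assumes "cmod t + r < R" "r > 0" "continuous_on (sphere 0 R) \<phi>"
  shows "continuous_on (sphere 0 r) (\<lambda>z. circ_mean R (\<lambda>w. poisson_kernel (z + t) w * \<phi> w))"
    and "circ_mean r (\<lambda>z. circ_mean R (\<lambda>w. poisson_kernel (z + t) w * \<phi> w)) =
         circ_mean R (\<lambda>w. poisson_kernel t w * \<phi> w)"
proof -
  have R: "R > 0" using assms norm_ge_zero[of t] by linarith
  have ne: "z + t \<noteq> w" if "cmod z = r" "cmod w = R" for z w
    using that assms(1) norm_triangle_ineq[of z t] by auto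
  have c: "continuous_on (sphere 0 r \<times> sphere 0 R) (\<lambda>(z,w). poisson_kernel (z + t) w * \<phi> w)"
    unfolding case_prod_unfold using ne
    by (intro continuous_intros continuous_on_compose2[OF assms(3)]) auto
  have c': "continuous_on (sphere 0 r \<times> cbox 0 (2*pi))
      (\<lambda>(z,s). poisson_kernel (z + t) (of_real R * cis s) * \<phi> (of_real R * cis s))"
    unfolding case_prod_unfold
    by (rule continuous_on_compose2[OF c[unfolded case_prod_unfold],
          where f = "\<lambda>p. (fst p, of_real R * cis (snd p))", simplified])
       (use R in \<open>auto intro!: continuous_intros simp: norm_mult\<close>)
  have c'': "continuous_on (sphere 0 r) (\<lambda>z. integral (cbox 0 (2*pi))
     (\<lambda>s. poisson_kernel (z + t) (of_real R * cis s) * \<phi> (of_real R * cis s)))"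
    by (rule integral_continuous_on_param[OF c'])
  then show "continuous_on (sphere 0 r) (\<lambda>z. circ_mean R (\<lambda>w. poisson_kernel (z + t) w * \<phi> w))"
    unfolding circ_mean_def by (intro continuous_on_divide) auto
  have "circ_mean r (\<lambda>z. circ_mean R (\<lambda>w. poisson_kernel (z + t) w * \<phi> w)) =
        circ_mean R (\<lambda>w. circ_mean r (\<lambda>z. \<phi> w * poisson_kernel (z + t) w))"
    using circ_mean_swap[OF c] assms R by (simp add: mult.commute)
  also have "\<dots> = circ_mean R (\<lambda>w. poisson_kernel t w * \<phi> w)"
    using R circ_mean_poisson_kernel_shift[OF assms(1,2)]
    by (intro circ_mean_cong) (auto simp: circ_mean_cmult)
  finally show "circ_mean r (\<lambda>z. circ_mean R (\<lambda>w. poisson_kernel (z + t) w * \<phi> w)) =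
         circ_mean R (\<lambda>w. poisson_kernel t w * \<phi> w)" .
qed

text \<open>The harmonic majorant of log+ |A| is averaged over the shifted circle before the kernel
  is estimated. Only its value at \<open>t\<close> remains, so the factor involves |t| and not
  \<open>r\<close>, and is bounded once R exceeds 2 |t|.\<close>

lemma nev_T_shift:
  assumes "A holomorphic_on UNIV" "cmod t + r < R" "r > 0"
  shows "nev_T r (\<lambda>z. A (z + t)) \<le> (R + cmod t) / (R - cmod t) * nev_T R A"
proof -
  have t: "cmod t < R" "R > 0" using assms norm_ge_zero[of t] by linarith+
  have zt: "cmod (z + t) < R" if "cmod z = r" for z
    using that assms(2) norm_triangle_ineq[of z t] by simp
  have "nev_T r (\<lambda>z. A (z + t)) \<le>
     circ_mean r (\<lambda>z. circ_mean R (\<lambda>w. poisson_kernel (z + t) w * lnp (cmod (A w))))"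
    unfolding nev_T_circ_mean using assms zt
    by (intro circ_mean_mono circ_mean_poisson_integral lnp_le_poisson continuous_intros entire_shift) auto
  also have "\<dots> = circ_mean R (\<lambda>w. poisson_kernel t w * lnp (cmod (A w)))"
    using assms by (intro circ_mean_poisson_integral continuous_intros) auto
  also have "\<dots> \<le> circ_mean R (\<lambda>w. (R + cmod t) / (R - cmod t) * lnp (cmod (A w)))"
    using assms t by (intro circ_mean_mono continuous_intros mult_right_mono poisson_kernel_le) auto
  finally show ?thesis unfolding circ_mean_cmult nev_T_circ_mean .
qed

lemma nev_T_mono:
  assumes "A holomorphic_on UNIV" "0 < r" "r \<le> R"
  shows "nev_T r A \<le> nev_T R A"
  using nev_T_shift[of A 0 r R] assms by (cases "r = R") auto

lemma abs_circ_mean_le: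
  assumes "continuous_on (sphere 0 r) \<phi>" "r \<ge> 0"
  shows "\<bar>circ_mean r \<phi>\<bar> \<le> circ_mean r (\<lambda>z. \<bar>\<phi> z\<bar>)"
proof -
  have "circ_mean r \<phi> \<le> circ_mean r (\<lambda>z. \<bar>\<phi> z\<bar>)"
    using assms by (intro circ_mean_mono continuous_intros) auto
  moreover have "circ_mean r (\<lambda>z. (-1) * \<phi> z) \<le> circ_mean r (\<lambda>z. \<bar>\<phi> z\<bar>)"
    using assms by (intro circ_mean_mono continuous_intros) auto
  ultimately show ?thesis unfolding circ_mean_cmult by linarith
qed

text \<open>The difference is the real part of 2wt / ((w - z - t)(w - z)). Since 2|t| \<le> R - r,
  the first factor below is at least |w - z| / 2. Writing R^2 - r^2 as (R - r)(R + r) restores the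
  kernel and leaves the gain |t| / (R - r).\<close>

lemma poisson_kernel_shift_diff:
  assumes "cmod z = r" "cmod w = R" "r < R" "2 * cmod t \<le> R - r"
  shows "\<bar>poisson_kernel (z + t) w - poisson_kernel z w\<bar> \<le> 4 * cmod t / (R - r) * poisson_kernel z w"
proof -
  have d: "R - r \<le> cmod (w - z)" using norm_triangle_ineq2[of w z] assms by simp
  have d2: "cmod (w - z) \<le> cmod (w - (z + t)) + cmod t"
    using norm_triangle_ineq[of "w - (z + t)" t] by simp
  with d assms have d3: "cmod (w - z) / 2 \<le> cmod (w - (z + t))" by linarith
  have pos: "cmod (w - z) > 0" "R > 0" using d assms norm_ge_zero[of z] by linarith+
  have ne: "w \<noteq> z" "w \<noteq> z + t" using pos d3 by auto
  have "poisson_kernel (z + t) w - poisson_kernel z w =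
      Re ((w + (z + t)) / (w - (z + t)) - (w + z) / (w - z))"
    using ne by (simp add: poisson_kernel_Re)
  also have "(w + (z + t)) / (w - (z + t)) - (w + z) / (w - z) = 2 * w * t / ((w - (z + t)) * (w - z))"
    using ne by (simp add: divide_simps) (simp add: algebra_simps)
  finally have "\<bar>poisson_kernel (z + t) w - poisson_kernel z w\<bar> \<le>
      cmod (2 * w * t / ((w - (z + t)) * (w - z)))"
    using abs_Re_le_cmod by metis
  also have "\<dots> = 2 * R * cmod t / (cmod (w - (z + t)) * cmod (w - z))"
    using assms by (simp add: norm_mult norm_divide)
  also have "\<dots> \<le> 2 * R * cmod t / (cmod (w - z) / 2 * cmod (w - z))"
    using d3 pos ne by (intro divide_left_mono mult_right_mono mult_pos_pos) auto
  also have "\<dots> = 4 * cmod t * R / (cmod (w - z))\<^sup>2"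
    by (simp add: power2_eq_square)
  also have "\<dots> \<le> 4 * cmod t * ((R + r) / (cmod (w - z))\<^sup>2)"
    using assms norm_ge_zero[of z] by (simp add: divide_right_mono mult_left_mono)
  also have "\<dots> = 4 * cmod t / (R - r) * poisson_kernel z w"
  proof -
    have "poisson_kernel z w = (R - r) * ((R + r) / (cmod (w - z))\<^sup>2)"
      using assms by (simp add: poisson_kernel_def power2_eq_square algebra_simps)
    then show ?thesis using assms by simp
  qed
  finally show ?thesis .
qed

text \<open>Each difference is bounded by a Poisson integral of |Re g|; averaging over |z| = r
  evaluates that integral at 0, where it is the plain mean.\<close>

lemma circ_mean_Re_shift_diff:
  assumes g: "g holomorphic_on UNIV" and r: "0 < r" "r < R" "2 * cmod t \<le> R - r"
  shows "circ_mean r (\<lambda>z. \<bar>Re (g (z + t)) - Re (g z)\<bar>) \<le>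
         4 * cmod t / (R - r) * circ_mean R (\<lambda>w. \<bar>Re (g w)\<bar>)"
proof -
  have gc: "continuous_on (sphere 0 R) (\<lambda>w. Re (g w))" by (intro continuous_intros entire_continuous_on g)
  have zt: "cmod (z + t) < R" "cmod z < R" if "cmod z = r" for z
    using that r norm_triangle_ineq[of z t] norm_ge_zero[of t] by linarith+
  have K: "continuous_on (sphere 0 R) (poisson_kernel z)" if "cmod z < R" for z
    using that by (intro continuous_intros) auto
  \<comment> \<open>Written with \<open>z + 0\<close> so that
    \<open>circ_mean_poisson_integral\<close> applies with shift 0.\<close>
  have "\<bar>Re (g (z + t)) - Re (g z)\<bar> \<le>
     4 * cmod t / (R - r) * circ_mean R (\<lambda>w. poisson_kernel (z + 0) w * \<bar>Re (g w)\<bar>)" if z: "cmod z = r" for z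
  proof -
    have "Re (g (z + t)) - Re (g z) =
        circ_mean R (\<lambda>w. poisson_kernel (z + t) w * Re (g w) - poisson_kernel z w * Re (g w))"
      using r zt[OF z] by (subst circ_mean_diff)
        (auto intro!: continuous_intros K gc simp: poisson_integral_entire[OF g])
    also have "\<bar>\<dots>\<bar> \<le> circ_mean R (\<lambda>w. \<bar>poisson_kernel (z + t) w * Re (g w) - poisson_kernel z w * Re (g w)\<bar>)"
      using r zt[OF z] by (intro abs_circ_mean_le) (auto intro!: continuous_intros K gc)
    also have "\<dots> \<le> circ_mean R (\<lambda>w. 4 * cmod t / (R - r) * (poisson_kernel (z + 0) w * \<bar>Re (g w)\<bar>))"
    proof (rule circ_mean_mono)
      fix w assume w: "cmod w = R"
      have "\<bar>poisson_kernel (z + t) w * Re (g w) - poisson_kernel z w * Re (g w)\<bar> =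
         \<bar>poisson_kernel (z + t) w - poisson_kernel z w\<bar> * \<bar>Re (g w)\<bar>"
        by (simp add: abs_mult flip: left_diff_distrib)
      also have "\<dots> \<le> 4 * cmod t / (R - r) * poisson_kernel z w * \<bar>Re (g w)\<bar>"
        by (intro mult_right_mono poisson_kernel_shift_diff z w r) auto
      finally show "\<bar>poisson_kernel (z + t) w * Re (g w) - poisson_kernel z w * Re (g w)\<bar> \<le>
          4 * cmod t / (R - r) * (poisson_kernel (z + 0) w * \<bar>Re (g w)\<bar>)" by (simp add: mult.assoc)
    qed (use r zt[OF z] in \<open>auto intro!: continuous_intros K gc\<close>)
    finally show ?thesis unfolding circ_mean_cmult .
  qed
  then have "circ_mean r (\<lambda>z. \<bar>Re (g (z + t)) - Re (g z)\<bar>) \<le>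
     circ_mean r (\<lambda>z. 4 * cmod t / (R - r) * circ_mean R (\<lambda>w. poisson_kernel (z + 0) w * \<bar>Re (g w)\<bar>))"
    using r by (intro circ_mean_mono)
       (auto intro!: continuous_intros circ_mean_poisson_integral gc entire_continuous_on g entire_shift simp del: add_0_right)
  also have "\<dots> = 4 * cmod t / (R - r) * circ_mean R (\<lambda>w. poisson_kernel 0 w * \<bar>Re (g w)\<bar>)"
    unfolding circ_mean_cmult using r
    by (subst circ_mean_poisson_integral(2)) (auto intro!: continuous_intros gc)
  also have "circ_mean R (\<lambda>w. poisson_kernel 0 w * \<bar>Re (g w)\<bar>) = circ_mean R (\<lambda>w. \<bar>Re (g w)\<bar>)"
    using r by (intro circ_mean_cong) (auto simp: poisson_kernel_def)
  finally show ?thesis .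
qed

lemma nev_T_exp:
  "nev_T r (\<lambda>z. exp (g z)) = circ_mean r (\<lambda>z. max 0 (Re (g z)))"
  by (simp add: nev_T_circ_mean)

lemma circ_mean_abs_Re:
  assumes "g holomorphic_on UNIV" "R > 0"
  shows "circ_mean R (\<lambda>w. \<bar>Re (g w)\<bar>) = 2 * nev_T R (\<lambda>z. exp (g z)) - Re (g 0)"
proof -
  have c: "continuous_on S (\<lambda>w. Re (g w))" for S by (intro continuous_intros entire_continuous_on assms)
  have "circ_mean R (\<lambda>w. \<bar>Re (g w)\<bar>) = circ_mean R (\<lambda>w. 2 * max 0 (Re (g w)) - Re (g w))"
    by (intro circ_mean_cong) (use assms in auto)
  also have "\<dots> = 2 * nev_T R (\<lambda>z. exp (g z)) - circ_mean R (\<lambda>w. Re (g (0 + w)))"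
    unfolding nev_T_exp using assms by (subst circ_mean_diff) (auto intro!: continuous_intros c simp: circ_mean_cmult)
  also have "circ_mean R (\<lambda>w. Re (g (0 + w))) = Re (g 0)"
    using assms by (intro circ_mean_Re_holomorphic[of _ UNIV]) auto
  finally show ?thesis .
qed

text \<open>A difference analogue of the lemma on the logarithmic derivative for a zero-free
  function. The gain 1 / (R - r) is the source of all smallness of shift quotients.\<close>

lemma nev_T_exp_shift_diff:
  assumes g: "g holomorphic_on UNIV" and r: "0 < r" "r < R" "2 * cmod t \<le> R - r"
  shows "nev_T r (\<lambda>z. exp (g (z + t) - g z)) \<le> 4 * cmod t / (R - r) * (2 * nev_T R (\<lambda>z. exp (g z)) - Re (g 0))"
proof -
  have "nev_T r (\<lambda>z. exp (g (z + t) - g z)) \<le> circ_mean r (\<lambda>z. \<bar>Re (g (z + t)) - Re (g z)\<bar>)"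
    unfolding nev_T_exp using r
    by (intro circ_mean_mono continuous_intros entire_continuous_on g entire_shift) auto
  also have "\<dots> \<le> 4 * cmod t / (R - r) * (2 * nev_T R (\<lambda>z. exp (g z)) - Re (g 0))"
    using circ_mean_Re_shift_diff[OF assms] circ_mean_abs_Re[OF g, of R] r by simp
  finally show ?thesis .
qed

section \<open>Characteristics of sums and products\<close>

lemma nev_T_add:
  assumes "A holomorphic_on UNIV" "B holomorphic_on UNIV" "r \<ge> 0"
  shows "nev_T r (\<lambda>z. A z + B z) \<le> nev_T r A + nev_T r B + ln 2"
proof -
  have "nev_T r (\<lambda>z. A z + B z) \<le> circ_mean r (\<lambda>z. lnp (cmod (A z)) + lnp (cmod (B z)) + ln 2)"
    unfolding nev_T_circ_mean using assms
    by (intro circ_mean_mono continuous_intros entire_continuous_on holomorphic_intros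
         order_trans[OF lnp_mono[OF norm_triangle_ineq] lnp_add]) auto
  also have "\<dots> = nev_T r A + nev_T r B + ln 2"
    unfolding nev_T_circ_mean using assms by (simp add: circ_mean_add continuous_intros)
  finally show ?thesis .
qed

lemma nev_T_mult:
  assumes "A holomorphic_on UNIV" "B holomorphic_on UNIV" "r \<ge> 0"
  shows "nev_T r (\<lambda>z. A z * B z) \<le> nev_T r A + nev_T r B"
proof -
  have "nev_T r (\<lambda>z. A z * B z) \<le> circ_mean r (\<lambda>z. lnp (cmod (A z)) + lnp (cmod (B z)))"
    unfolding nev_T_circ_mean norm_mult using assms
    by (intro circ_mean_mono continuous_intros lnp_mult entire_continuous_on) auto
  also have "\<dots> = nev_T r A + nev_T r B"
    unfolding nev_T_circ_mean using assms by (simp add: circ_mean_add continuous_intros)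
  finally show ?thesis .
qed

lemma nev_T_uminus: "nev_T r (\<lambda>z. - A z) = nev_T r A"
  by (simp add: nev_T_def)

lemma nev_T_diff:
  assumes "A holomorphic_on UNIV" "B holomorphic_on UNIV" "r \<ge> 0"
  shows "nev_T r (\<lambda>z. A z - B z) \<le> nev_T r A + nev_T r B + ln 2"
  using nev_T_add[of A "\<lambda>z. - B z" r] assms by (simp add: nev_T_uminus holomorphic_on_minus)

lemma nev_T_le_bound:
  assumes "A holomorphic_on UNIV" "r \<ge> 0" "\<And>z. cmod z = r \<Longrightarrow> lnp (cmod (A z)) \<le> C"
  shows "nev_T r A \<le> C"
  unfolding nev_T_circ_mean
  using circ_mean_mono[of r "\<lambda>z. lnp (cmod (A z))" "\<lambda>_. C"] assms by (auto intro!: continuous_intros)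


section \<open>Entire functions: division, Jensen's inequality, coefficients\<close>

text \<open>The exponent 0 is allowed, so \<open>z0\<close> need not be a zero. At a zero, some
  derivative is nonzero by the identity theorem, and the least such order gives the
  exponent.\<close>

lemma entire_factor_zero:
  assumes "A holomorphic_on UNIV" "A \<noteq> (\<lambda>_. 0)"
  obtains B k where "B holomorphic_on UNIV" "B z0 \<noteq> 0" "\<And>z. A z = (z - z0) ^ k * B z"
proof (cases "A z0 = 0")
  case False
  then show ?thesis using that[of A 0] assms by simp
next
  case True
  have ev: "\<exists>w. A w \<noteq> A z0" using True assms(2) by (auto simp: fun_eq_iff)
  have "\<exists>n>0. (deriv ^^ n) A z0 \<noteq> 0"
  proof (rule ccontr)
    assume "\<not> ?thesis"
    then have "A w = A z0" for w
      by (intro holomorphic_fun_eq_const_on_connected[OF assms(1)]) blast+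
    with ev show False by blast
  qed
  then obtain n where n: "n > 0" "(deriv ^^ n) A z0 \<noteq> 0" by blast
  define m where "m = (LEAST n. n > 0 \<and> (deriv ^^ n) A z0 \<noteq> 0)"
  have m: "m > 0 \<and> (deriv ^^ m) A z0 \<noteq> 0"
    unfolding m_def by (rule LeastI[of _ n]) (use n in auto)
  have m2: "(deriv ^^ i) A z0 = 0" if "0 < i" "i < m" for i
    using not_less_Least[of i "\<lambda>n. n > 0 \<and> (deriv ^^ n) A z0 \<noteq> 0"] that by (auto simp: m_def)
  obtain g r where g: "0 < r" "g holomorphic_on ball z0 r"
     "\<And>w. w \<in> ball z0 r \<Longrightarrow> A w - A z0 = (w - z0) ^ m * g w" "\<And>w. w \<in> ball z0 r \<Longrightarrow> g w \<noteq> 0"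
    by (rule holomorphic_factor_order_of_zero[OF assms(1) open_UNIV UNIV_I, of m z0]) (use m m2 in auto)
  define B where "B z = (if z = z0 then g z0 else A z / (z - z0) ^ m)" for z
  have B1: "B holomorphic_on ball z0 r"
  proof (rule holomorphic_transform[OF g(2)])
    show "g w = B w" if "w \<in> ball z0 r" for w
      using g(3)[OF that] True by (simp add: B_def)
  qed
  have "(\<lambda>z. A z / (z - z0) ^ m) holomorphic_on - {z0}"
    by (intro holomorphic_intros holomorphic_on_subset[OF assms(1)]) auto
  then have B2: "B holomorphic_on - {z0}"
    by (rule holomorphic_transform) (auto simp: B_def)
  have "B holomorphic_on ball z0 r \<union> - {z0}"
    by (intro holomorphic_on_Un B1 B2) auto
  also have "ball z0 r \<union> - {z0} = UNIV" using g(1) by auto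
  finally have "B holomorphic_on UNIV" .
  moreover have "B z0 \<noteq> 0" using g by (auto simp: B_def)
  moreover have "A z = (z - z0) ^ m * B z" for z using True m by (auto simp: B_def)
  ultimately show ?thesis using that by blast
qed

text \<open>Continuous majorants \<open>\<phi>\<close> avoid integrating \<open>ln |A|\<close> over circles that contain zeros of \<open>A\<close>.\<close>
lemma jensen_lower_bound:
  assumes "A holomorphic_on UNIV" "A \<noteq> (\<lambda>_. 0)"
  shows "\<exists>C. \<forall>r \<phi>. r \<ge> 1 \<longrightarrow> continuous_on (sphere 0 r) \<phi> \<longrightarrow>
      (\<forall>w. cmod w = r \<longrightarrow> cmod (A w) \<le> exp (\<phi> w)) \<longrightarrow> C \<le> circ_mean r \<phi>"
proof -
  obtain B k where B: "B holomorphic_on UNIV" "B 0 \<noteq> 0" "\<And>z. A z = (z - 0) ^ k * B z"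
    using entire_factor_zero[OF assms] by blast
  have "ln (cmod (B 0)) \<le> circ_mean r \<phi>" if r: "r \<ge> 1" and \<phi>: "continuous_on (sphere 0 r) \<phi>"
    and le: "\<And>w. cmod w = r \<Longrightarrow> cmod (A w) \<le> exp (\<phi> w)" for r \<phi>
  proof -
    have "cmod (B 0) \<le> exp (circ_mean r (\<lambda>w. poisson_kernel 0 w * \<phi> w))"
    proof (rule poisson_majorant[OF B(1) \<phi>])
      fix w assume w: "cmod w = r"
      have "1 * cmod (B w) \<le> cmod w ^ k * cmod (B w)"
        using w r by (intro mult_right_mono) auto
      also have "\<dots> \<le> exp (\<phi> w)" using le[OF w] by (simp add: B(3) norm_mult norm_power)
      finally show "cmod (B w) \<le> exp (\<phi> w)" by simp
    qed (use r in auto)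
    also have "circ_mean r (\<lambda>w. poisson_kernel 0 w * \<phi> w) = circ_mean r \<phi>"
      using r by (intro circ_mean_cong) (auto simp: poisson_kernel_def)
    finally show ?thesis using B(2) by (metis exp_le_cancel_iff exp_ln zero_less_norm_iff)
  qed
  then show ?thesis by (intro exI[of _ "ln (cmod (B 0))"]) simp
qed

text \<open>Stands in for the first fundamental theorem applied to the entire quotient A / B.
  Everywhere log |B| \<le> log+ |A| + log+ |B| - log+ |D|: trivially where |D| \<le> 1, and by |B| =
  |A| / |D| elsewhere. The right side is continuous, so Jensen's inequality for \<open>B\<close>
  applies to it.\<close>

lemma nev_T_factor_le:
  assumes "A holomorphic_on UNIV" "B holomorphic_on UNIV" "D holomorphic_on UNIV"
    and "\<And>z. A z = B z * D z" and "B \<noteq> (\<lambda>_. 0)"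
  obtains C where "\<And>r. r \<ge> 1 \<Longrightarrow> nev_T r D \<le> nev_T r A + nev_T r B + C"
proof -
  obtain C where C: "\<forall>r \<phi>. r \<ge> 1 \<longrightarrow> continuous_on (sphere 0 r) \<phi> \<longrightarrow>
      (\<forall>w. cmod w = r \<longrightarrow> cmod (B w) \<le> exp (\<phi> w)) \<longrightarrow> C \<le> circ_mean r \<phi>"
    using jensen_lower_bound[OF assms(2,5)] by blast
  have "nev_T r D \<le> nev_T r A + nev_T r B + (- C)" if r: "r \<ge> 1" for r
  proof -
    have "C \<le> circ_mean r (\<lambda>z. lnp (cmod (A z)) + lnp (cmod (B z)) - lnp (cmod (D z)))"
    proof (rule C[rule_format, OF r])
      fix w
      show "cmod (B w) \<le> exp (lnp (cmod (A w)) + lnp (cmod (B w)) - lnp (cmod (D w)))"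
      proof (cases "cmod (D w) \<le> 1")
        case True
        then have "lnp (cmod (B w)) \<le> lnp (cmod (A w)) + lnp (cmod (B w)) - lnp (cmod (D w))"
          by (simp add: lnp_def[of "cmod (D w)"])
        then show ?thesis by (intro order_trans[OF le_exp_lnp[of "cmod (B w)"]]) (simp only: exp_le_cancel_iff)
      next
        case False
        then have D: "cmod (D w) > 0" by linarith
        with False have lnD: "lnp (cmod (D w)) = ln (cmod (D w))" by (simp add: lnp_def)
        have "cmod (B w) = cmod (A w) / cmod (D w)"
          using D unfolding assms(4) norm_mult by simp
        also have "\<dots> \<le> exp (lnp (cmod (A w)) + lnp (cmod (B w))) / cmod (D w)"
          by (intro divide_right_mono order_trans[OF le_exp_lnp[of "cmod (A w)"]]) auto
        also have "\<dots> = exp (lnp (cmod (A w)) + lnp (cmod (B w)) - lnp (cmod (D w)))"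
          unfolding lnD exp_diff using D by simp
        finally show ?thesis .
      qed
    qed (intro continuous_intros assms)
    also have "\<dots> = circ_mean r (\<lambda>z. lnp (cmod (A z)) + lnp (cmod (B z))) - nev_T r D"
      unfolding nev_T_circ_mean using r by (intro circ_mean_diff continuous_intros assms) auto
    also have "circ_mean r (\<lambda>z. lnp (cmod (A z)) + lnp (cmod (B z))) = nev_T r A + nev_T r B"
      unfolding nev_T_circ_mean using r by (intro circ_mean_add continuous_intros assms) auto
    finally show ?thesis by simp
  qed
  then show ?thesis by (rule that)
qed

text \<open>The coefficient of \<open>z ^ k\<close> is recovered from \<open>Re g\<close> alone, because the mean of
  \<open>z ^ k * g z\<close> over a circle vanishes.\<close>
lemma taylor_coeff_le_circ_mean_Re:
  assumes g: "g holomorphic_on UNIV" and "k > 0" "r > 0"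
  shows "cmod ((deriv ^^ k) g 0) / fact k * r ^ k \<le> 2 * circ_mean r (\<lambda>z. \<bar>Re (g z)\<bar>)"
proof -
  have gc: "continuous_on S (\<lambda>z. g z)" for S by (rule entire_continuous_on[OF g])
  define a where "a = (deriv ^^ k) g 0 / fact k"
  have "((\<lambda>u. g u / (u - 0) ^ Suc k) has_contour_integral (2 * pi * \<i> / fact k * (deriv ^^ k) g 0))
      (circlepath 0 r)"
    by (intro Cauchy_has_contour_integral_higher_derivative_circlepath)
       (use assms in \<open>auto intro: entire_continuous_on holomorphic_on_subset\<close>)
  then have "((\<lambda>t. g (0 + r * cis t) / (0 + r * cis t - 0) ^ Suc k * r * \<i> * cis t)
     has_integral (2 * of_real pi * \<i> / fact k * (deriv ^^ k) g 0)) {0..2*pi}"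
    unfolding circlepath_def by (subst (asm) has_contour_integral_part_circlepath_iff) auto
  note 0 = has_integral_mult_right[OF this, of "-\<i> * r ^ k"]
  have 1: "((\<lambda>t. g (r * cis t) / cis t ^ k) has_integral (2 * of_real pi * (a * r ^ k))) {0..2*pi}"
  proof (rule has_integral_eq_rhs[OF has_integral_eq[OF _ 0]])
    show "- \<i> * of_real (r ^ k) * (g (0 + r * cis t) / (0 + r * cis t - 0) ^ Suc k * r * \<i> * cis t) =
        g (r * cis t) / cis t ^ k" for t
      using assms(3) by (simp add: power_mult_distrib) (simp add: mult_ac)
  qed (simp add: a_def mult_ac)
  have "(\<lambda>z. g z * z ^ k) holomorphic_on UNIV" by (intro holomorphic_intros g)
  from mean_value_holomorphic[OF this open_UNIV, of 0 r] assms
  have "((\<lambda>t. g (r * cis t) * (r * cis t) ^ k) has_integral 0) {0..2*pi}"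
    by (simp add: power_0_left)
  note 5 = has_integral_mult_right[OF this, of "1 / of_real (r ^ k)"]
  have "((\<lambda>t. g (r * cis t) * cis t ^ k) has_integral 0) {0..2*pi}"
  proof (rule has_integral_eq_rhs[OF has_integral_eq[OF _ 5]])
    show "1 / of_real (r ^ k) * (g (r * cis t) * (r * cis t) ^ k) = g (r * cis t) * cis t ^ k" for t
      using assms(3) by (simp add: power_mult_distrib)
  qed simp
  then have "((\<lambda>t. cnj (g (r * cis t) * cis t ^ k)) has_integral cnj 0) {0..2*pi}"
    using has_integral_linear[OF _ bounded_linear_cnj, unfolded o_def] by blast
  note 3 = has_integral_add[OF 1 this]
  have 4: "g (r * cis t) / cis t ^ k + cnj (g (r * cis t) * cis t ^ k) =
       of_real (2 * Re (g (r * cis t))) / cis t ^ k" for t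
  proof -
    have "cnj (cis t ^ k) = inverse (cis t ^ k)"
      unfolding complex_cnj_power cis_cnj cis_inverse[symmetric] by (rule power_inverse)
    then have "g (r * cis t) / cis t ^ k + cnj (g (r * cis t) * cis t ^ k) =
        (g (r * cis t) + cnj (g (r * cis t))) / cis t ^ k"
      by (simp only: complex_cnj_mult) (simp add: divide_inverse distrib_right)
    then show ?thesis by (simp only: complex_add_cnj)
  qed
  have 2: "((\<lambda>t. of_real (2 * Re (g (r * cis t))) / cis t ^ k) has_integral (2 * of_real pi * (a * r ^ k))) {0..2*pi}"
    using 3 unfolding 4 complex_cnj_zero add_0_right .
  have "cmod (integral {0..2*pi} (\<lambda>t. of_real (2 * Re (g (r * cis t))) / cis t ^ k))
      \<le> integral {0..2*pi} (\<lambda>t. 2 * \<bar>Re (g (r * cis t))\<bar>)"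
  proof (rule integral_norm_bound_integral)
    show "(\<lambda>t. of_real (2 * Re (g (r * cis t))) / cis t ^ k) integrable_on {0..2*pi}"
      using 2 by (rule has_integral_integrable)
    show "(\<lambda>t. 2 * \<bar>Re (g (r * cis t))\<bar>) integrable_on {0..2*pi}"
      using assms(3) by (intro circ_mean_integrable[of r "\<lambda>z. 2 * \<bar>Re (g z)\<bar>"] continuous_intros gc) auto
  qed (simp add: norm_divide norm_power norm_mult)
  then have "2 * pi * (cmod a * r ^ k) \<le> 2 * integral {0..2*pi} (\<lambda>t. \<bar>Re (g (r * cis t))\<bar>)"
    using integral_unique[OF 2] assms(3) by (simp add: norm_mult norm_power)
  then have "cmod a * r ^ k \<le> 2 * circ_mean r (\<lambda>z. \<bar>Re (g z)\<bar>)"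
    using pi_gt_zero by (simp add: circ_mean_def pos_le_divide_eq mult_ac)
  then show ?thesis by (simp add: a_def norm_divide)
qed

lemma taylor_coeff_le_nev_T_exp:
  assumes "g holomorphic_on UNIV" "k > 0" "r > 0"
  shows "cmod ((deriv ^^ k) g 0) / fact k * r ^ k \<le> 4 * nev_T r (\<lambda>z. exp (g z)) - 2 * Re (g 0)"
  using taylor_coeff_le_circ_mean_Re[OF assms] circ_mean_abs_Re[OF assms(1,3)] by simp


section \<open>Hadamard factorisation\<close>

text \<open>Order at most \<open>s\<close> with finite type. The base 1 + |z| makes the bound
  global, without an exception near the origin, and stable under shifts.\<close>

definition exp_growth :: "real \<Rightarrow> (complex \<Rightarrow> complex) \<Rightarrow> bool" where
  "exp_growth s f \<longleftrightarrow> (\<exists>C. \<forall>z. cmod (f z) \<le> exp (C * (1 + cmod z) powr s))"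

lemma exp_growthI: "(\<And>z. cmod (f z) \<le> exp (C * (1 + cmod z) powr s)) \<Longrightarrow> exp_growth s f"
  by (auto simp: exp_growth_def)

lemma exp_growthE:
  assumes "exp_growth s f"
  obtains C where "C \<ge> 0" "\<And>z. cmod (f z) \<le> exp (C * (1 + cmod z) powr s)"
proof -
  obtain C where C: "\<And>z. cmod (f z) \<le> exp (C * (1 + cmod z) powr s)"
    using assms by (auto simp: exp_growth_def)
  have "C * (1 + cmod z) powr s \<le> \<bar>C\<bar> * (1 + cmod z) powr s" for z
    by (intro mult_right_mono) auto
  then have "cmod (f z) \<le> exp (\<bar>C\<bar> * (1 + cmod z) powr s)" for z
    using C[of z] by (meson exp_le_cancel_iff order_trans)
  then show ?thesis using that[of "\<bar>C\<bar>"] by simp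
qed

lemma exp_growth_mult:
  assumes "exp_growth s f" "exp_growth s g"
  shows "exp_growth s (\<lambda>z. f z * g z)"
proof -
  obtain C D where "\<And>z. cmod (f z) \<le> exp (C * (1 + cmod z) powr s)"
     "\<And>z. cmod (g z) \<le> exp (D * (1 + cmod z) powr s)"
    using assms by (auto simp: exp_growth_def)
  then have "cmod (f z * g z) \<le> exp ((C + D) * (1 + cmod z) powr s)" for z
    by (auto simp: norm_mult distrib_right exp_add intro!: mult_mono)
  then show ?thesis by (rule exp_growthI)
qed

lemma ln_le_powr_div:
  fixes u s :: real
  assumes "u > 0" "s > 0"
  shows "ln u \<le> u powr s / s"
proof -
  have "s * ln u = ln (u powr s)" using assms by (simp add: powr_def)
  also have "\<dots> \<le> u powr s" using assms by (intro less_imp_le ln_less_self) auto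
  finally show ?thesis using assms by (simp add: field_simps)
qed

lemma exp_growth_const: "s > 0 \<Longrightarrow> exp_growth s (\<lambda>_. k)"
proof (rule exp_growthI[of _ "cmod k"])
  fix z :: complex assume s: "s > 0"
  have "cmod k \<le> exp (cmod k)" using exp_ge_add_one_self[of "cmod k"] by linarith
  also have "cmod k * 1 \<le> cmod k * (1 + cmod z) powr s"
    using s by (intro mult_left_mono ge_one_powr_ge_zero) auto
  then have "exp (cmod k) \<le> exp (cmod k * (1 + cmod z) powr s)" by simp
  finally show "cmod k \<le> exp (cmod k * (1 + cmod z) powr s)" .
qed

lemma exp_growth_linear:
  assumes "s > 0"
  shows "exp_growth s (\<lambda>z. z - w)"
proof -
  have "exp_growth s (\<lambda>z. of_real ((1 + cmod w)) * of_real ((1 + cmod z)))"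
  proof (intro exp_growth_mult exp_growth_const assms exp_growthI[of _ "1 / s"])
    fix z
    have "1 + cmod z = exp (ln (1 + cmod z))" by (simp add: add_pos_nonneg)
    also have "\<dots> \<le> exp (1 / s * (1 + cmod z) powr s)"
      using ln_le_powr_div[of "1 + cmod z" s] assms unfolding exp_le_cancel_iff by (simp add: add_pos_nonneg)
    finally show "cmod (of_real (1 + cmod z)) \<le> exp (1 / s * (1 + cmod z) powr s)"
      unfolding norm_of_real by (simp add: add_nonneg_nonneg)
  qed
  moreover have "cmod (z - w) \<le> cmod (of_real (1 + cmod w) * of_real (1 + cmod z))" for z
  proof -
    have "cmod (z - w) \<le> cmod z + cmod w" by (rule norm_triangle_ineq4)
    also have "\<dots> \<le> (1 + cmod w) * (1 + cmod z)" by (simp add: algebra_simps)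
    also have "\<dots> = cmod (of_real (1 + cmod w) * of_real (1 + cmod z))"
      unfolding norm_mult norm_of_real by (simp add: add_nonneg_nonneg)
    finally show ?thesis .
  qed
  ultimately show ?thesis unfolding exp_growth_def by (meson order_trans)
qed

lemma exp_growth_power:
  assumes "exp_growth s f" "s > 0"
  shows "exp_growth s (\<lambda>z. f z ^ k)"
  by (induction k) (auto intro: exp_growth_mult exp_growth_const assms)

text \<open>For |z| \<le> 1/2 the factor differs from 1 by at most 3 |z|^(p+1) \<le> 3 |z|^s. For
  |z| > 1/2 all powers up to \<open>p\<close> are at most (2|z|)^s, and 1 + |z| < 3|z| turns the
  logarithm of the linear factor into a multiple of |z|^s.\<close>

lemma weierstrass_factor_growth:
  fixes s :: real
  assumes "s > 0" "real p \<le> s" "s \<le> real (Suc p)"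
  obtains A where "A \<ge> 0" "\<And>z. cmod (weierstrass_factor p z) \<le> exp (A * cmod z powr s)"
proof -
  define A where "A = 3 + real p * 2 powr s + 3 powr s / s"
  have A: "A \<ge> 0" "3 \<le> A" "real p * 2 powr s + 3 powr s / s \<le> A" using assms by (auto simp: A_def)
  have "cmod (weierstrass_factor p z) \<le> exp (A * cmod z powr s)" for z
  proof (cases "cmod z \<le> 1/2")
    case True
    have "cmod (weierstrass_factor p z) \<le> 1 + cmod (weierstrass_factor p z - 1)"
      using norm_triangle_ineq[of 1 "weierstrass_factor p z - 1"] by simp
    also have "\<dots> \<le> 1 + 3 * cmod z ^ Suc p" using weierstrass_factor_bound[OF True, of p] by simp
    also have "cmod z ^ Suc p \<le> cmod z powr s"
    proof (cases "z = 0")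
      case False
      then have "cmod z ^ Suc p = cmod z powr real (Suc p)" using powr_realpow[of "cmod z" "Suc p"] by simp
      also have "\<dots> \<le> cmod z powr s" using True assms False by (intro powr_mono') auto
      finally show ?thesis .
    qed auto
    also have "1 + 3 * cmod z powr s \<le> 1 + A * cmod z powr s"
      using A by (intro add_left_mono mult_right_mono) auto
    also have "\<dots> \<le> exp (A * cmod z powr s)" by (rule exp_ge_add_one_self)
    finally show ?thesis by simp
  next
    case False
    then have z: "cmod z > 1/2" by simp
    have "cmod (weierstrass_factor p z) \<le> (1 + cmod z) * exp (cmod (\<Sum>k=1..p. z ^ k / of_nat k))"
      unfolding weierstrass_factor_def norm_mult
      using norm_triangle_ineq4[of 1 z] by (intro mult_mono norm_exp) auto
    also have "cmod (\<Sum>k=1..p. z ^ k / of_nat k) \<le> (\<Sum>k=1..p. (2 * cmod z) powr s)"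
    proof (intro sum_norm_le)
      fix k assume k: "k \<in> {1..p}"
      have "cmod (z ^ k / of_nat k) \<le> cmod z ^ k"
        using k by (simp add: norm_divide norm_power divide_le_eq mult_le_cancel_left1)
      also have "\<dots> \<le> (2 * cmod z) ^ k" by (intro power_mono) auto
      also have "\<dots> = (2 * cmod z) powr real k" using z by (subst powr_realpow) auto
      also have "\<dots> \<le> (2 * cmod z) powr s" using k assms z by (intro powr_mono) auto
      finally show "cmod (z ^ k / of_nat k) \<le> (2 * cmod z) powr s" .
    qed
    also have "(\<Sum>k=1..p. (2 * cmod z) powr s) = real p * 2 powr s * cmod z powr s"
      by (simp add: powr_mult)
    also have "1 + cmod z = exp (ln (1 + cmod z))" by (simp add: add_pos_nonneg)
    also have "ln (1 + cmod z) \<le> 3 powr s / s * cmod z powr s"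
    proof -
      have "ln (1 + cmod z) \<le> (1 + cmod z) powr s / s"
        using assms by (intro ln_le_powr_div) (auto simp: add_pos_nonneg)
      also have "\<dots> \<le> (3 * cmod z) powr s / s"
        using assms z by (intro divide_right_mono powr_mono2) auto
      finally show ?thesis by (simp add: powr_mult)
    qed
    finally have "cmod (weierstrass_factor p z) \<le>
        exp (3 powr s / s * cmod z powr s) * exp (real p * 2 powr s * cmod z powr s)"
      by (simp add: mult_mono)
    also have "\<dots> = exp ((real p * 2 powr s + 3 powr s / s) * cmod z powr s)"
      by (simp add: algebra_simps flip: exp_add)
    also have "\<dots> \<le> exp (A * cmod z powr s)"
      using A(3) by (simp add: mult_right_mono)
    finally show ?thesis .
  qed
  with A(1) show ?thesis by (rule that)
qed

text \<open>With the constant genus floor(s), both facts reduce to the given sum: convergence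
  because (r/|a n|)^(p+1) \<le> (r/|a n|)^s eventually, and growth because the exponents A |z / a
  n|^s of the factors add up to A |z|^s times that sum. The bound holds for partial products and
  passes to the limit.\<close>

lemma canonical_product_exists:
  fixes a :: "nat \<Rightarrow> complex"
  assumes "\<And>n. a n \<noteq> 0" "filterlim a at_infinity at_top" "s > 0"
    and sum: "summable (\<lambda>n. cmod (a n) powr (- s))"
  obtains H where "H holomorphic_on UNIV" "\<And>z. H z = 0 \<longleftrightarrow> z \<in> range a"
    "\<And>z. zorder H z = int (card (a -` {z}))" "exp_growth s H"
proof -
  define p where "p = nat \<lfloor>s\<rfloor>"
  have p: "real p \<le> s" "s \<le> real (Suc p)"
    using assms(3) unfolding p_def by linarith+
  interpret W: weierstrass_product a "\<lambda>_. p"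
  proof
    fix r :: real assume r: "r > 0"
    show "summable (\<lambda>n. (r / cmod (a n)) ^ Suc p)"
    proof (rule summable_comparison_test_ev)
      have "eventually (\<lambda>n. cmod (a n) \<ge> r) at_top"
        using assms(2) by (metis filterlim_at_infinity_imp_norm_at_top filterlim_at_top)
      then show "eventually (\<lambda>n. norm ((r / cmod (a n)) ^ Suc p) \<le> r powr s * cmod (a n) powr (- s)) at_top"
      proof eventually_elim
        case (elim n)
        have "(r / cmod (a n)) ^ Suc p = (r / cmod (a n)) powr real (Suc p)"
          using r assms(1)[of n] by (subst powr_realpow) auto
        also have "\<dots> \<le> (r / cmod (a n)) powr s"
          using p r elim assms(1)[of n] by (intro powr_mono') (auto simp: divide_le_eq)
        also have "\<dots> = r powr s * cmod (a n) powr (- s)"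
          using r by (simp add: powr_divide powr_minus_divide)
        finally show ?case using r by simp
      qed
    qed (intro summable_mult sum)
  qed (use assms in auto)
  obtain A where A: "A \<ge> 0" "\<And>z. cmod (weierstrass_factor p z) \<le> exp (A * cmod z powr s)"
    using weierstrass_factor_growth[OF assms(3) p] by blast
  define S where "S = (\<Sum>n. cmod (a n) powr (- s))"
  have S: "(\<Sum>n\<le>N. cmod (a n) powr (- s)) \<le> S" for N
    unfolding S_def by (rule sum_le_suminf[OF sum]) auto
  have bound: "cmod (W.f z) \<le> exp (A * S * (1 + cmod z) powr s)" for z
  proof -
    have "(\<lambda>N. \<Prod>n\<le>N. weierstrass_factor p (z / a n)) \<longlonglongrightarrow> W.f z"
      using convergent_prod_LIMSEQ[OF W.convergent[of z]] by (simp add: W.f_def)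
    then have lim: "(\<lambda>N. cmod (\<Prod>n\<le>N. weierstrass_factor p (z / a n))) \<longlonglongrightarrow> cmod (W.f z)"
      by (rule tendsto_norm)
    show ?thesis
    proof (rule LIMSEQ_le_const2[OF lim], intro exI allI impI)
      fix N
      have "cmod (\<Prod>n\<le>N. weierstrass_factor p (z / a n)) \<le> (\<Prod>n\<le>N. exp (A * cmod (z / a n) powr s))"
        unfolding prod_norm[symmetric] by (intro prod_mono) (auto intro: A)
      also have "\<dots> = exp (\<Sum>n\<le>N. A * cmod (z / a n) powr s)" by (simp add: exp_sum)
      also have "(\<Sum>n\<le>N. A * cmod (z / a n) powr s) = A * cmod z powr s * (\<Sum>n\<le>N. cmod (a n) powr (- s))"
        by (simp add: sum_distrib_left norm_divide powr_divide powr_minus_divide)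
      also have "\<dots> \<le> A * cmod z powr s * S"
        using A(1) S by (intro mult_left_mono) auto
      also have "\<dots> \<le> A * (1 + cmod z) powr s * S"
        using A(1) S[of 0] assms(3) order_trans[OF _ S[of 0], of 0]
        by (intro mult_right_mono mult_left_mono powr_mono2) auto
      finally show "cmod (\<Prod>n\<le>N. weierstrass_factor p (z / a n)) \<le> exp (A * S * (1 + cmod z) powr s)"
        by (simp add: mult_ac)
    qed
  qed
  show ?thesis
  proof (rule that[of W.f])
    show "W.f holomorphic_on UNIV" by (rule W.holomorphic)
    show "W.f z = 0 \<longleftrightarrow> z \<in> range a" for z by (rule W.zero)
    show "zorder W.f z = int (card (a -` {z}))" for z by (rule W.zorder)
    show "exp_growth s W.f" using bound by (rule exp_growthI)
  qed
qed

section \<open>Zeros and zero orders of entire functions\<close>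

lemma entire_eventually_nonzero:
  assumes "F holomorphic_on UNIV" "F \<noteq> (\<lambda>_. 0)"
  shows "eventually (\<lambda>w. F w \<noteq> 0) (at z)"
proof -
  obtain z0 where "F z0 \<noteq> 0" using assms(2) by auto
  then have "\<forall>\<^sub>F w in (at z). F w \<noteq> 0 \<and> w \<in> UNIV"
    using non_zero_neighbour_alt[OF assms(1) open_UNIV connected_UNIV, of z z0] by simp
  then show ?thesis by simp
qed

lemma entire_analytic: "F holomorphic_on UNIV \<Longrightarrow> F analytic_on A"
  by (metis UNIV_I analytic_on_analytic_at analytic_on_open open_UNIV)

lemma entire_zorder_ge_0:
  assumes "F holomorphic_on UNIV" "F \<noteq> (\<lambda>_. 0)"
  shows "zorder F z \<ge> 0"
  using zorder_ge_0[OF entire_analytic[OF assms(1)] eventually_frequently[OF _ entire_eventually_nonzero[OF assms]]]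
  by simp

lemma entire_zorder_pos_iff:
  assumes "F holomorphic_on UNIV" "F \<noteq> (\<lambda>_. 0)"
  shows "zorder F z > 0 \<longleftrightarrow> F z = 0"
  using zorder_pos_iff'[OF entire_analytic[OF assms(1)] eventually_frequently[OF _ entire_eventually_nonzero[OF assms]]]
  by simp

lemma entire_zorder_mult:
  assumes "F holomorphic_on UNIV" "F \<noteq> (\<lambda>_. 0)" "G holomorphic_on UNIV" "G \<noteq> (\<lambda>_. 0)"
  shows "zorder (\<lambda>z. F z * G z) z = zorder F z + zorder G z"
proof (rule zorder_times_analytic)
  show "eventually (\<lambda>w. F w * G w \<noteq> 0) (at z)"
    using entire_eventually_nonzero[OF assms(1,2), of z] entire_eventually_nonzero[OF assms(3,4), of z]
    by eventually_elim auto
qed (intro entire_analytic assms)+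

lemma entire_finite_zeros:
  assumes "F holomorphic_on UNIV" "F \<noteq> (\<lambda>_. 0)"
  shows "finite {z. cmod z \<le> r \<and> F z = 0}"
proof (cases "F constant_on UNIV")
  case True
  then obtain k where "\<And>z. F z = k" by (auto simp: constant_on_def)
  with assms(2) show ?thesis by (cases "k = 0") auto
next
  case False
  have "finite {z \<in> cball 0 r. F z = 0}"
    by (rule holomorphic_compact_finite_zeros[OF assms(1)]) (use False in auto)
  then show ?thesis by simp
qed

lemma entire_nonvanishing_exp:
  assumes "F holomorphic_on UNIV" "\<And>z. F z \<noteq> 0"
  obtains g where "g holomorphic_on UNIV" "\<And>z. F z = exp (g z)"
  using holomorphic_logarithm_exists[of UNIV F 0] assms by (metis UNIV_I convex_UNIV open_UNIV)

lemma entire_eq_exp_mult: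
  assumes "A holomorphic_on UNIV" "B holomorphic_on UNIV"
    and "\<And>z. A z = 0 \<longleftrightarrow> B z = 0" "\<And>z. zorder A z = zorder B z"
  obtains Q where "Q holomorphic_on UNIV" "\<And>z. A z = exp (Q z) * B z"
proof -
  obtain h where h: "h holomorphic_on UNIV" "\<And>z. h z \<noteq> 0" "\<And>z. A z = h z * B z"
    using holomorphic_zorder_factorization[OF assms(1) open_UNIV connected_UNIV assms(2)] assms(3,4)
    by (metis UNIV_I)
  obtain Q where "Q holomorphic_on UNIV" "\<And>z. h z = exp (Q z)"
    using entire_nonvanishing_exp[OF h(1,2)] by blast
  then show ?thesis using that h(3) by metis
qed

text \<open>Kept apart from the general case, where the zeros are enumerated by an infinite
  sequence. The induction removes one zero with its full multiplicity at a time.\<close>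

lemma finite_zeros_factorization:
  assumes "finite {z. F z = 0}" "F holomorphic_on UNIV" "F \<noteq> (\<lambda>_. 0)" "s > 0"
  shows "\<exists>H g. H holomorphic_on UNIV \<and> g holomorphic_on UNIV \<and> exp_growth s H \<and> (\<forall>z. F z = H z * exp (g z))"
  using assms
proof (induction "card {z. F z = 0}" arbitrary: F rule: less_induct)
  case less
  show ?case
  proof (cases "{z. F z = 0} = {}")
    case True
    then obtain g where "g holomorphic_on UNIV" "\<And>z. F z = exp (g z)"
      using entire_nonvanishing_exp[OF less.prems(2)] by blast
    then show ?thesis using exp_growth_const[OF less.prems(4), of 1]
      by (intro exI[of _ "\<lambda>_. 1"] exI[of _ g]) auto
  next
    case False
    then obtain w where w: "F w = 0" by auto
    obtain B k where B: "B holomorphic_on UNIV" "B w \<noteq> 0" "\<And>z. F z = (z - w) ^ k * B z"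
      using entire_factor_zero[OF less.prems(2,3)] by blast
    have "{z. B z = 0} \<subseteq> {z. F z = 0} - {w}" using B by auto
    moreover have "card ({z. F z = 0} - {w}) < card {z. F z = 0}"
      using w less.prems(1) by (intro card_Diff1_less) auto
    ultimately have card: "card {z. B z = 0} < card {z. F z = 0}" "finite {z. B z = 0}"
      using less.prems(1) by (meson card_mono finite_Diff le_less_trans finite_subset)+
    obtain H g where H: "H holomorphic_on UNIV" "g holomorphic_on UNIV" "exp_growth s H" "\<forall>z. B z = H z * exp (g z)"
      using less.hyps[OF card(1) card(2) B(1) _ less.prems(4)] B(2) by auto
    show ?thesis
    proof (intro exI conjI allI)
      show "(\<lambda>z. (z - w) ^ k * H z) holomorphic_on UNIV" by (intro holomorphic_intros H)
      show "exp_growth s (\<lambda>z. (z - w) ^ k * H z)"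
        by (intro exp_growth_mult exp_growth_power exp_growth_linear H less.prems(4))
      show "F z = (z - w) ^ k * H z * exp (g z)" for z using B(3) H(4) by simp
    qed (rule H(2))
  qed
qed

lemma zero_count_le_powr:
  assumes "zero_exponent F < ereal \<tau>"
  shows "eventually (\<lambda>r. zero_count r F \<le> r powr \<tau>) at_top"
proof -
  have "eventually (\<lambda>r. ereal (lnp (zero_count r F) / ln r) < ereal \<tau>) at_top"
    using assms unfolding zero_exponent_def by (rule Limsup_lessD)
  then show ?thesis
    using eventually_gt_at_top[of 1]
  proof eventually_elim
    case (elim r)
    then have "lnp (zero_count r F) \<le> \<tau> * ln r" by (simp add: divide_less_eq)
    then have "exp (lnp (zero_count r F)) \<le> r powr \<tau>" using elim(2) by (simp add: powr_def)
    then show ?case using le_exp_lnp order_trans by blast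
  qed
qed

text \<open>The zeros are enumerated with multiplicity by increasing modulus, so that the \<open>n\<close>-th one
  satisfies \<open>n + 1 \<le> zero_count |a n| F\<close>.\<close>
lemma hadamard_factorization:
  assumes F: "F holomorphic_on UNIV" "F \<noteq> (\<lambda>_. 0)"
    and exponent: "zero_exponent F < ereal \<tau>" and "0 < \<tau>" "\<tau> < s"
  obtains H g where "H holomorphic_on UNIV" "g holomorphic_on UNIV" "exp_growth s H" "\<And>z. F z = H z * exp (g z)"
proof (cases "finite {z. F z = 0}")
  case True
  then show ?thesis using finite_zeros_factorization[OF True F, of s] assms(4,5) that by auto
next
  case False
  have s: "s > 0" using assms by simp
  \<comment> \<open>A zero at the origin is split off because the Weierstrass factors contain
    \<open>z / a n\<close>.\<close>
  obtain B k where B: "B holomorphic_on UNIV" "B 0 \<noteq> 0" "\<And>z. F z = (z - 0) ^ k * B z"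
    using entire_factor_zero[OF F] by blast
  have B0: "B \<noteq> (\<lambda>_. 0)" using B(2) by auto
  define Z where "Z = {z. B z = 0}"
  have inf: "infinite Z"
  proof
    assume "finite Z"
    moreover have "{z. F z = 0} \<subseteq> insert 0 Z" using B(3) by (auto simp: Z_def)
    ultimately show False using False finite_subset by blast
  qed
  have zorder_eq: "zorder B z = zorder F z" if "z \<noteq> 0" for z
  proof -
    have "zorder (\<lambda>z. (z - 0) ^ k * B z) z = zorder (\<lambda>z::complex. (z - 0) ^ k) z + zorder B z"
      by (rule entire_zorder_mult) (use B B0 in \<open>auto intro!: holomorphic_intros simp: fun_eq_iff intro: exI[of _ 1]\<close>)
    moreover have "zorder (\<lambda>z::complex. (z - 0) ^ k) z = 0"
      using that by (intro zorder_eq_0I analytic_intros) auto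
    moreover have "(\<lambda>z. (z - 0) ^ k * B z) = F" using B(3) by auto
    ultimately show ?thesis by simp
  qed
  have fin: "finite {z. cmod z \<le> r \<and> F z = 0}" for r by (rule entire_finite_zeros[OF F])
  have "\<exists>a :: nat \<Rightarrow> complex. mono (norm \<circ> a) \<and> range a = Z \<and> filterlim a at_infinity at_top \<and>
    (\<forall>z\<in>Z. finite (a -` {z}) \<and> card (a -` {z}) = nat (zorder B z))"
  proof (rule sequence_of_sparse_set_exists'[of Z "\<lambda>z. nat (zorder B z)"])
    show "closed Z"
      unfolding Z_def by (intro closed_Collect_eq entire_continuous_on B continuous_intros)
    show "finite (Z \<inter> cball 0 r)" if "r \<ge> 0" for r
      by (rule finite_subset[OF _ entire_finite_zeros[OF B(1) B0, of r]]) (auto simp: Z_def)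
    show "nat (zorder B z) > 0" if "z \<in> Z" for z
      using that entire_zorder_pos_iff[OF B(1) B0] by (auto simp: Z_def)
    fix f :: "nat \<Rightarrow> complex"
    assume "mono (norm \<circ> f)" "range f = Z" "filterlim f at_infinity at_top"
      "\<And>z. z \<in> Z \<Longrightarrow> finite (f -` {z}) \<and> card (f -` {z}) = nat (zorder B z)"
    then show ?thesis by (intro exI[of _ f]) simp
  qed (rule inf)
  then obtain a :: "nat \<Rightarrow> complex" where a: "mono (norm \<circ> a)" "range a = Z" "filterlim a at_infinity at_top"
    "\<And>z. z \<in> Z \<Longrightarrow> finite (a -` {z}) \<and> card (a -` {z}) = nat (zorder B z)"
    by blast
  have a0: "a n \<noteq> 0" for n using a(2) B(2) by (metis (mono_tags, lifting) Z_def mem_Collect_eq rangeI)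
  have count: "real (Suc n) \<le> zero_count (cmod (a n)) F" for n
  proof -
    define Y where "Y = {z \<in> Z. cmod z \<le> cmod (a n)}"
    have Yfin: "finite Y" and YF: "Y \<subseteq> {z. cmod z \<le> cmod (a n) \<and> F z = 0}"
      using fin[of "cmod (a n)"] B(3) by (auto simp: Y_def Z_def elim!: finite_subset[rotated])
    have "{..n} \<subseteq> (\<Union>z\<in>Y. a -` {z})"
      using a(1,2) by (auto simp: Y_def mono_def)
    then have "card {..n} \<le> card (\<Union>z\<in>Y. a -` {z})"
      using Yfin a(4) by (intro card_mono finite_UN_I) (auto simp: Y_def)
    also have "\<dots> \<le> (\<Sum>z\<in>Y. card (a -` {z}))" by (rule card_UN_le[OF Yfin])
    also have "\<dots> = (\<Sum>z\<in>Y. nat (zorder F z))"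
    proof (intro sum.cong refl)
      fix z assume "z \<in> Y"
      then have "z \<in> Z" "z \<noteq> 0" using B(2) by (auto simp: Y_def Z_def)
      then show "card (a -` {z}) = nat (zorder F z)" using a(4) zorder_eq by simp
    qed
    also have "\<dots> \<le> (\<Sum>z\<in>{z. cmod z \<le> cmod (a n) \<and> F z = 0}. nat (zorder F z))"
      by (intro sum_mono2 fin YF) auto
    finally show ?thesis unfolding zero_count_def
      by (metis card_atMost of_nat_le_iff of_nat_sum)
  qed
  \<comment> \<open>From n + 1 \<le> |a n|^\<tau> follows |a n|^(-s) \<le> (n + 1)^(-s/\<tau>),
    summable because \<tau> < s.\<close>
  have "summable (\<lambda>n. cmod (a n) powr (- s))"
  proof (rule summable_comparison_test_ev)
    have "filterlim (\<lambda>n. cmod (a n)) at_top at_top"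
      using a(3) filterlim_at_infinity_imp_norm_at_top by blast
    from eventually_compose_filterlim[OF zero_count_le_powr[OF exponent] this]
    show "eventually (\<lambda>n. norm (cmod (a n) powr (- s)) \<le> real (Suc n) powr (- s / \<tau>)) at_top"
    proof eventually_elim
      case (elim n)
      have "real (Suc n) \<le> cmod (a n) powr \<tau>" using elim count[of n] by linarith
      then have "(cmod (a n) powr \<tau>) powr (- s / \<tau>) \<le> real (Suc n) powr (- s / \<tau>)"
        using s assms(4) by (intro powr_mono2') auto
      then show ?case using assms(4) by (simp add: powr_powr)
    qed
    have "summable (\<lambda>n. real n powr (- s / \<tau>))"
      using assms(4,5) by (subst summable_real_powr_iff) (simp add: field_simps)
    then show "summable (\<lambda>n. real (Suc n) powr (- s / \<tau>))"
      by (subst summable_Suc_iff)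
  qed
  then obtain W where W: "W holomorphic_on UNIV" "\<And>z. W z = 0 \<longleftrightarrow> z \<in> range a"
    "\<And>z. zorder W z = int (card (a -` {z}))" "exp_growth s W"
    using canonical_product_exists[OF a0 a(3) s] by blast
  obtain g where g: "g holomorphic_on UNIV" "\<And>z. B z = exp (g z) * W z"
  proof (rule entire_eq_exp_mult[OF B(1) W(1)])
    show "B z = 0 \<longleftrightarrow> W z = 0" for z by (auto simp: W(2) a(2) Z_def)
    show "zorder B z = zorder W z" for z
    proof (cases "z \<in> Z")
      case True
      then show ?thesis using a(4)[OF True] W(3)[of z] entire_zorder_ge_0[OF B(1) B0, of z] by simp
    next
      case False
      then have "a -` {z} = {}" using a(2) by auto
      moreover have "zorder B z = 0"
        using False entire_zorder_ge_0[OF B(1) B0, of z] entire_zorder_pos_iff[OF B(1) B0, of z]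
        by (auto simp: Z_def)
      ultimately show ?thesis using W(3)[of z] by simp
    qed
  qed blast
  show ?thesis
  proof (rule that[of "\<lambda>z. (z - 0) ^ k * W z" g])
    show "exp_growth s (\<lambda>z. (z - 0) ^ k * W z)"
      by (intro exp_growth_mult exp_growth_power exp_growth_linear W s)
    show "F z = (z - 0) ^ k * W z * exp (g z)" for z using B(3) g(2) by simp
  qed (intro holomorphic_intros W g)+
qed


section \<open>Linear difference equations of order less than one\<close>

lemma eventually_powr_le:
  fixes s t C :: real
  assumes "s < t"
  shows "eventually (\<lambda>x. C * x powr s \<le> x powr t) at_top"
  using eventually_ge_at_top[of "max 1 (max 1 C powr (1 / (t - s)))"]
proof eventually_elim
  case (elim x)
  then have x: "x \<ge> 1" "max 1 C powr (1 / (t - s)) \<le> x" by simp_all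
  have "C \<le> (max 1 C powr (1 / (t - s))) powr (t - s)" using assms by (simp add: powr_powr)
  also have "\<dots> \<le> x powr (t - s)" using assms x by (intro powr_mono2) auto
  finally have "C * x powr s \<le> x powr (t - s) * x powr s" by (intro mult_right_mono) auto
  then show ?case by (simp flip: powr_add)
qed

lemma eventually_affine_powr_le:
  fixes s t C c k :: real
  assumes "s < t" "0 \<le> s" "c \<ge> 0" "k \<ge> 0"
  shows "eventually (\<lambda>x. C * (c + k * x) powr s \<le> x powr t) at_top"
  using eventually_powr_le[OF assms(1), of "\<bar>C\<bar> * (c + k) powr s"] eventually_ge_at_top[of 1]
proof eventually_elim
  case (elim x)
  have "c * 1 \<le> c * x" using elim assms by (intro mult_left_mono) auto
  then have "c + k * x \<le> (c + k) * x" by (simp add: algebra_simps)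
  then have "(c + k * x) powr s \<le> ((c + k) * x) powr s"
    using assms elim by (intro powr_mono2) auto
  also have "\<dots> = (c + k) powr s * x powr s" using assms elim by (simp add: powr_mult)
  finally have le: "(c + k * x) powr s \<le> (c + k) powr s * x powr s" .
  have "C * (c + k * x) powr s \<le> \<bar>C\<bar> * (c + k * x) powr s" by (intro mult_right_mono) auto
  also have "\<dots> \<le> \<bar>C\<bar> * ((c + k) powr s * x powr s)" by (intro mult_left_mono le) auto
  finally show ?case using elim by (simp add: mult.assoc)
qed

lemma exp_growth_add:
  assumes "exp_growth s f" "exp_growth s g" "s > 0"
  shows "exp_growth s (\<lambda>z. f z + g z)"
proof -
  obtain C D where C: "C \<ge> 0" "\<And>z. cmod (f z) \<le> exp (C * (1 + cmod z) powr s)"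
    and D: "D \<ge> 0" "\<And>z. cmod (g z) \<le> exp (D * (1 + cmod z) powr s)"
    using assms(1,2) by (metis exp_growthE)
  have "exp_growth s (\<lambda>z. 2 * of_real (exp ((C + D) * (1 + cmod z) powr s)))"
    by (intro exp_growth_mult exp_growth_const assms exp_growthI[of _ "C + D"]) (simp del: of_real_exp)
  moreover have "cmod (f z + g z) \<le> cmod (2 * of_real (exp ((C + D) * (1 + cmod z) powr s)))" for z
  proof -
    have "exp (C * (1 + cmod z) powr s) \<le> exp ((C + D) * (1 + cmod z) powr s)"
      "exp (D * (1 + cmod z) powr s) \<le> exp ((C + D) * (1 + cmod z) powr s)"
      using C(1) D(1) by (auto intro!: mult_right_mono)
    then have "cmod (f z + g z) \<le> 2 * exp ((C + D) * (1 + cmod z) powr s)"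
      using norm_triangle_ineq[of "f z" "g z"] C(2)[of z] D(2)[of z] by linarith
    then show ?thesis by (simp add: norm_mult del: of_real_exp)
  qed
  ultimately show ?thesis unfolding exp_growth_def by (meson order_trans)
qed

lemma exp_growth_cmult: "exp_growth s f \<Longrightarrow> s > 0 \<Longrightarrow> exp_growth s (\<lambda>z. k * f z)"
  by (intro exp_growth_mult exp_growth_const)

lemma exp_growth_shift:
  assumes "exp_growth s f" "s > 0"
  shows "exp_growth s (\<lambda>z. f (z + t))"
proof -
  obtain C where C: "C \<ge> 0" "\<And>z. cmod (f z) \<le> exp (C * (1 + cmod z) powr s)"
    using assms(1) by (metis exp_growthE)
  have "cmod (f (z + t)) \<le> exp (C * (1 + cmod t) powr s * (1 + cmod z) powr s)" for z
  proof -
    have "(1 + cmod t) * (1 + cmod z) = 1 + cmod z + cmod t + cmod t * cmod z"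
      by (simp add: algebra_simps)
    then have "1 + cmod (z + t) \<le> (1 + cmod t) * (1 + cmod z)"
      using norm_triangle_ineq[of z t] mult_nonneg_nonneg[OF norm_ge_zero[of t] norm_ge_zero[of z]]
      by linarith
    then have "(1 + cmod (z + t)) powr s \<le> ((1 + cmod t) * (1 + cmod z)) powr s"
      using assms(2) by (intro powr_mono2) auto
    also have "\<dots> = (1 + cmod t) powr s * (1 + cmod z) powr s" by (simp add: powr_mult)
    finally have "C * (1 + cmod (z + t)) powr s \<le> C * (1 + cmod t) powr s * (1 + cmod z) powr s"
      using C(1) by (simp add: mult_left_mono mult.assoc)
    then show ?thesis using C(2)[of "z + t"] by (meson exp_le_cancel_iff order_trans)
  qed
  then show ?thesis by (rule exp_growthI)
qed

lemma exp_growth_nev_T: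
  assumes "exp_growth s A" "A holomorphic_on UNIV"
  obtains C where "C \<ge> 0" "\<And>r. r \<ge> 0 \<Longrightarrow> nev_T r A \<le> C * (1 + r) powr s"
proof -
  obtain C where C: "C \<ge> 0" "\<And>z. cmod (A z) \<le> exp (C * (1 + cmod z) powr s)"
    using assms(1) by (metis exp_growthE)
  have "nev_T r A \<le> C * (1 + r) powr s" if "r \<ge> 0" for r
    using C that by (intro nev_T_le_bound assms) (auto simp: lnp_le_iff)
  then show ?thesis using that C(1) by blast
qed

lemma exp_growth_of_nev_T:
  assumes A: "A holomorphic_on UNIV" and s: "s > 0"
    and le: "\<And>r. r \<ge> r0 \<Longrightarrow> nev_T r A \<le> D * r powr s"
  shows "exp_growth s A"
proof -
  define R0 where "R0 = max 1 r0"
  have R0: "R0 \<ge> 1" "R0 \<ge> r0" by (simp_all add: R0_def)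
  have "cmod (A z) \<le> exp (3 * \<bar>D\<bar> * (2 + R0) powr s * (1 + cmod z) powr s)" for z
  proof -
    \<comment> \<open>With R at least 2|z| + 1 the factor (R + |z|) / (R - |z|) is at most 3, while
      R remains comparable to 1 + |z|.\<close>
    define R where "R = 2 * cmod z + R0"
    have "cmod z \<ge> 0" by simp
    then have R: "cmod z < R" "R \<ge> r0" "R > 0" "R - cmod z > 0" "R + cmod z \<le> 3 * (R - cmod z)"
      using R0 unfolding R_def by (smt (verit))+
    have "lnp (cmod (A z)) \<le> (R + cmod z) / (R - cmod z) * nev_T R A" by (rule lnp_le_nev_T[OF A R(1)])
    also have "\<dots> \<le> 3 * nev_T R A"
      using R nev_T_nonneg[OF A, of R] by (intro mult_right_mono) (auto simp: divide_le_eq)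
    also have "nev_T R A \<le> \<bar>D\<bar> * R powr s" using le[OF R(2)] by (rule order_trans) (simp add: mult_right_mono)
    also have "R powr s \<le> ((2 + R0) * (1 + cmod z)) powr s"
      using R s by (intro powr_mono2) (auto simp: R_def R0_def algebra_simps)
    also have "\<dots> = (2 + R0) powr s * (1 + cmod z) powr s" by (simp add: powr_mult R0_def)
    finally have "lnp (cmod (A z)) \<le> 3 * \<bar>D\<bar> * (2 + R0) powr s * (1 + cmod z) powr s"
      by (simp add: mult_left_mono mult.assoc)
    then show ?thesis by (meson exp_le_cancel_iff le_exp_lnp order_trans)
  qed
  then show ?thesis by (rule exp_growthI)
qed

lemma taylor_coeff_eq_0:
  assumes g: "g holomorphic_on UNIV" and "0 \<le> s" "s < real k" "k > 0"
    and le: "\<And>r. r \<ge> 1 \<Longrightarrow> nev_T r (\<lambda>z. exp (g z)) \<le> C * (1 + r) powr s + D"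
  shows "(deriv ^^ k) g 0 = 0"
proof (rule ccontr)
  assume nz: "(deriv ^^ k) g 0 \<noteq> 0"
  define m where "m = cmod ((deriv ^^ k) g 0) / fact k"
  have m: "m > 0" using nz by (simp add: m_def)
  define E where "E = \<bar>4 * D - 2 * Re (g 0)\<bar> + 1"
  have "eventually (\<lambda>r. 2 * (4 * C / m) * (1 + 1 * r) powr s \<le> r powr real k) at_top"
    using assms by (intro eventually_affine_powr_le) auto
  moreover have "eventually (\<lambda>r. (2 * E / m) * r powr 0 \<le> r powr real k) at_top"
    using assms by (intro eventually_powr_le) auto
  ultimately have "eventually (\<lambda>r::real. False) at_top"
    using eventually_ge_at_top[of 1]
  proof eventually_elim
    case (elim r)
    have "m * r ^ k \<le> 4 * (C * (1 + r) powr s + D) - 2 * Re (g 0)"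
      using taylor_coeff_le_nev_T_exp[OF g assms(4), of r] le[of r] elim by (simp add: m_def)
    also have "\<dots> < 4 * C * (1 + r) powr s + E" by (simp add: E_def)
    finally have "m * r ^ k < 4 * C * (1 + r) powr s + E" .
    moreover have "2 * (4 * C * (1 + r) powr s) \<le> m * r ^ k" "2 * E \<le> m * r ^ k"
      using elim m by (simp_all add: powr_realpow field_simps)
    ultimately show False by linarith
  qed
  then show False by simp
qed

text \<open>Write \<open>G\<close> as exp g. The \<open>k\<close>-th coefficient of \<open>g\<close>
  times r^k is O(r^s) with s < 1, so every coefficient of positive index vanishes.\<close>

lemma entire_nonvanishing_small_growth_constant:
  assumes "G holomorphic_on UNIV" "exp_growth s G" "0 < s" "s < 1" "\<And>z. G z \<noteq> 0"
  shows "G z = G 0"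
proof -
  obtain g where g: "g holomorphic_on UNIV" "\<And>z. G z = exp (g z)"
    using entire_nonvanishing_exp[OF assms(1,5)] by blast
  obtain C where C: "\<And>r. r \<ge> 0 \<Longrightarrow> nev_T r G \<le> C * (1 + r) powr s"
    using exp_growth_nev_T[OF assms(2,1)] by blast
  have "G = (\<lambda>z. exp (g z))" using g(2) by auto
  with C have T: "nev_T r (\<lambda>z. exp (g z)) \<le> C * (1 + r) powr s + 0" if "r \<ge> 1" for r using that by simp
  have "(deriv ^^ k) g 0 = 0" if "k > 0" for k
    by (rule taylor_coeff_eq_0[OF g(1) _ _ that T]) (use assms that in auto)
  then have "g z = g 0"
    by (intro holomorphic_fun_eq_const_on_connected[OF g(1)]) blast+
  then show ?thesis using g(2) by simp
qed

text \<open>Every point is divided out once, whatever its multiplicity. In the induction the current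
  quotient still vanishes at the new point, because the product over the other points does
  not.\<close>

lemma entire_divide_finite_zeros:
  assumes "finite S" "B holomorphic_on UNIV" "\<And>w. w \<in> S \<Longrightarrow> B w = 0"
  shows "\<exists>A. A holomorphic_on UNIV \<and> (\<forall>z. B z = A z * (\<Prod>w\<in>S. z - w))"
  using assms(1,3)
proof (induction S)
  case empty
  then show ?case using assms(2) by auto
next
  case (insert w S)
  then obtain A where A: "A holomorphic_on UNIV" "\<And>z. B z = A z * (\<Prod>w\<in>S. z - w)" by auto
  have "B w = 0" using insert.prems by simp
  then have Aw: "A w = 0" using A(2)[of w] insert.hyps by auto
  show ?case
  proof (cases "A = (\<lambda>_. 0)")
    case True
    then show ?thesis using A by (intro exI[of _ A]) auto
  next
    case False
    obtain D k where D: "D holomorphic_on UNIV" "D w \<noteq> 0" "\<And>z. A z = (z - w) ^ k * D z"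
      using entire_factor_zero[OF A(1) False] by blast
    then obtain j where j: "k = Suc j" using Aw by (cases k) auto
    show ?thesis
    proof (intro exI conjI allI)
      show "(\<lambda>z. (z - w) ^ j * D z) holomorphic_on UNIV" by (intro holomorphic_intros D)
      show "B z = (z - w) ^ j * D z * (\<Prod>w\<in>insert w S. z - w)" for z
        using insert.hyps A(2) D(3) j by simp
    qed
  qed
qed

text \<open>Divide by \<open>m\<close> of the zeros and compare the value at \<open>z0\<close> with the maximum on a circle of
  radius \<open>8 m\<close>: every zero gains a factor \<open>7\<close>.\<close>
lemma entire_zero_progression_eq_0:
  assumes G: "G holomorphic_on UNIV" "exp_growth s G" "0 < s" "s < 1"
    and zero: "\<And>j::nat. G (z0 + of_nat j) = 0"
  shows "G = (\<lambda>_. 0)"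
proof (rule ccontr)
  assume nz: "G \<noteq> (\<lambda>_. 0)"
  \<comment> \<open>Splitting off the zero at \<open>z0\<close> gives a nonzero value to compare
    with; \<open>B\<close> still vanishes at \<open>z0 + j\<close> for every j > 0.\<close>
  obtain B k where B: "B holomorphic_on UNIV" "B z0 \<noteq> 0" "\<And>z. G z = (z - z0) ^ k * B z"
    using entire_factor_zero[OF G(1) nz] by blast
  obtain C where C: "C \<ge> 0" "\<And>z. cmod (G z) \<le> exp (C * (1 + cmod z) powr s)"
    using G(2) by (metis exp_growthE)
  have main: "cmod (B z0) * 7 ^ m \<le> exp (C * (1 + cmod z0 + 8 * real m) powr s)" if m: "m > 0" for m :: nat
  proof -
    define S where "S = (\<lambda>j. z0 + complex_of_nat j) ` {1..m}"
    have inj: "inj_on (\<lambda>j. z0 + complex_of_nat j) {1..m}" by (auto simp: inj_on_def)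
    have BS: "B w = 0" if "w \<in> S" for w
      using that zero B(3)[of w] by (auto simp: S_def)
    obtain A where A: "A holomorphic_on UNIV" "\<And>z. B z = A z * (\<Prod>w\<in>S. z - w)"
      using entire_divide_finite_zeros[of S B] BS B(1) by (auto simp: S_def)
    have prod: "(\<Prod>w\<in>S. z - w) = (\<Prod>j\<in>{1..m}. z - z0 - of_nat j)" for z
      unfolding S_def by (subst prod.reindex[OF inj]) (simp add: algebra_simps)
    define M where "M = exp (C * (1 + cmod z0 + 8 * real m) powr s) / (7 * real m) ^ m"
    have "cmod (A z0) \<le> M"
    proof (rule maximum_modulus_frontier[where S = "cball z0 (8 * real m)" and f = A])
      show "A holomorphic_on interior (cball z0 (8 * real m))"
        "continuous_on (closure (cball z0 (8 * real m))) A"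
        by (auto intro: entire_continuous_on holomorphic_on_subset A)
      fix z assume "z \<in> frontier (cball z0 (8 * real m))"
      then have z: "cmod (z - z0) = 8 * real m" using m by (simp add: frontier_cball dist_norm norm_minus_commute)
      have "1 * cmod (B z) \<le> cmod (z - z0) ^ k * cmod (B z)"
        using m z by (intro mult_right_mono one_le_power) auto
      also have "\<dots> = cmod (G z)" by (simp add: B(3) norm_mult norm_power)
      also have "\<dots> \<le> exp (C * (1 + cmod z) powr s)" by (rule C)
      also have "\<dots> \<le> exp (C * (1 + cmod z0 + 8 * real m) powr s)"
        using C(1) G(3) norm_triangle_sub[of z z0] z
        by (auto intro!: mult_left_mono powr_mono2)
      finally have 1: "cmod (B z) \<le> exp (C * (1 + cmod z0 + 8 * real m) powr s)" by simp
      have "(\<Prod>j\<in>{1..m}. 7 * real m) \<le> (\<Prod>j\<in>{1..m}. cmod (z - z0 - of_nat j))"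
      proof (rule prod_mono)
        fix j assume j: "j \<in> {1..m}"
        have "cmod (z - z0) - cmod (complex_of_nat j) \<le> cmod (z - z0 - of_nat j)" by (rule norm_triangle_ineq2)
        then show "0 \<le> 7 * real m \<and> 7 * real m \<le> cmod (z - z0 - of_nat j)" using z j by auto
      qed
      then have 2: "(7 * real m) ^ m \<le> cmod (\<Prod>w\<in>S. z - w)" by (simp add: prod prod_norm)
      have "cmod (A z) * (7 * real m) ^ m \<le> cmod (A z) * cmod (\<Prod>w\<in>S. z - w)"
        by (intro mult_left_mono 2) auto
      also have "\<dots> = cmod (B z)" by (simp add: A(2) norm_mult)
      finally show "cmod (A z) \<le> M" using 1 m by (simp add: M_def field_simps)
    qed auto
    moreover have "cmod (\<Prod>w\<in>S. z0 - w) \<le> real m ^ m"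
    proof -
      have "cmod (\<Prod>w\<in>S. z0 - w) = (\<Prod>j\<in>{1..m}. real j)" by (simp add: prod prod_norm[symmetric])
      also have "\<dots> \<le> (\<Prod>j\<in>{1..m}. real m)" by (intro prod_mono) auto
      finally show ?thesis by simp
    qed
    ultimately have "cmod (B z0) \<le> M * real m ^ m"
      unfolding A(2) norm_mult by (intro mult_mono) (auto simp: M_def)
    then show ?thesis using m by (simp add: M_def power_mult_distrib field_simps)
  qed
  have "eventually (\<lambda>x. C * (1 + cmod z0 + 8 * x) powr s \<le> x powr 1) at_top"
    using G by (intro eventually_affine_powr_le) (auto simp: add_nonneg_nonneg)
  then have ev: "eventually (\<lambda>m. C * (1 + cmod z0 + 8 * real m) powr s \<le> real m powr 1) at_top"
    using eventually_compose_filterlim filterlim_real_sequentially by blast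
  \<comment> \<open>Since s < 1 the exponent is at most \<open>m\<close> for large \<open>m\<close>,
    and e < 7 makes the quotient of the two powers tend to 0.\<close>
  have "eventually (\<lambda>m. cmod (B z0) \<le> (exp 1 / 7) ^ m) at_top"
    using ev eventually_gt_at_top[of 0]
  proof eventually_elim
    case (elim m)
    have "C * (1 + cmod z0 + 8 * real m) powr s \<le> real m" using elim by simp
    then have "cmod (B z0) * 7 ^ m \<le> exp (real m)"
      using main[OF elim(2)] by (meson exp_le_cancel_iff order_trans)
    also have "\<dots> = exp 1 ^ m" by (simp flip: exp_of_nat_mult)
    finally show ?case by (simp add: power_divide field_simps)
  qed
  moreover have "(\<lambda>m. (exp 1 / 7 :: real) ^ m) \<longlonglongrightarrow> 0"
    using exp_le by (intro LIMSEQ_power_zero) auto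
  ultimately have "cmod (B z0) \<le> 0"
    by (intro tendsto_lowerbound[of "\<lambda>m. (exp 1 / 7 :: real) ^ m" 0 sequentially "cmod (B z0)"]) auto
  then show False using B(2) by simp
qed

text \<open>The equation carries a zero at \<open>z0\<close> to all points \<open>z0 + j\<close>,
  too many for order below one unless \<open>G\<close> vanishes identically; a zero-free
  \<open>G\<close> is constant by its growth.\<close>

lemma first_order_difference_equation_constant:
  assumes G: "G holomorphic_on UNIV" "exp_growth s G" "0 < s" "s < 1"
    and eq: "\<And>z. G (z + 1) = x * G z"
  shows "G z = G 0"
proof (cases "\<exists>z0. G z0 = 0")
  case True
  then obtain z0 where z0: "G z0 = 0" by blast
  have "G (z0 + of_nat j) = 0" for j
  proof (induction j)
    case (Suc j)
    then show ?case using eq[of "z0 + of_nat j"] by (simp add: add_ac)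
  qed (use z0 in simp)
  then have "G = (\<lambda>_. 0)" by (rule entire_zero_progression_eq_0[OF G])
  then show ?thesis by simp
next
  case False
  then show ?thesis using entire_nonvanishing_small_growth_constant[OF G] by blast
qed

lemma periodic_small_growth_constant:
  assumes "G holomorphic_on UNIV" "exp_growth s G" "0 < s" "s < 1" "\<And>z. G (z + 1) = G z"
  shows "G z = G 0"
  using first_order_difference_equation_constant[OF assms(1-4), of 1] assms(5) by simp

text \<open>\<open>shift_op p\<close> is the difference operator \<open>p(E)\<close>, where \<open>E\<close> is the shift \<open>z \<mapsto> z + 1\<close>.\<close>
definition shift_op :: "complex poly \<Rightarrow> (complex \<Rightarrow> complex) \<Rightarrow> complex \<Rightarrow> complex" where
  "shift_op p G z = (\<Sum>i\<le>degree p. coeff p i * G (z + of_nat i))"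

lemma shift_op_eq_sum:
  assumes "degree p \<le> N"
  shows "shift_op p G z = (\<Sum>i\<le>N. coeff p i * G (z + of_nat i))"
  unfolding shift_op_def
  by (rule sum.mono_neutral_left) (use assms in \<open>auto intro: coeff_eq_0\<close>)

lemma shift_op_add: "shift_op (p + q) G z = shift_op p G z + shift_op q G z"
proof -
  let ?N = "max (degree p) (degree q)"
  have "degree (p + q) \<le> ?N" by (rule degree_add_le_max)
  then show ?thesis by (simp add: shift_op_eq_sum[of _ ?N] distrib_right sum.distrib)
qed

lemma shift_op_smult: "shift_op (smult k p) G z = k * shift_op p G z"
  by (subst shift_op_eq_sum[OF degree_smult_le]) (simp add: shift_op_def sum_distrib_left mult.assoc)

lemma shift_op_diff: "shift_op (p - q) G z = shift_op p G z - shift_op q G z"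
  using shift_op_add[of p "smult (-1) q" G z] unfolding shift_op_smult by simp

lemma shift_op_pCons: "shift_op (pCons a p) G z = a * G z + shift_op p G (z + 1)"
  by (subst shift_op_eq_sum[OF degree_pCons_le])
     (simp add: shift_op_def sum.atMost_Suc_shift add_ac del: sum.atMost_Suc)

lemma shift_op_0 [simp]: "shift_op 0 G z = 0"
  by (simp add: shift_op_def)

lemma shift_op_1 [simp]: "shift_op 1 G z = G z"
  by (simp add: shift_op_def)

lemma shift_op_linear_mult:
  "shift_op ([:a, b:] * p) G z = a * shift_op p G z + b * shift_op p G (z + 1)"
  by (simp add: mult_pCons_left shift_op_add shift_op_smult shift_op_pCons)

text \<open>Here the linear factor acts first, on \<open>G\<close> itself; in
  \<open>shift_op_linear_mult\<close> it acts last. This form lowers the degree of an equation by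
  passing to a new unknown function.\<close>

lemma shift_op_linear_mult':
  "shift_op ([:a, b:] * p) G z = shift_op p (\<lambda>z. a * G z + b * G (z + 1)) z"
  unfolding shift_op_linear_mult
  by (simp add: shift_op_def sum_distrib_left sum.distrib algebra_simps)

lemma fdiff_eq_shift_op: "fdiff n f = shift_op ([:-1, 1:] ^ n) f"
  by (induction n) (auto simp: fun_eq_iff shift_op_linear_mult simp del: mult_pCons_left)

text \<open>Induction over the roots: for a root x, the function G(z + 1) - x G(z) solves an
  equation of lower degree and is zero. Then \<open>G\<close> is constant, and x \<noteq> 1 leaves
  only the constant 0.\<close>

lemma shift_op_eq_0_imp_eq_0:
  assumes "G holomorphic_on UNIV" "exp_growth s G" "0 < s" "s < 1"
    and "\<And>z. shift_op p G z = 0" "poly p 1 \<noteq> 0"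
  shows "G z = 0"
  using assms
proof (induction "degree p" arbitrary: p G z)
  case 0
  then obtain a where "p = [:a:]" by (metis degree_eq_zeroE)
  then show ?case using "0.prems"(5)[of z] "0.prems"(6) by (simp add: shift_op_pCons)
next
  case (Suc d)
  have "\<not> constant (poly p)" using Suc.hyps(2) constant_degree[of p] by simp
  then obtain x where x: "poly p x = 0" using fundamental_theorem_of_algebra by blast
  then obtain q where q: "p = [:-x, 1:] * q" by (auto simp: poly_eq_0_iff_dvd)
  have q0: "q \<noteq> 0" using q Suc.prems(6) by auto
  have deg: "d = degree q" using Suc.hyps(2) q q0 by (simp add: degree_mult_eq del: mult_pCons_left)
  have x1: "x \<noteq> 1" "poly q 1 \<noteq> 0" using Suc.prems(6) x q by auto
  define G1 where "G1 z = - x * G z + 1 * G (z + 1)" for z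
  have "G1 w = 0" for w
  proof (rule Suc.hyps(1)[OF deg, where G = G1])
    show "G1 holomorphic_on UNIV" unfolding G1_def
      by (intro holomorphic_intros Suc.prems(1) entire_shift)
    show "exp_growth s G1" unfolding G1_def
      by (intro exp_growth_add exp_growth_cmult exp_growth_shift Suc.prems)
    show "shift_op q G1 z = 0" for z
      using Suc.prems(5)[of z] unfolding q shift_op_linear_mult' G1_def .
  qed (use Suc.prems x1 in auto)
  note G1 = this
  have eq: "G (w + 1) = x * G w" for w
  proof -
    have "G (w + 1) = G1 w + x * G w" by (simp add: G1_def)
    then show ?thesis by (simp add: G1)
  qed
  have const: "G w = G 0" for w
    by (rule first_order_difference_equation_constant[OF Suc.prems(1-4) eq])
  have "G 0 = x * G 0" using eq[of 0] const[of "0 + 1"] by simp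
  then show ?case using x1 const[of z] by simp
qed

text \<open>If 1 is a simple root, the difference of \<open>G\<close> solves the equation of the
  cofactor, which does not vanish at 1. Hence \<open>G\<close> is periodic and, being of order below
  one, constant. A double root would admit the solution G z = z.\<close>

lemma shift_op_eq_0_imp_constant:
  assumes G: "G holomorphic_on UNIV" "exp_growth s G" "0 < s" "s < 1"
    and eq: "\<And>z. shift_op p G z = 0" and simple: "poly p 1 \<noteq> 0 \<or> poly (pderiv p) 1 \<noteq> 0"
  shows "G z = G 0"
proof (cases "poly p 1 = 0")
  case False
  have "G w = 0" for w by (rule shift_op_eq_0_imp_eq_0[OF G eq False])
  then show ?thesis by simp
next
  case True
  then obtain q where q: "p = [:-1, 1:] * q" by (auto simp: poly_eq_0_iff_dvd)
  have q1: "poly q 1 \<noteq> 0" using simple True unfolding q by (simp add: pderiv_mult pderiv_pCons del: mult_pCons_left)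
  have *: "(- 1) * G w + 1 * G (w + 1) = 0" for w
  proof (rule shift_op_eq_0_imp_eq_0[where G = "\<lambda>w. (- 1) * G w + 1 * G (w + 1)", OF _ _ G(3,4) _ q1])
    show "(\<lambda>w. (- 1) * G w + 1 * G (w + 1)) holomorphic_on UNIV"
      by (intro holomorphic_intros G entire_shift)
    show "exp_growth s (\<lambda>w. (- 1) * G w + 1 * G (w + 1))"
      by (intro exp_growth_add exp_growth_cmult exp_growth_shift G)
    show "shift_op q (\<lambda>w. (- 1) * G w + 1 * G (w + 1)) z = 0" for z
      using eq[of z] unfolding q shift_op_linear_mult' .
  qed
  have "G (w + 1) = G w" for w
  proof -
    have "G (w + 1) = ((- 1) * G w + 1 * G (w + 1)) + G w" by simp
    then show ?thesis using *[of w] by simp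
  qed
  note periodic = this
  show ?thesis by (rule periodic_small_growth_constant[OF G periodic])
qed


section \<open>Functions that are small along good radii\<close>

text \<open>A step from r to r + r^\<beta> raises r^(1-\<beta>) by at most one, so this power counts
  the steps of the iteration.\<close>

lemma powr_add_powr_le:
  fixes r \<beta> :: real
  assumes "r > 0" "0 < \<beta>" "\<beta> < 1"
  shows "(r + r powr \<beta>) powr (1 - \<beta>) \<le> r powr (1 - \<beta>) + 1"
proof -
  define x where "x = r powr (\<beta> - 1)"
  have x: "x > 0" using assms by (simp add: x_def)
  have "r + r powr \<beta> = r * (1 + x)"
    using assms by (simp add: x_def distrib_left powr_diff)
  then have "(r + r powr \<beta>) powr (1 - \<beta>) = r powr (1 - \<beta>) * (1 + x) powr (1 - \<beta>)"
    using assms x by (simp add: powr_mult)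
  also have "(1 + x) powr (1 - \<beta>) \<le> (1 + x) powr 1"
    using assms x by (intro powr_mono) auto
  also have "r powr (1 - \<beta>) * (1 + x) powr 1 = r powr (1 - \<beta>) + r powr (1 - \<beta>) * x"
    using x by (simp add: distrib_left)
  also have "r powr (1 - \<beta>) * x = 1"
    using assms by (simp add: x_def flip: powr_add)
  finally show ?thesis using assms by (simp add: mult_left_mono)
qed

lemma nonexceptional_radius:
  fixes E :: "real set"
  assumes "E \<in> sets lebesgue" "emeasure lebesgue E < \<infinity>"
  shows "\<exists>L>0. \<forall>x y. L \<le> y - x \<longrightarrow> (\<exists>r. x \<le> r \<and> r \<le> y \<and> r \<notin> E)"
proof -
  define \<mu> where "\<mu> = measure lebesgue E"
  have \<mu>: "emeasure lebesgue E = ennreal \<mu>" "\<mu> \<ge> 0"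
    using assms(2) by (simp_all add: \<mu>_def emeasure_eq_ennreal_measure less_top)
  have "\<exists>r. x \<le> r \<and> r \<le> y \<and> r \<notin> E" if xy: "\<mu> + 1 \<le> y - x" for x y
  proof (rule ccontr)
    assume "\<not> ?thesis"
    then have "{x..y} \<subseteq> E" by auto
    then have "emeasure lebesgue {x..y} \<le> ennreal \<mu>"
      unfolding \<mu>(1)[symmetric] by (intro emeasure_mono assms)
    moreover have "emeasure lebesgue {x..y} = ennreal (y - x)" using \<mu>(2) xy by simp
    ultimately have "ennreal (y - x) \<le> ennreal \<mu>" by metis
    then show False using \<mu>(2) xy by (simp add: ennreal_le_iff)
  qed
  then show ?thesis using \<mu>(2) by (intro exI[of _ "\<mu> + 1"]) auto
qed

text \<open>The setting for an arbitrary comparison function \<open>exp g\<close>: an upper bound of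
  hyper-order below one, and a Taylor coefficient that bounds the growth from below. It is used for
  the exponent of the factorisation and again for its first difference.\<close>

locale small_functions =
  fixes g :: "complex \<Rightarrow> complex" and \<sigma> :: real and k :: nat
  assumes g_entire: "g holomorphic_on UNIV"
    and \<sigma>: "0 < \<sigma>" "\<sigma> < 1"
    and growth: "eventually (\<lambda>r. nev_T r (\<lambda>z. exp (g z)) \<le> exp (r powr \<sigma>)) at_top"
    and k: "k > 0" "(deriv ^^ k) g 0 \<noteq> 0"
begin

section \<open>Good radii\<close>

definition N :: "real \<Rightarrow> real" where "N r = nev_T r (\<lambda>z. exp (g z))"

text \<open>Any value strictly between 0 and 1 - \<sigma> would do: \<beta> > 0 lets the step
  \<open>r powr \<beta>\<close> outgrow every fixed shift, and \<sigma> < 1 - \<beta> keeps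
  \<open>N\<close> from more than doubling at every large step.\<close>

definition \<beta> :: real where "\<beta> = (1 - \<sigma>) / 2"

text \<open>As a filter, the good radii can be used directly in Landau symbols and in
  \<open>eventually\<close>; \<open>good_nontrivial\<close> says that there are arbitrarily large
  ones.\<close>

definition good :: "real filter" where
  "good = inf at_top (principal {r. N (r + r powr \<beta>) \<le> 2 * N r})"

lemma \<beta>: "0 < \<beta>" "\<beta> < 1" "\<sigma> < 1 - \<beta>"
  using \<sigma> by (simp_all add: \<beta>_def field_simps)

lemma exp_g_entire: "(\<lambda>z. exp (g z)) holomorphic_on UNIV"
  by (intro holomorphic_intros g_entire)

lemma N_mono: "0 < r \<Longrightarrow> r \<le> R \<Longrightarrow> N r \<le> N R"
  unfolding N_def by (rule nev_T_mono[OF exp_g_entire])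

lemma N_nonneg: "r \<ge> 0 \<Longrightarrow> N r \<ge> 0"
  unfolding N_def by (rule nev_T_nonneg[OF exp_g_entire])

lemma power_le_N: "eventually (\<lambda>r. r ^ k \<le> 5 * fact k / cmod ((deriv ^^ k) g 0) * N r) at_top"
proof -
  define m where "m = cmod ((deriv ^^ k) g 0) / fact k"
  have m: "m > 0" using k by (simp add: m_def)
  \<comment> \<open>Once the constant 2 |Re (g 0)| is at most a fifth of m r^k, the coefficient
    bound with 4 N gives m r^k \<le> 5 N.\<close>
  have "eventually (\<lambda>r. 5 * (\<bar>2 * Re (g 0)\<bar> / m) * r powr 0 \<le> r powr real k) at_top"
    using k by (intro eventually_powr_le) auto
  then have "eventually (\<lambda>r. m * r ^ k \<le> 5 * N r) at_top"
    using eventually_gt_at_top[of 0]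
  proof eventually_elim
    case (elim r)
    have "m * r ^ k \<le> 4 * N r - 2 * Re (g 0)"
      using taylor_coeff_le_nev_T_exp[OF g_entire k(1) elim(2)] by (simp add: m_def N_def)
    moreover have "5 * \<bar>2 * Re (g 0)\<bar> \<le> m * r ^ k"
      using elim m by (simp add: powr_realpow field_simps)
    ultimately show ?case by linarith
  qed
  then show ?thesis
    by (rule eventually_mono) (use m k in \<open>simp add: m_def field_simps\<close>)
qed

lemma power_in_bigo_N: "(\<lambda>r. r ^ k) \<in> O(N)"
proof (rule bigoI)
  show "eventually (\<lambda>r. norm (r ^ k) \<le> 5 * fact k / cmod ((deriv ^^ k) g 0) * norm (N r)) at_top"
    using power_le_N eventually_ge_at_top[of 0]
    by eventually_elim (simp add: N_nonneg)
qed

lemma N_at_top: "filterlim N at_top at_top"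
proof -
  define D where "D = 5 * fact k / cmod ((deriv ^^ k) g 0)"
  have D: "D > 0" using k by (simp add: D_def)
  show ?thesis
    unfolding filterlim_at_top
  proof
    fix Z
    have "filterlim (\<lambda>r::real. r ^ k) at_top at_top"
      using k by (intro filterlim_pow_at_top filterlim_ident)
    then have "eventually (\<lambda>r. D * Z \<le> r ^ k) at_top"
      unfolding filterlim_at_top by blast
    then show "eventually (\<lambda>r. Z \<le> N r) at_top"
      using power_le_N
    proof eventually_elim
      case (elim r)
      then have "D * Z \<le> D * N r" by (simp add: D_def)
      then show ?case using D by simp
    qed
  qed
qed

lemma good_le_at_top: "good \<le> at_top"
  by (simp add: good_def)

lemma eventually_good: "eventually (\<lambda>r. N (r + r powr \<beta>) \<le> 2 * N r) good"
  unfolding good_def eventually_inf_principal by simp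

lemma eventually_good_at_top: "eventually P at_top \<Longrightarrow> eventually P good"
  using good_le_at_top by (auto simp: le_filter_def)

text \<open>Otherwise \<open>N\<close> doubles along \<open>\<rho> (Suc j) = \<rho> j + \<rho> j powr \<beta>\<close>. Since
  \<open>\<rho> j powr (1 - \<beta>)\<close> grows at most linearly in \<open>j\<close>, this contradicts the growth of \<open>N\<close>.\<close>
lemma good_nontrivial: "good \<noteq> bot"
proof
  assume "good = bot"
  then have "eventually (\<lambda>r. \<not> (N (r + r powr \<beta>) \<le> 2 * N r)) at_top"
    unfolding good_def trivial_limit_def eventually_inf_principal by (auto elim: eventually_mono)
  then have "eventually (\<lambda>r. 2 * N r < N (r + r powr \<beta>) \<and> N r \<le> exp (r powr \<sigma>) \<and> 1 \<le> N r \<and> 1 \<le> r) at_top"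
    using growth[folded N_def] filterlim_at_top[THEN iffD1, OF N_at_top, rule_format, of 1] eventually_ge_at_top[of 1]
    by eventually_elim auto
  then obtain r1 where r1: "\<And>r. r \<ge> r1 \<Longrightarrow> 2 * N r < N (r + r powr \<beta>) \<and> N r \<le> exp (r powr \<sigma>) \<and> 1 \<le> N r \<and> 1 \<le> r"
    by (auto simp: eventually_at_top_linorder)
  define \<rho> where "\<rho> j = ((\<lambda>r. r + r powr \<beta>) ^^ j) r1" for j
  have \<rho>_Suc: "\<rho> (Suc j) = \<rho> j + \<rho> j powr \<beta>" for j by (simp add: \<rho>_def)
  have ge: "\<rho> j \<ge> r1" for j
    by (induction j) (auto simp: \<rho>_Suc \<rho>_def[of 0] intro: add_increasing2)
  have low: "2 ^ j \<le> N (\<rho> j)" for j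
  proof (induction j)
    case 0
    then show ?case using r1[of r1] by (simp add: \<rho>_def)
  next
    case (Suc j)
    then show ?case using r1[OF ge[of j]] unfolding \<rho>_Suc by simp
  qed
  define A where "A = r1 powr (1 - \<beta>)"
  have up: "\<rho> j powr (1 - \<beta>) \<le> A + real j" for j
  proof (induction j)
    case 0
    show ?case by (simp add: \<rho>_def A_def)
  next
    case (Suc j)
    have "\<rho> j > 0" using r1[OF ge[of j]] by linarith
    then show ?case using powr_add_powr_le[of "\<rho> j" \<beta>] \<beta> Suc unfolding \<rho>_Suc by simp
  qed
  have key: "real j * ln 2 \<le> (A + 1 * real j) powr (\<sigma> / (1 - \<beta>))" for j
  proof -
    have pos: "\<rho> j > 0" using r1[OF ge[of j]] by linarith
    have "exp (real j * ln 2) = 2 ^ j" by (simp add: exp_of_nat_mult)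
    also have "\<dots> \<le> exp (\<rho> j powr \<sigma>)" using low[of j] r1[OF ge[of j]] by linarith
    finally have "real j * ln 2 \<le> \<rho> j powr \<sigma>" by simp
    also have "\<dots> = (\<rho> j powr (1 - \<beta>)) powr (\<sigma> / (1 - \<beta>))" using \<beta> by (simp add: powr_powr)
    also have "\<dots> \<le> (A + real j) powr (\<sigma> / (1 - \<beta>))"
      using up[of j] \<beta> \<sigma> by (intro powr_mono2) auto
    finally show ?thesis by simp
  qed
  \<comment> \<open>The exponent \<sigma> / (1 - \<beta>) is below one. The factor 2 is chosen so
    that the contradiction becomes 2 ln 2 \<le> 1.\<close>
  have "eventually (\<lambda>x. 2 * (A + 1 * x) powr (\<sigma> / (1 - \<beta>)) \<le> x powr 1) at_top"
    using \<beta> \<sigma> by (intro eventually_affine_powr_le) (auto simp: A_def)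
  then have "eventually (\<lambda>j. 2 * (A + 1 * real j) powr (\<sigma> / (1 - \<beta>)) \<le> real j powr 1) at_top"
    using eventually_compose_filterlim filterlim_real_sequentially by blast
  then have "eventually (\<lambda>j::nat. False) at_top"
    using eventually_gt_at_top[of 0]
  proof eventually_elim
    case (elim j)
    have "2 * (real j * ln 2) \<le> real j" using key[of j] elim(1) powr_one[of "real j"] by linarith
    then have "real j * (2 * ln 2) \<le> real j * 1" by (simp only: mult_1_right mult.left_commute)
    then have "2 * ln 2 \<le> (1::real)" using elim(2) by (simp only: mult_le_cancel_left_pos of_nat_0_less_iff)
    then show False using ln2_ge_two_thirds by simp
  qed
  then show False by simp
qed

lemma N_at_top_good: "filterlim N at_top good"
  using N_at_top good_le_at_top filterlim_mono by blast

text \<open>Allowing every \<open>\<theta> < 1\<close> makes the class closed under shifts: passing from \<open>\<theta>\<close> to a larger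
  \<open>\<theta>'\<close> gains a distance that tends to infinity with \<open>r\<close>.\<close>
definition T_in :: "(real \<Rightarrow> real) set \<Rightarrow> (complex \<Rightarrow> complex) \<Rightarrow> bool" where
  "T_in S h \<longleftrightarrow> h holomorphic_on UNIV \<and>
     (\<forall>\<theta>. 0 < \<theta> \<longrightarrow> \<theta> < 1 \<longrightarrow> (\<lambda>r. nev_T (r + \<theta> * r powr \<beta>) h) \<in> S)"

abbreviation small :: "(complex \<Rightarrow> complex) \<Rightarrow> bool" where "small \<equiv> T_in (o[good](N))"
abbreviation moderate :: "(complex \<Rightarrow> complex) \<Rightarrow> bool" where "moderate \<equiv> T_in (O[good](N))"

section \<open>Closure properties of small and moderate functions\<close>

lemma T_in_entire: "T_in S h \<Longrightarrow> h holomorphic_on UNIV"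
  by (simp add: T_in_def)

lemma T_inD: "T_in S h \<Longrightarrow> 0 < \<theta> \<Longrightarrow> \<theta> < 1 \<Longrightarrow> (\<lambda>r. nev_T (r + \<theta> * r powr \<beta>) h) \<in> S"
  by (simp add: T_in_def)

lemma small_imp_moderate: "small h \<Longrightarrow> moderate h"
  unfolding T_in_def by (auto intro: landau_o.small_imp_big)

lemma const_in_small: "(\<lambda>_. c) \<in> o[good](N)"
proof -
  have "eventually (\<lambda>r. norm c \<le> e * norm (N r)) good" if "e > 0" for e
    using filterlim_at_top[THEN iffD1, OF N_at_top_good, rule_format, of "norm c / e"]
  proof eventually_elim
    case (elim r)
    then have "norm c \<le> e * N r" using that by (simp add: pos_divide_le_eq mult.commute)
    also have "\<dots> \<le> e * norm (N r)" using that by (intro mult_left_mono) auto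
    finally show ?case .
  qed
  then show ?thesis by (intro landau_o.smallI) auto
qed

lemma radius_pos: "eventually (\<lambda>r. 0 < r + \<theta> * r powr \<beta>) good" if "\<theta> > 0" for \<theta>
  using eventually_good_at_top[OF eventually_gt_at_top[of 0]]
  by eventually_elim (use that in \<open>auto intro: add_pos_nonneg\<close>)

text \<open>The disjunction lets the closure properties be proved once for both classes.\<close>

lemma T_class_mono:
  assumes S: "S = o[good](N) \<or> S = O[good](N)" and f: "f \<in> S"
    and le: "eventually (\<lambda>r. 0 \<le> h r \<and> h r \<le> C * f r) good"
  shows "h \<in> S"
proof -
  have "h \<in> O[good](f)"
  proof (rule bigoI)
    show "eventually (\<lambda>r. norm (h r) \<le> \<bar>C\<bar> * norm (f r)) good"
      using le by eventually_elim (metis abs_ge_self abs_mult abs_of_nonneg order_trans real_norm_def)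
  qed
  then show ?thesis using S f by (meson landau_o.big_small_trans landau_o.big_trans)
qed

lemma T_class_add:
  assumes S: "S = o[good](N) \<or> S = O[good](N)" and "f \<in> S" "h \<in> S"
  shows "(\<lambda>r. f r + h r) \<in> S"
  using assms sum_in_smallo(1) sum_in_bigo(1) by blast

lemma T_class_const:
  assumes S: "S = o[good](N) \<or> S = O[good](N)"
  shows "(\<lambda>_. c) \<in> S"
  using S const_in_small landau_o.small_imp_big by blast

lemma T_in_const:
  assumes S: "S = o[good](N) \<or> S = O[good](N)"
  shows "T_in S (\<lambda>_. c)"
  unfolding T_in_def using T_class_const[OF S] by (simp add: nev_T_circ_mean)

lemma T_in_add:
  assumes S: "S = o[good](N) \<or> S = O[good](N)" and f: "T_in S f" and h: "T_in S h"
  shows "T_in S (\<lambda>z. f z + h z)"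
  unfolding T_in_def
proof (intro conjI allI impI)
  show hol: "(\<lambda>z. f z + h z) holomorphic_on UNIV" using f h by (intro holomorphic_intros T_in_entire)
  fix \<theta> :: real assume \<theta>: "0 < \<theta>" "\<theta> < 1"
  show "(\<lambda>r. nev_T (r + \<theta> * r powr \<beta>) (\<lambda>z. f z + h z)) \<in> S"
  proof (rule T_class_mono[OF S T_class_add[OF S T_class_add[OF S T_inD[OF f \<theta>] T_inD[OF h \<theta>]] T_class_const[OF S, of "ln 2"]]])
    show "\<forall>\<^sub>F r in good. 0 \<le> nev_T (r + \<theta> * r powr \<beta>) (\<lambda>z. f z + h z) \<and>
      nev_T (r + \<theta> * r powr \<beta>) (\<lambda>z. f z + h z) \<le>
        1 * (nev_T (r + \<theta> * r powr \<beta>) f + nev_T (r + \<theta> * r powr \<beta>) h + ln 2)"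
      using radius_pos[OF \<theta>(1)]
      by eventually_elim (simp add: nev_T_nonneg[OF hol] nev_T_add[OF T_in_entire[OF f] T_in_entire[OF h]])
  qed
qed

lemma T_in_mult:
  assumes S: "S = o[good](N) \<or> S = O[good](N)" and f: "T_in S f" and h: "T_in S h"
  shows "T_in S (\<lambda>z. f z * h z)"
  unfolding T_in_def
proof (intro conjI allI impI)
  show hol: "(\<lambda>z. f z * h z) holomorphic_on UNIV" using f h by (intro holomorphic_intros T_in_entire)
  fix \<theta> :: real assume \<theta>: "0 < \<theta>" "\<theta> < 1"
  show "(\<lambda>r. nev_T (r + \<theta> * r powr \<beta>) (\<lambda>z. f z * h z)) \<in> S"
  proof (rule T_class_mono[OF S T_class_add[OF S T_inD[OF f \<theta>] T_inD[OF h \<theta>]]])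
    show "\<forall>\<^sub>F r in good. 0 \<le> nev_T (r + \<theta> * r powr \<beta>) (\<lambda>z. f z * h z) \<and>
      nev_T (r + \<theta> * r powr \<beta>) (\<lambda>z. f z * h z) \<le>
        1 * (nev_T (r + \<theta> * r powr \<beta>) f + nev_T (r + \<theta> * r powr \<beta>) h)"
      using radius_pos[OF \<theta>(1)]
      by eventually_elim (simp add: nev_T_nonneg[OF hol] nev_T_mult[OF T_in_entire[OF f] T_in_entire[OF h]])
  qed
qed

lemma T_in_uminus: "T_in S f \<Longrightarrow> T_in S (\<lambda>z. - f z)"
  by (auto simp: T_in_def nev_T_uminus intro: holomorphic_intros)

lemma T_in_diff:
  assumes "S = o[good](N) \<or> S = O[good](N)" "T_in S f" "T_in S h"
  shows "T_in S (\<lambda>z. f z - h z)"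
  using T_in_add[OF assms(1,2) T_in_uminus[OF assms(3)]] by simp

lemma T_in_sum:
  assumes S: "S = o[good](N) \<or> S = O[good](N)" and "\<And>i. i \<in> I \<Longrightarrow> T_in S (f i)"
  shows "T_in S (\<lambda>z. \<Sum>i\<in>I. f i z)"
proof (cases "finite I")
  case True
  then show ?thesis using assms(2)
    by (induction I) (auto intro: T_in_const[OF S] T_in_add[OF S])
qed (simp add: T_in_const[OF S])

lemma radius_gap:
  assumes "0 < d"
  shows "eventually (\<lambda>r. C \<le> d * r powr \<beta>) good"
proof -
  have "eventually (\<lambda>r. (C / d) * r powr 0 \<le> r powr \<beta>) at_top"
    using \<beta> by (intro eventually_powr_le) auto
  then have "eventually (\<lambda>r. C \<le> d * r powr \<beta>) at_top"
    using eventually_gt_at_top[of 0] by eventually_elim (use assms in \<open>simp add: field_simps\<close>)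
  then show ?thesis by (rule eventually_good_at_top)
qed

lemma T_in_shift:
  assumes S: "S = o[good](N) \<or> S = O[good](N)" and f: "T_in S f"
  shows "T_in S (\<lambda>z. f (z + t))"
  unfolding T_in_def
proof (intro conjI allI impI)
  note hol = T_in_entire[OF f]
  show hol': "(\<lambda>z. f (z + t)) holomorphic_on UNIV" by (rule entire_shift[OF hol])
  fix \<theta> :: real assume \<theta>: "0 < \<theta>" "\<theta> < 1"
  define \<theta>' where "\<theta>' = (1 + \<theta>) / 2"
  have \<theta>': "0 < \<theta>'" "\<theta>' < 1" "0 < \<theta>' - \<theta>" using \<theta> by (auto simp: \<theta>'_def)
  show "(\<lambda>r. nev_T (r + \<theta> * r powr \<beta>) (\<lambda>z. f (z + t))) \<in> S"
  proof (rule T_class_mono[OF S T_inD[OF f \<theta>'(1,2)]])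
    show "\<forall>\<^sub>F r in good. 0 \<le> nev_T (r + \<theta> * r powr \<beta>) (\<lambda>z. f (z + t)) \<and>
      nev_T (r + \<theta> * r powr \<beta>) (\<lambda>z. f (z + t)) \<le> 3 * nev_T (r + \<theta>' * r powr \<beta>) f"
      using radius_pos[OF \<theta>(1)] radius_gap[OF \<theta>'(3), of "cmod t + 1"]
        eventually_good_at_top[OF eventually_ge_at_top[of "2 * cmod t + 1"]]
    proof eventually_elim
      case (elim r)
      let ?R = "r + \<theta>' * r powr \<beta>"
      have R: "cmod t + (r + \<theta> * r powr \<beta>) < ?R" using elim(2) by (simp add: algebra_simps)
      have "0 \<le> \<theta>' * r powr \<beta>" using \<theta>' by simp
      then have tr: "2 * cmod t < ?R" using elim(3) by linarith
      have t0: "0 \<le> cmod t" by simp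
      have "nev_T (r + \<theta> * r powr \<beta>) (\<lambda>z. f (z + t)) \<le> (?R + cmod t) / (?R - cmod t) * nev_T ?R f"
        by (rule nev_T_shift[OF hol R elim(1)])
      also have "\<dots> \<le> 3 * nev_T ?R f"
      proof (rule mult_right_mono)
        have "(x + y) / (x - y) \<le> 3" if "2 * y < x" "0 \<le> y" for x y :: real
          using that by (simp add: divide_le_eq)
        then show "(?R + cmod t) / (?R - cmod t) \<le> 3" using tr t0 by blast
        show "0 \<le> nev_T ?R f" using tr t0 by (intro nev_T_nonneg hol) linarith
      qed
      finally show ?case using nev_T_nonneg[OF hol'] elim(1) by simp
    qed
  qed
qed

text \<open>This is where the doubling condition in \<open>good\<close> is used: \<theta> < 1 keeps
  the radius inside the interval on which \<open>N\<close> at most doubles.\<close>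

lemma moderate_exp_g: "moderate (\<lambda>z. exp (g z))"
  unfolding T_in_def
proof (intro conjI allI impI exp_g_entire)
  fix \<theta> :: real assume \<theta>: "0 < \<theta>" "\<theta> < 1"
  show "(\<lambda>r. nev_T (r + \<theta> * r powr \<beta>) (\<lambda>z. exp (g z))) \<in> O[good](N)"
    unfolding N_def[symmetric]
  proof (rule bigoI)
    show "\<forall>\<^sub>F r in good. norm (N (r + \<theta> * r powr \<beta>)) \<le> 2 * norm (N r)"
      using eventually_good radius_pos[OF \<theta>(1)] eventually_good_at_top[OF eventually_gt_at_top[of 0]]
    proof eventually_elim
      case (elim r)
      have "N (r + \<theta> * r powr \<beta>) \<le> N (r + r powr \<beta>)"
        using elim \<theta> by (intro N_mono) (auto simp: mult_le_cancel_right1)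
      then show ?case using elim N_nonneg[of r] N_nonneg[of "r + \<theta> * r powr \<beta>"] by simp
    qed
  qed
qed

lemma moderate_factor:
  assumes "moderate A" "moderate B" "D holomorphic_on UNIV" "\<And>z. A z = B z * D z" "B \<noteq> (\<lambda>_. 0)"
  shows "moderate D"
  unfolding T_in_def
proof (intro conjI allI impI assms)
  fix \<theta> :: real assume \<theta>: "0 < \<theta>" "\<theta> < 1"
  have S: "O[good](N) = o[good](N) \<or> O[good](N) = O[good](N)" by simp
  obtain C where C: "\<And>r. r \<ge> 1 \<Longrightarrow> nev_T r D \<le> nev_T r A + nev_T r B + C"
    using nev_T_factor_le[OF T_in_entire[OF assms(1)] T_in_entire[OF assms(2)] assms(3,4,5)] by blast
  show "(\<lambda>r. nev_T (r + \<theta> * r powr \<beta>) D) \<in> O[good](N)"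
  proof (rule T_class_mono[OF S T_class_add[OF S T_class_add[OF S T_inD[OF assms(1) \<theta>] T_inD[OF assms(2) \<theta>]] T_class_const[OF S, of C]]])
    show "\<forall>\<^sub>F r in good. 0 \<le> nev_T (r + \<theta> * r powr \<beta>) D \<and> nev_T (r + \<theta> * r powr \<beta>) D \<le>
      1 * (nev_T (r + \<theta> * r powr \<beta>) A + nev_T (r + \<theta> * r powr \<beta>) B + C)"
      using eventually_good_at_top[OF eventually_ge_at_top[of 1]]
    proof eventually_elim
      case (elim r)
      have "r + \<theta> * r powr \<beta> \<ge> 1" using elim \<theta> by (intro add_increasing2) auto
      then show ?case using C[of "r + \<theta> * r powr \<beta>"] nev_T_nonneg[OF assms(3), of "r + \<theta> * r powr \<beta>"] by simp
    qed
  qed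
qed

text \<open>Between the radii for \<theta> and for a larger \<theta>' there is a gap proportional to
  r^\<beta>, so the shift estimate multiplies O(N) by a factor tending to 0. It is stated for
  general \<open>Q\<close> because it serves both for \<open>g\<close> and for the unknown exponent
  in the sharing identity.\<close>

lemma small_exp_shift_diff:
  assumes Q: "Q holomorphic_on UNIV" and mod: "moderate (\<lambda>z. exp (Q z))"
  shows "small (\<lambda>z. exp (Q (z + t) - Q z))"
  unfolding T_in_def
proof (intro conjI allI impI)
  show hol: "(\<lambda>z. exp (Q (z + t) - Q z)) holomorphic_on UNIV"
    by (intro holomorphic_intros entire_shift Q)
  fix \<theta> :: real assume \<theta>: "0 < \<theta>" "\<theta> < 1"
  define \<theta>' where "\<theta>' = (1 + \<theta>) / 2"
  have \<theta>': "0 < \<theta>'" "\<theta>' < 1" "0 < \<theta>' - \<theta>" using \<theta> by (auto simp: \<theta>'_def)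
  have SO: "O[good](N) = o[good](N) \<or> O[good](N) = O[good](N)" by simp
  have So: "o[good](N) = o[good](N) \<or> o[good](N) = O[good](N)" by simp
  let ?X = "\<lambda>r. nev_T (r + \<theta>' * r powr \<beta>) (\<lambda>z. exp (Q z))"
  have "(\<lambda>r. 2 * ?X r + (- Re (Q 0))) \<in> O[good](N)"
  proof (rule T_class_add[OF SO _ T_class_const[OF SO]])
    show "(\<lambda>r. 2 * ?X r) \<in> O[good](N)"
      using T_inD[OF mod \<theta>'(1,2)] by simp
  qed
  moreover have "(\<lambda>r. 4 * cmod t / ((\<theta>' - \<theta>) * r powr \<beta>)) \<in> o[good](\<lambda>_. 1)"
  proof (rule landau_o.smallI)
    fix e :: real assume e: "e > 0"
    show "\<forall>\<^sub>F r in good. norm (4 * cmod t / ((\<theta>' - \<theta>) * r powr \<beta>)) \<le> e * norm (1::real)"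
      using radius_gap[OF \<theta>'(3), of "4 * cmod t / e"] eventually_good_at_top[OF eventually_gt_at_top[of 0]]
    proof eventually_elim
      case (elim r)
      have "(\<theta>' - \<theta>) * r powr \<beta> > 0" using elim \<theta>' by (intro mult_pos_pos) auto
      then show ?case using elim e by (simp add: field_simps abs_if)
    qed
  qed
  ultimately have o: "(\<lambda>r. 4 * cmod t / ((\<theta>' - \<theta>) * r powr \<beta>) * (2 * ?X r + (- Re (Q 0)))) \<in> o[good](N)"
    using landau_o.small_big_mult by fastforce
  show "(\<lambda>r. nev_T (r + \<theta> * r powr \<beta>) (\<lambda>z. exp (Q (z + t) - Q z))) \<in> o[good](N)"
  proof (rule T_class_mono[OF So o])
    show "\<forall>\<^sub>F r in good. 0 \<le> nev_T (r + \<theta> * r powr \<beta>) (\<lambda>z. exp (Q (z + t) - Q z)) \<and>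
      nev_T (r + \<theta> * r powr \<beta>) (\<lambda>z. exp (Q (z + t) - Q z)) \<le>
      1 * (4 * cmod t / ((\<theta>' - \<theta>) * r powr \<beta>) * (2 * ?X r + (- Re (Q 0))))"
      using radius_pos[OF \<theta>(1)] radius_gap[OF \<theta>'(3), of "2 * cmod t + 1"]
    proof eventually_elim
      case (elim r)
      have *: "r + \<theta>' * r powr \<beta> - (r + \<theta> * r powr \<beta>) = (\<theta>' - \<theta>) * r powr \<beta>"
        by (simp add: algebra_simps)
      have "nev_T (r + \<theta> * r powr \<beta>) (\<lambda>z. exp (Q (z + t) - Q z)) \<le>
        4 * cmod t / (r + \<theta>' * r powr \<beta> - (r + \<theta> * r powr \<beta>)) * (2 * ?X r - Re (Q 0))"
      proof (rule nev_T_exp_shift_diff[OF Q elim(1)])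
        show "r + \<theta> * r powr \<beta> < r + \<theta>' * r powr \<beta>" using elim(2) * norm_ge_zero[of t] by linarith
        show "2 * cmod t \<le> r + \<theta>' * r powr \<beta> - (r + \<theta> * r powr \<beta>)" using elim(2) * by linarith
      qed
      then show ?case using nev_T_nonneg[OF hol] elim(1) unfolding * by simp
    qed
  qed
qed

text \<open>The characteristic is O(r^s), whereas \<open>N\<close> is at least a constant multiple
  of r^k with k > s; radii up to 2r change only the constant.\<close>

lemma small_of_exp_growth:
  assumes h: "h holomorphic_on UNIV" "exp_growth s h" and s: "0 < s" "s < real k"
  shows "small h"
  unfolding T_in_def
proof (intro conjI allI impI h)
  fix \<theta> :: real assume \<theta>: "0 < \<theta>" "\<theta> < 1"
  have So: "o[good](N) = o[good](N) \<or> o[good](N) = O[good](N)" by simp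
  obtain C where C: "C \<ge> 0" "\<And>r. r \<ge> 0 \<Longrightarrow> nev_T r h \<le> C * (1 + r) powr s"
    using exp_growth_nev_T[OF h(2,1)] by blast
  have "(\<lambda>r. (1 + 2 * r) powr s) \<in> o[good](\<lambda>r. r ^ k)"
  proof (rule landau_o.smallI)
    fix e :: real assume e: "e > 0"
    have "eventually (\<lambda>r. (1 / e) * (1 + 2 * r) powr s \<le> r powr real k) at_top"
      using s by (intro eventually_affine_powr_le) auto
    then have "eventually (\<lambda>r. norm ((1 + 2 * r) powr s) \<le> e * norm (r ^ k)) at_top"
      using eventually_gt_at_top[of 0]
      by eventually_elim (use e in \<open>simp add: powr_realpow field_simps\<close>)
    then show "eventually (\<lambda>r. norm ((1 + 2 * r) powr s) \<le> e * norm (r ^ k)) good"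
      by (rule eventually_good_at_top)
  qed
  also have "(\<lambda>r. r ^ k) \<in> O[good](N)"
    using power_in_bigo_N good_le_at_top by (rule landau_o.big.filter_mono[rotated])
  finally have o: "(\<lambda>r. (1 + 2 * r) powr s) \<in> o[good](N)" .
  show "(\<lambda>r. nev_T (r + \<theta> * r powr \<beta>) h) \<in> o[good](N)"
  proof (rule T_class_mono[OF So o])
    show "\<forall>\<^sub>F r in good. 0 \<le> nev_T (r + \<theta> * r powr \<beta>) h \<and>
       nev_T (r + \<theta> * r powr \<beta>) h \<le> C * (1 + 2 * r) powr s"
      using radius_pos[OF \<theta>(1)] eventually_good_at_top[OF eventually_ge_at_top[of 1]]
    proof eventually_elim
      case (elim r)
      have "\<theta> * r powr \<beta> \<le> 1 * r powr 1" using elim \<theta> \<beta> by (intro mult_mono powr_mono) auto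
      then have le: "r + \<theta> * r powr \<beta> \<le> 2 * r" using elim by simp
      have "nev_T (r + \<theta> * r powr \<beta>) h \<le> C * (1 + (r + \<theta> * r powr \<beta>)) powr s"
        using elim(1) by (intro C) simp
      also have "\<dots> \<le> C * (1 + 2 * r) powr s"
        using C(1) s le elim by (intro mult_left_mono powr_mono2) auto
      finally show ?case using nev_T_nonneg[OF h(1)] elim(1) by simp
    qed
  qed
qed

text \<open>The radius is moved out of the exceptional set of finite measure, inside the interval in
  which \<open>N\<close> at most doubles.\<close>
lemma small_of_small_fun:
  assumes a: "a holomorphic_on UNIV" "small_fun a f" and f: "moderate f"
  shows "small a"
  unfolding T_in_def
proof (intro conjI allI impI a)
  fix \<theta> :: real assume \<theta>: "0 < \<theta>" "\<theta> < 1"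
  define \<theta>' where "\<theta>' = (1 + \<theta>) / 2"
  have \<theta>': "0 < \<theta>'" "\<theta>' < 1" "0 < \<theta>' - \<theta>" using \<theta> by (auto simp: \<theta>'_def)
  obtain E where E: "E \<in> sets lebesgue" "emeasure lebesgue E < \<infinity>"
    "\<And>\<epsilon>. \<epsilon> > 0 \<Longrightarrow> \<exists>R. \<forall>r\<ge>R. r \<notin> E \<longrightarrow> nev_T r a \<le> \<epsilon> * nev_T r f"
    using a(2) by (auto simp: small_fun_def)
  obtain L where L: "\<And>x y. L \<le> y - x \<Longrightarrow> \<exists>r'. x \<le> r' \<and> r' \<le> y \<and> r' \<notin> E"
    using nonexceptional_radius[OF E(1,2)] by blast
  have "(\<lambda>r. nev_T (r + \<theta> * r powr \<beta>) a) \<in> o[good](\<lambda>r. nev_T (r + \<theta>' * r powr \<beta>) f)"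
  proof (rule landau_o.smallI)
    fix e :: real assume e: "e > 0"
    obtain R where R: "\<And>r. r \<ge> R \<Longrightarrow> r \<notin> E \<Longrightarrow> nev_T r a \<le> e * nev_T r f"
      using E(3)[OF e] by blast
    show "\<forall>\<^sub>F r in good. norm (nev_T (r + \<theta> * r powr \<beta>) a) \<le> e * norm (nev_T (r + \<theta>' * r powr \<beta>) f)"
      using radius_pos[OF \<theta>(1)] eventually_good_at_top[OF eventually_ge_at_top[of R]]
        radius_gap[OF \<theta>'(3), of L] eventually_good_at_top[OF eventually_gt_at_top[of 0]]
    proof eventually_elim
      case (elim r)
      let ?r1 = "r + \<theta> * r powr \<beta>" and ?r2 = "r + \<theta>' * r powr \<beta>"
      have "L \<le> ?r2 - ?r1" using elim(3) by (simp add: algebra_simps)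
      then obtain r' where r': "?r1 \<le> r'" "r' \<le> ?r2" "r' \<notin> E" using L by blast
      have "R \<le> ?r1" using elim(2,4) \<theta> by (intro add_increasing2) auto
      then have rR: "R \<le> r'" using r' by linarith
      have "nev_T ?r1 a \<le> nev_T r' a" using elim(1) r' by (intro nev_T_mono a) auto
      also have "\<dots> \<le> e * nev_T r' f" by (rule R[OF rR r'(3)])
      also have "\<dots> \<le> e * nev_T ?r2 f"
        using elim(1) r' e by (intro mult_left_mono nev_T_mono T_in_entire[OF f]) auto
      finally show ?case
        using nev_T_nonneg[OF a(1), of ?r1] nev_T_nonneg[OF T_in_entire[OF f], of ?r2] elim(1) r' by simp
    qed
  qed
  then show "(\<lambda>r. nev_T (r + \<theta> * r powr \<beta>) a) \<in> o[good](N)"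
    using T_inD[OF f \<theta>'(1,2)] by (rule landau_o.small_big_trans)
qed

end


section \<open>Polynomial identities with small coefficients\<close>

lemma entire_mult_eq_0:
  assumes "f holomorphic_on UNIV" "h holomorphic_on UNIV" "\<And>z. f z * h z = 0"
  shows "f = (\<lambda>_. 0) \<or> h = (\<lambda>_. 0)"
proof (rule ccontr)
  assume "\<not> ?thesis"
  then have "eventually (\<lambda>z. f z \<noteq> 0) (at 0)" "eventually (\<lambda>z. h z \<noteq> 0) (at 0)"
    using entire_eventually_nonzero assms by blast+
  then have "eventually (\<lambda>z::complex. False) (at 0)"
    by eventually_elim (use assms(3) in auto)
  then show False by simp
qed

text \<open>Taking out \<open>exp (g z)\<close> leaves shifts of \<open>H\<close> and shift
  quotients of \<open>exp g\<close>, all of which are small in the intended use.\<close>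

lemma shift_op_mult_exp:
  assumes "\<And>z. F z = H z * exp (g z)"
  shows "shift_op p F z =
    (\<Sum>i\<le>degree p. coeff p i * (H (z + of_nat i) * exp (g (z + of_nat i) - g z))) * exp (g z)"
  by (simp add: shift_op_def assms sum_distrib_right mult.assoc flip: exp_add)

context small_functions
begin

lemma small_class: "o[good](N) = o[good](N) \<or> o[good](N) = O[good](N)" by simp
lemma moderate_class: "O[good](N) = o[good](N) \<or> O[good](N) = O[good](N)" by simp

lemmas small_intros = T_in_add[OF small_class] T_in_diff[OF small_class] T_in_mult[OF small_class]
  T_in_uminus T_in_const[OF small_class] T_in_sum[OF small_class] T_in_shift[OF small_class]
lemmas moderate_intros = T_in_add[OF moderate_class] T_in_diff[OF moderate_class]
  T_in_mult[OF moderate_class] moderate_exp_g small_imp_moderate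

lemma small_power: "small f \<Longrightarrow> small (\<lambda>z. f z ^ j)"
  by (induction j) (simp_all add: small_intros)

lemma small_prod: "(\<And>i. i \<in> I \<Longrightarrow> small (f i)) \<Longrightarrow> small (\<lambda>z. \<Prod>i\<in>I. f i z)"
  by (induction I rule: infinite_finite_induct) (simp_all add: small_intros)

lemma small_exp_g_shift: "small (\<lambda>z. exp (g (z + t) - g z))"
  by (rule small_exp_shift_diff[OF g_entire moderate_exp_g])

text \<open>Jensen's lower bound for the leading coefficient against the inequality
  \<open>|c m| * |exp g| \<le> sum |c j|\<close>, valid where \<open>|exp g| \<ge> 1\<close>.\<close>
lemma leading_coefficient_eq_0:
  assumes c: "\<And>j. j \<le> Suc m \<Longrightarrow> small (c j)"
    and eq: "\<And>z. (\<Sum>j\<le>Suc m. c j z * exp (g z) ^ j) = 0"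
  shows "c (Suc m) = (\<lambda>_. 0)"
proof (rule ccontr)
  assume nz: "c (Suc m) \<noteq> (\<lambda>_. 0)"
  have hol: "c j holomorphic_on UNIV" if "j \<le> Suc m" for j using c[OF that] by (rule T_in_entire)
  \<comment> \<open>exp \<phi> is (m + 2) e^X / max 1 |exp g|, with X the sum of the positive
    logarithms. For |exp g| \<le> 1 each coefficient is at most e^X; otherwise the equation is
    divided by |exp g|^m. Both cases are thus covered by one continuous majorant.\<close>
  define \<phi> where "\<phi> z = (\<Sum>j\<le>Suc m. lnp (cmod (c j z))) + ln (real (m + 2)) - lnp (cmod (exp (g z)))" for z
  have le: "cmod (c (Suc m) z) \<le> exp (\<phi> z)" for z
  proof -
    define X where "X = (\<Sum>j\<le>Suc m. lnp (cmod (c j z)))"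
    define U where "U = cmod (exp (g z))"
    have cX: "cmod (c j z) \<le> exp X" if "j \<le> Suc m" for j
    proof -
      have "lnp (cmod (c j z)) \<le> X"
        unfolding X_def using that by (intro member_le_sum) auto
      then show ?thesis by (meson exp_le_cancel_iff le_exp_lnp order_trans)
    qed
    have "cmod (c (Suc m) z) * max 1 U \<le> real (m + 2) * exp X"
    proof (cases "U \<le> 1")
      case True
      have "cmod (c (Suc m) z) * 1 \<le> exp X * real (m + 2)"
        by (intro mult_mono cX) auto
      then show ?thesis using True by (simp add: max_def mult.commute)
    next
      case False
      have "c (Suc m) z * exp (g z) ^ Suc m = - (\<Sum>j\<le>m. c j z * exp (g z) ^ j)"
        using eq[of z] by (simp add: add_eq_0_iff)
      then have "cmod (c (Suc m) z) * U ^ Suc m = cmod (\<Sum>j\<le>m. c j z * exp (g z) ^ j)"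
        unfolding U_def by (metis norm_minus_cancel norm_mult norm_power)
      also have "\<dots> \<le> (\<Sum>j\<le>m. exp X * U ^ m)"
      proof (rule sum_norm_le)
        fix j assume j: "j \<in> {..m}"
        have "cmod (c j z * exp (g z) ^ j) = cmod (c j z) * U ^ j" by (simp add: U_def norm_mult norm_power)
        also have "\<dots> \<le> exp X * U ^ m"
          using j False by (intro mult_mono cX power_increasing) auto
        finally show "cmod (c j z * exp (g z) ^ j) \<le> exp X * U ^ m" .
      qed
      finally have "(cmod (c (Suc m) z) * U) * U ^ m \<le> (real (Suc m) * exp X) * U ^ m"
        by (simp add: mult_ac)
      then have "cmod (c (Suc m) z) * U \<le> real (Suc m) * exp X"
        by (rule mult_right_le_imp_le) (use False in simp)
      also have "\<dots> \<le> real (m + 2) * exp X" by (intro mult_right_mono) auto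
      finally show ?thesis using False by (simp add: max_def)
    qed
    then have "cmod (c (Suc m) z) \<le> real (m + 2) * exp X / max 1 U"
      by (simp add: pos_le_divide_eq)
    also have "\<dots> = exp (\<phi> z)"
      unfolding \<phi>_def X_def[symmetric] U_def[symmetric] by (simp add: exp_diff exp_add lnp_max)
    finally show ?thesis .
  qed
  obtain C where C: "\<forall>r \<phi>. r \<ge> 1 \<longrightarrow> continuous_on (sphere 0 r) \<phi> \<longrightarrow>
      (\<forall>w. cmod w = r \<longrightarrow> cmod (c (Suc m) w) \<le> exp (\<phi> w)) \<longrightarrow> C \<le> circ_mean r \<phi>"
    using jensen_lower_bound[OF hol[of "Suc m"] nz] by blast
  define D where "D = ln (real (m + 2)) - C"
  have N_le: "N r \<le> (\<Sum>j\<le>Suc m. nev_T r (c j)) + D" if r: "r \<ge> 1" for r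
  proof -
    have c1: "continuous_on (sphere 0 r) (\<lambda>z. \<Sum>j\<le>Suc m. lnp (cmod (c j z)))"
      by (intro continuous_on_sum continuous_on_lnp_entire hol) auto
    have c2: "continuous_on (sphere 0 r) (\<lambda>z. lnp (cmod (exp (g z))))"
      by (intro continuous_on_lnp_entire exp_g_entire)
    have "continuous_on (sphere 0 r) \<phi>"
      unfolding \<phi>_def by (intro continuous_on_diff continuous_on_add c1 c2 continuous_on_const)
    then have "C \<le> circ_mean r \<phi>" using C r le by blast
    also have "circ_mean r \<phi> = circ_mean r (\<lambda>z. (\<Sum>j\<le>Suc m. lnp (cmod (c j z))) + ln (real (m + 2))) - N r"
      unfolding \<phi>_def N_def nev_T_circ_mean using r
      by (intro circ_mean_diff continuous_on_add c1 c2 continuous_on_const) auto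
    also have "circ_mean r (\<lambda>z. (\<Sum>j\<le>Suc m. lnp (cmod (c j z))) + ln (real (m + 2))) =
        circ_mean r (\<lambda>z. (\<Sum>j\<le>Suc m. lnp (cmod (c j z)))) + circ_mean r (\<lambda>z. ln (real (m + 2)))"
      using r by (intro circ_mean_add c1 continuous_on_const) auto
    also have "circ_mean r (\<lambda>z. (\<Sum>j\<le>Suc m. lnp (cmod (c j z)))) = (\<Sum>j\<le>Suc m. nev_T r (c j))"
      unfolding nev_T_circ_mean using r by (intro circ_mean_sum continuous_on_lnp_entire hol) auto
    finally show ?thesis by (simp add: D_def)
  qed
  \<comment> \<open>Smallness refers to radii with \<theta> > 0; the choice 1/2 is arbitrary, and
    monotonicity leads back to \<open>r\<close>.\<close>
  have "(\<lambda>r. (\<Sum>j\<le>Suc m. nev_T (r + 1/2 * r powr \<beta>) (c j)) + D) \<in> o[good](N)"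
  proof (rule T_class_add[OF small_class _ T_class_const[OF small_class]])
    show "(\<lambda>r. (\<Sum>j\<le>Suc m. nev_T (r + 1/2 * r powr \<beta>) (c j))) \<in> o[good](N)"
      by (intro big_sum_in_smallo T_inD c) auto
  qed
  then have "eventually (\<lambda>r. norm ((\<Sum>j\<le>Suc m. nev_T (r + 1/2 * r powr \<beta>) (c j)) + D) \<le> 1/2 * norm (N r)) good"
    by (rule landau_o.smallD) simp
  moreover have "eventually (\<lambda>r. 1 \<le> N r) good"
    using N_at_top_good unfolding filterlim_at_top by blast
  ultimately have "eventually (\<lambda>r. False) good"
    using eventually_good_at_top[OF eventually_ge_at_top[of 1]]
  proof eventually_elim
    case (elim r)
    have "(\<Sum>j\<le>Suc m. nev_T r (c j)) \<le> (\<Sum>j\<le>Suc m. nev_T (r + 1/2 * r powr \<beta>) (c j))"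
      using elim(3) by (intro sum_mono nev_T_mono hol) auto
    then show False using N_le[OF elim(3)] elim(1,2) by simp
  qed
  then show False using good_nontrivial by simp
qed

lemma coefficients_eq_0:
  assumes "\<And>j. j \<le> m \<Longrightarrow> small (c j)" "\<And>z. (\<Sum>j\<le>m. c j z * exp (g z) ^ j) = 0" "j \<le> m"
  shows "c j z = 0"
  using assms
proof (induction m arbitrary: z)
  case 0
  then show ?case by simp
next
  case (Suc m)
  have top: "c (Suc m) = (\<lambda>_. 0)" by (rule leading_coefficient_eq_0[OF Suc.prems(1,2)])
  then have "(\<Sum>j\<le>m. c j z * exp (g z) ^ j) = 0" for z using Suc.prems(2)[of z] by simp
  then show ?case using Suc top by (cases "j = Suc m") auto
qed

text \<open>Degree four is that of a product of two quadratics in \<open>exp g\<close>; quadratic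
  identities are padded with zero coefficients.\<close>

lemma quartic_coefficients_eq_0:
  assumes "small c0" "small c1" "small c2" "small c3" "small c4"
    and eq: "\<And>z. c0 z + c1 z * exp (g z) + c2 z * exp (g z) ^ 2 + c3 z * exp (g z) ^ 3 + c4 z * exp (g z) ^ 4 = 0"
  shows "c0 z = 0" "c1 z = 0" "c2 z = 0" "c3 z = 0" "c4 z = 0"
proof -
  define c where "c j = [c0, c1, c2, c3, c4] ! j" for j
  have small: "small (c j)" if "j \<le> 4" for j
  proof -
    have "j \<in> {0, 1, 2, 3, 4}" using that by auto
    then show ?thesis using assms by (auto simp: c_def)
  qed
  have "(\<Sum>j\<le>4. c j z * exp (g z) ^ j) = 0" for z
    using eq[of z] by (simp add: c_def eval_nat_numeral)
  then have "c j z = 0" if "j \<le> 4" for j using coefficients_eq_0[of 4 c] small that by blast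
  from this[of 0] this[of 1] this[of 2] this[of 3] this[of 4]
  show "c0 z = 0" "c1 z = 0" "c2 z = 0" "c3 z = 0" "c4 z = 0" by (simp_all add: c_def)
qed

text \<open>\<open>exp Q\<close> is only of moderate growth, but its quotients under shifts are small. Comparing the
  identity with its shift by \<open>t\<close> gives the leading coefficient for all \<open>z\<close> and \<open>t\<close>, hence
  determines \<open>exp Q\<close> up to a constant.\<close>
lemma shared_pair_identity:
  assumes sm: "small M" "small H" "small A" "small B" "small d"
    and Q: "Q holomorphic_on UNIV" and H0: "H \<noteq> (\<lambda>_. 0)" and AB: "A \<noteq> B"
    and eq: "\<And>z. (M z * exp (g z) + (d z - A z)) * (M z * exp (g z) + (d z - B z)) =
                 exp (Q z) * ((H z * exp (g z) - A z) * (H z * exp (g z) - B z))"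
    and nz: "\<exists>z. (H z * exp (g z) - A z) * (H z * exp (g z) - B z) \<noteq> 0"
  shows "(M = H \<and> d = (\<lambda>_. 0)) \<or> (M = (\<lambda>z. - H z) \<and> d = (\<lambda>z. A z + B z))"
proof -
  note hol = sm[THEN T_in_entire]
  define P1 where "P1 z = (M z * exp (g z) + (d z - A z)) * (M z * exp (g z) + (d z - B z))" for z
  define P2 where "P2 z = (H z * exp (g z) - A z) * (H z * exp (g z) - B z)" for z
  have P12: "P1 z = exp (Q z) * P2 z" for z using eq by (simp add: P1_def P2_def)
  have mP1: "moderate P1" unfolding P1_def[abs_def] by (intro moderate_intros sm)
  have mP2: "moderate P2" unfolding P2_def[abs_def] by (intro moderate_intros sm)
  have "moderate (\<lambda>z. exp (Q z))"
  proof (rule moderate_factor[OF mP1 mP2])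
    show "P2 \<noteq> (\<lambda>_. 0)" using nz by (auto simp: P2_def fun_eq_iff)
  qed (auto simp: P12 intro!: holomorphic_intros Q)
  note smQ = small_exp_shift_diff[OF Q this]
  define p2 p1 p0 where "p2 z = M z * M z" and "p1 z = M z * (2 * d z - A z - B z)"
    and "p0 z = (d z - A z) * (d z - B z)" for z
  define q2 q1 q0 where "q2 z = H z * H z" and "q1 z = - (H z * (A z + B z))" and "q0 z = A z * B z" for z
  have P1p: "P1 z = p2 z * exp (g z) ^ 2 + p1 z * exp (g z) + p0 z" for z
    unfolding P1_def p2_def p1_def p0_def by (simp add: algebra_simps power2_eq_square)
  have P2q: "P2 z = q2 z * exp (g z) ^ 2 + q1 z * exp (g z) + q0 z" for z
    unfolding P2_def q2_def q1_def q0_def by (simp add: algebra_simps power2_eq_square)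
  have smp: "small p2" "small p1" "small p0" "small q2" "small q1" "small q0"
    unfolding p2_def[abs_def] p1_def[abs_def] p0_def[abs_def] q2_def[abs_def] q1_def[abs_def] q0_def[abs_def]
    by (intro small_intros sm)+
  \<comment> \<open>Of the five coefficient identities two are kept: the fourth-degree one serves
    when \<open>M\<close> is nonzero, the second-degree one when \<open>M\<close> vanishes
    identically and the left side is free of \<open>exp g\<close>.\<close>
  have shift: "p0 (z + t) * q2 z + p1 (z + t) * W z * q1 z + p2 (z + t) * W z ^ 2 * q0 z
        - S z * (p0 z * (q2 (z + t) * W z ^ 2) + p1 z * (q1 (z + t) * W z) + p2 z * q0 (z + t)) = 0 \<and>
      p2 (z + t) * W z ^ 2 * q2 z - S z * (p2 z * (q2 (z + t) * W z ^ 2)) = 0"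
    if W: "W = (\<lambda>z. exp (g (z + t) - g z))" and S: "S = (\<lambda>z. exp (Q (z + t) - Q z))" for z t W S
  proof -
    have sW: "small W" unfolding W by (rule small_exp_g_shift)
    have sS: "small S" unfolding S by (rule smQ)
    have u: "exp (g (z + t)) = W z * exp (g z)" for z by (simp add: W exp_diff)
    have id: "P1 (z + t) * P2 z - S z * (P1 z * P2 (z + t)) = 0" for z
      unfolding P12 S by (simp add: exp_diff)
    define c0 where "c0 z = p0 (z + t) * q0 z - S z * (p0 z * q0 (z + t))" for z
    define c1 where "c1 z = p0 (z + t) * q1 z + p1 (z + t) * W z * q0 z
      - S z * (p0 z * (q1 (z + t) * W z) + p1 z * q0 (z + t))" for z
    define c2 where "c2 z = p0 (z + t) * q2 z + p1 (z + t) * W z * q1 z + p2 (z + t) * W z ^ 2 * q0 z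
      - S z * (p0 z * (q2 (z + t) * W z ^ 2) + p1 z * (q1 (z + t) * W z) + p2 z * q0 (z + t))" for z
    define c3 where "c3 z = p1 (z + t) * W z * q2 z + p2 (z + t) * W z ^ 2 * q1 z
      - S z * (p1 z * (q2 (z + t) * W z ^ 2) + p2 z * (q1 (z + t) * W z))" for z
    define c4 where "c4 z = p2 (z + t) * W z ^ 2 * q2 z - S z * (p2 z * (q2 (z + t) * W z ^ 2))" for z
    note c_defs = c0_def c1_def c2_def c3_def c4_def
    have sm: "small c0" "small c1" "small c2" "small c3" "small c4"
      unfolding c_defs[abs_def] by (intro small_intros small_power smp sW sS)+
    have "c0 z + c1 z * exp (g z) + c2 z * exp (g z) ^ 2 + c3 z * exp (g z) ^ 3 + c4 z * exp (g z) ^ 4 = 0" for z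
      using id[of z] unfolding P1p P2q u by (simp add: c_defs algebra_simps eval_nat_numeral)
    from quartic_coefficients_eq_0(3,5)[OF sm this] show ?thesis
      unfolding c2_def c4_def by blast
  qed
  obtain z0 where z0: "H z0 \<noteq> 0" using H0 by auto
  have q20: "q2 z0 \<noteq> 0" using z0 by (simp add: q2_def)
  show ?thesis
  proof (cases "M = (\<lambda>_. 0)")
    case True
    then have p0: "p2 z = 0" "p1 z = 0" for z by (simp_all add: p2_def p1_def)
    \<comment> \<open>Here the quadratic coefficient determines \<open>exp Q\<close> up to a
      constant. Substituting it shows that \<open>P2\<close> is a pure multiple of (H exp g)^2,
      which forces A B = 0 and A + B = 0, hence A = B, contrary to assumption.\<close>
    define K where "K = p0 z0 / (exp (Q z0) * exp (g z0) ^ 2 * q2 z0)"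
    have Kp: "p0 z = K * exp (Q z) * q2 z * exp (g z) ^ 2" for z
      using shift[OF refl refl, of z0 "z - z0"] q20
      by (simp add: p0 K_def exp_diff power_divide field_simps)
    have "P2 z = K * q2 z * exp (g z) ^ 2" for z
    proof -
      have "exp (Q z) * P2 z = exp (Q z) * (K * q2 z * exp (g z) ^ 2)"
        unfolding P12[symmetric] P1p p0 using Kp[of z] by (simp add: mult_ac)
      then show ?thesis by simp
    qed
    then have "q0 z + q1 z * exp (g z) + (q2 z - K * q2 z) * exp (g z) ^ 2 + 0 * exp (g z) ^ 3 + 0 * exp (g z) ^ 4 = 0" for z
      using P2q[of z] by (simp add: algebra_simps)
    note coeffs = quartic_coefficients_eq_0[where ?c0.0 = q0 and ?c1.0 = q1 and ?c2.0 = "\<lambda>z. q2 z - K * q2 z"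
        and ?c3.0 = "\<lambda>_. 0" and ?c4.0 = "\<lambda>_. 0", OF _ _ _ _ _ this]
    have q: "q0 z = 0" "q1 z = 0" for z
      using coeffs(1,2) by (simp_all add: smp small_intros)
    have "H z * (A z + B z) = 0" for z using q(2)[of z] by (simp add: q1_def)
    then have "H = (\<lambda>_. 0) \<or> (\<lambda>z. A z + B z) = (\<lambda>_. 0)"
      by (intro entire_mult_eq_0 holomorphic_intros hol)
    with H0 have "(\<lambda>z. A z + B z) = (\<lambda>_. 0)" by blast
    then have sum0: "A z + B z = 0" for z by (rule fun_cong)
    have "A z = B z" for z
    proof -
      have "A z * A z = - (A z * B z) + A z * (A z + B z)" by (simp add: algebra_simps)
      also have "\<dots> = 0" using q(1)[of z] sum0[of z] by (simp add: q0_def)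
      finally show ?thesis using sum0[of z] by simp
    qed
    then show ?thesis using AB by auto
  next
    case False
    \<comment> \<open>Fixing the base point \<open>z0\<close> and taking the shift
      \<open>z - z0\<close> turns the functional relation into an explicit formula at
      \<open>z\<close>.\<close>
    define K where "K = p2 z0 / (exp (Q z0) * q2 z0)"
    have Kp: "p2 z = K * exp (Q z) * q2 z" for z
    proof -
      define W where "W = exp (g z - g z0)"
      have "W \<noteq> 0" by (simp add: W_def)
      moreover have "p2 z * W ^ 2 * q2 z0 - exp (Q z - Q z0) * (p2 z0 * (q2 z * W ^ 2)) = 0"
        using shift[OF refl refl, of z0 "z - z0"] by (simp add: W_def)
      then have "(p2 z * q2 z0 - exp (Q z - Q z0) * (p2 z0 * q2 z)) * W ^ 2 = 0"
        by (simp add: algebra_simps)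
      ultimately have "p2 z * q2 z0 = exp (Q z - Q z0) * (p2 z0 * q2 z)" by simp
      then show ?thesis using q20 by (simp add: K_def exp_diff field_simps)
    qed
    \<comment> \<open>Multiplying the sharing identity by K q2 replaces \<open>exp Q\<close> by a
      small function; what remains is a quadratic identity in \<open>exp g\<close>.\<close>
    have KP: "K * q2 z * P1 z = p2 z * P2 z" for z
      using Kp[of z] P12[of z] by (simp add: mult_ac)
    then have "(K * q2 z * p0 z - p2 z * q0 z) + (K * q2 z * p1 z - p2 z * q1 z) * exp (g z) +
       (K * q2 z * p2 z - p2 z * q2 z) * exp (g z) ^ 2 + 0 * exp (g z) ^ 3 + 0 * exp (g z) ^ 4 = 0" for z
      using KP[of z] unfolding P1p P2q by (simp add: algebra_simps)
    note coeffs = quartic_coefficients_eq_0[where ?c0.0 = "\<lambda>z. K * q2 z * p0 z - p2 z * q0 z"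
        and ?c1.0 = "\<lambda>z. K * q2 z * p1 z - p2 z * q1 z" and ?c2.0 = "\<lambda>z. K * q2 z * p2 z - p2 z * q2 z"
        and ?c3.0 = "\<lambda>_. 0" and ?c4.0 = "\<lambda>_. 0", OF _ _ _ _ _ this]
    have c: "K * q2 z * p0 z - p2 z * q0 z = 0" "K * q2 z * p1 z - p2 z * q1 z = 0"
       "K * q2 z * p2 z - p2 z * q2 z = 0" for z
      using coeffs(1,2,3)[of z] by (simp_all add: smp small_intros)
    have HM: "\<exists>z. H z * M z \<noteq> 0"
      using entire_mult_eq_0[OF hol(2) hol(1)] H0 False by blast
    then obtain z1 where z1: "H z1 * M z1 \<noteq> 0" by blast
    have "(K - 1) * (H z1 * M z1) ^ 2 = 0"
      using c(3)[of z1] by (simp add: p2_def q2_def algebra_simps power2_eq_square)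
    then have K1: "K = 1" using z1 by simp
    \<comment> \<open>The linear coefficient is H M times this expression. The quadratic one has
      already given K = 1.\<close>
    define E where "E z = H z * (2 * d z - A z - B z) + M z * (A z + B z)" for z
    have Ehol: "E holomorphic_on UNIV" unfolding E_def by (intro holomorphic_intros hol)
    have "(H z * M z) * E z = 0" for z
      using c(2)[of z] by (simp add: K1 p2_def p1_def q2_def q1_def E_def algebra_simps)
    then have "(\<lambda>z. H z * M z) = (\<lambda>_. 0) \<or> E = (\<lambda>_. 0)"
      by (intro entire_mult_eq_0 holomorphic_intros hol Ehol)
    moreover have "(\<lambda>z. H z * M z) \<noteq> (\<lambda>_. 0)" using HM by metis
    ultimately have "E = (\<lambda>_. 0)" by blast
    then have E0: "E z = 0" for z by simp
    \<comment> \<open>Both (2d - A - B)^2 - 4 (d - A)(d - B) and (A + B)^2 - 4 A B equal (A - B)^2.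
      Squaring E = 0 and subtracting four times the constant coefficient therefore leaves (H^2 -
      M^2)(A - B)^2 = 0.\<close>
    have "((H z - M z) * (H z + M z)) * ((A z - B z) * (A z - B z)) = 0" for z
    proof -
      have "H z * (2 * d z - A z - B z) = - (M z * (A z + B z))"
        using E0[of z] by (simp add: E_def add_eq_0_iff2)
      then have "(H z * (2 * d z - A z - B z)) ^ 2 = (M z * (A z + B z)) ^ 2" by simp
      moreover have "H z * H z * ((d z - A z) * (d z - B z)) = M z * M z * (A z * B z)"
        using c(1)[of z] by (simp add: K1 p2_def p0_def q2_def q0_def)
      ultimately show ?thesis by algebra
    qed
    then have "(\<lambda>z. (H z - M z) * (H z + M z)) = (\<lambda>_. 0) \<or> (\<lambda>z. (A z - B z) * (A z - B z)) = (\<lambda>_. 0)"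
      by (intro entire_mult_eq_0 holomorphic_intros hol)
    moreover have "(\<lambda>z. (A z - B z) * (A z - B z)) \<noteq> (\<lambda>_. 0)" using AB by (auto simp: fun_eq_iff)
    ultimately have "(H z - M z) * (H z + M z) = 0" for z by (metis (no_types, lifting))
    then have "(\<lambda>z. H z - M z) = (\<lambda>_. 0) \<or> (\<lambda>z. H z + M z) = (\<lambda>_. 0)"
      by (intro entire_mult_eq_0 holomorphic_intros hol)
    then show ?thesis
    proof
      assume "(\<lambda>z. H z - M z) = (\<lambda>_. 0)"
      then have MH: "M z = H z" for z by (metis eq_iff_diff_eq_0)
      have "H z * (2 * d z) = 0" for z using E0[of z] by (simp add: E_def MH algebra_simps)
      then have "H = (\<lambda>_. 0) \<or> (\<lambda>z. 2 * d z) = (\<lambda>_. 0)"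
        by (intro entire_mult_eq_0 holomorphic_intros hol)
      with H0 have "(\<lambda>z. 2 * d z) = (\<lambda>_. 0)" by blast
      then show ?thesis using MH by (auto simp: fun_eq_iff)
    next
      assume "(\<lambda>z. H z + M z) = (\<lambda>_. 0)"
      then have MH: "M z = - H z" for z by (metis add_eq_0_iff)
      have "H z * (2 * (d z - (A z + B z))) = 0" for z using E0[of z] by (simp add: E_def MH algebra_simps)
      then have "H = (\<lambda>_. 0) \<or> (\<lambda>z. 2 * (d z - (A z + B z))) = (\<lambda>_. 0)"
        by (intro entire_mult_eq_0 holomorphic_intros hol)
      with H0 have "(\<lambda>z. 2 * (d z - (A z + B z))) = (\<lambda>_. 0)" by blast
      then have "2 * (d z - (A z + B z)) = 0" for z by (rule fun_cong)
      then have "d z = A z + B z" for z by (metis mult_eq_0_iff zero_neq_numeral eq_iff_diff_eq_0)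
      then have "d = (\<lambda>z. A z + B z)" by (rule ext)
      moreover have "M = (\<lambda>z. - H z)" using MH by (rule ext)
      ultimately show ?thesis by blast
    qed
  qed
qed

end


section \<open>Difference equations for \<open>H exp g\<close>\<close>

lemma higher_deriv_entire_shift:
  assumes "g holomorphic_on UNIV"
  shows "(deriv ^^ j) (\<lambda>z. g (z + t)) z = (deriv ^^ j) g (z + t)"
  using higher_deriv_compose_linear'[OF assms open_UNIV open_UNIV UNIV_I, where u = 1 and c = t] by simp

lemma higher_deriv_entire_diff_shift:
  assumes "g holomorphic_on UNIV"
  shows "(deriv ^^ j) (\<lambda>z. g (z + t) - g z) z = (deriv ^^ j) g (z + t) - (deriv ^^ j) g z"
  using higher_deriv_diff[OF entire_shift[OF assms] assms open_UNIV UNIV_I]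
  by (simp add: higher_deriv_entire_shift[OF assms])

text \<open>The shift estimate with outer radius r + 2, the least one admissible for a unit shift;
  the moved radius and the constants are absorbed by the larger exponent.\<close>

lemma shift_difference_growth:
  assumes g: "g holomorphic_on UNIV" and \<sigma>: "0 < \<sigma>" "\<sigma> < \<sigma>'"
    and growth: "eventually (\<lambda>r. nev_T r (\<lambda>z. exp (g z)) \<le> exp (r powr \<sigma>)) at_top"
  shows "eventually (\<lambda>r. nev_T r (\<lambda>z. exp (g (z + 1) - g z)) \<le> exp (r powr \<sigma>')) at_top"
proof -
  define D where "D = 4 + 2 * \<bar>Re (g 0)\<bar>"
  have D: "D \<ge> 4" by (simp add: D_def)
  have "filterlim (\<lambda>r::real. r + 2) at_top at_top"
    by (rule filterlim_tendsto_add_at_top[OF tendsto_const filterlim_ident, simplified add.commute])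
  note ev = eventually_compose_filterlim[OF growth this]
  have "eventually (\<lambda>r. 2 * (2 + 1 * r) powr \<sigma> \<le> r powr \<sigma>') at_top"
    using \<sigma> by (intro eventually_affine_powr_le) auto
  moreover have "eventually (\<lambda>r. 2 * ln D * r powr 0 \<le> r powr \<sigma>') at_top"
    using \<sigma> by (intro eventually_powr_le) auto
  ultimately show ?thesis
    using ev eventually_gt_at_top[of 0]
  proof eventually_elim
    case (elim r)
    define X where "X = (r + 2) powr \<sigma>"
    have "nev_T r (\<lambda>z. exp (g (z + 1) - g z)) \<le>
        4 * cmod 1 / (r + 2 - r) * (2 * nev_T (r + 2) (\<lambda>z. exp (g z)) - Re (g 0))"
      using elim by (intro nev_T_exp_shift_diff[OF g]) auto
    also have "\<dots> \<le> 2 * (2 * exp X + \<bar>Re (g 0)\<bar> * exp X)"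
    proof -
      have "\<bar>Re (g 0)\<bar> * 1 \<le> \<bar>Re (g 0)\<bar> * exp X"
        by (intro mult_left_mono) (auto simp: X_def)
      then show ?thesis using elim(3) by (simp add: X_def)
    qed
    also have "\<dots> = exp (ln D + X)" using D by (simp add: exp_add) (simp add: D_def algebra_simps)
    also have "ln D + X \<le> r powr \<sigma>'" using elim by (simp add: X_def add.commute)
    finally show ?case by simp
  qed
qed

text \<open>With g1 the first difference of \<open>g\<close>, telescoping gives exp (g (z + i) - g
  z) as exp (g1 z)^i times a product of shift quotients of exp g1. A nonzero coefficient of
  \<open>g1\<close> beyond \<open>s\<close> would make those products and \<open>H\<close> small
  relative to exp g1. The difference equation would then be a polynomial equation in exp g1,
  although its leading coefficient is not identically zero.\<close>

lemma difference_coefficient_eq_0: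
  assumes g: "g holomorphic_on UNIV" and \<sigma>: "0 < \<sigma>" "\<sigma> < 1"
    and growth: "eventually (\<lambda>r. nev_T r (\<lambda>z. exp (g z)) \<le> exp (r powr \<sigma>)) at_top"
    and H: "H holomorphic_on UNIV" "H \<noteq> (\<lambda>_. 0)" "exp_growth s H" "0 < s"
    and p: "p \<noteq> 0" "\<And>z. shift_op p (\<lambda>z. H z * exp (g z)) z = 0"
    and j: "0 < j" "s < real j"
  shows "(deriv ^^ j) (\<lambda>z. g (z + 1) - g z) 0 = 0"
proof (rule ccontr)
  assume nz: "(deriv ^^ j) (\<lambda>z. g (z + 1) - g z) 0 \<noteq> 0"
  define \<sigma>' where "\<sigma>' = (1 + \<sigma>) / 2"
  define g1 where "g1 z = g (z + 1) - g z" for z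
  have g1: "g1 holomorphic_on UNIV"
    unfolding g1_def by (intro holomorphic_intros entire_shift g)
  interpret D: small_functions g1 \<sigma>' j
  proof
    show "eventually (\<lambda>r. nev_T r (\<lambda>z. exp (g1 z)) \<le> exp (r powr \<sigma>')) at_top"
      unfolding g1_def by (rule shift_difference_growth[OF g \<sigma>(1) _ growth]) (use \<sigma> in \<open>simp add: \<sigma>'_def\<close>)
    show "(deriv ^^ j) g1 0 \<noteq> 0" using nz by (simp add: g1_def[abs_def])
  qed (use g1 j \<sigma> in \<open>auto simp: \<sigma>'_def\<close>)
  define S where "S i z = (\<Prod>l<i. exp (g1 (z + of_nat l) - g1 z))" for i :: nat and z
  have smS: "D.small (S i)" for i unfolding S_def[abs_def] by (intro D.small_prod D.small_exp_g_shift)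
  have smH: "D.small H" by (rule D.small_of_exp_growth[OF H(1,3,4) j(2)])
  have exp_eq: "exp (g (z + of_nat i) - g z) = S i z * exp (g1 z) ^ i" for i z
  proof (induction i)
    case (Suc i)
    have "exp (g (z + of_nat (Suc i)) - g z) = exp (g1 (z + of_nat i)) * exp (g (z + of_nat i) - g z)"
      by (simp add: g1_def add_ac flip: exp_add)
    also have "exp (g1 (z + of_nat i)) = exp (g1 (z + of_nat i) - g1 z) * exp (g1 z)"
      by (simp flip: exp_add)
    finally show ?case unfolding Suc by (simp add: S_def mult_ac)
  qed (simp add: S_def)
  define c where "c i z = coeff p i * (H (z + of_nat i) * S i z)" for i z
  have "c (degree p) z = 0" for z
  proof (rule D.coefficients_eq_0[of "degree p" c])
    show "D.small (c i)" for i unfolding c_def[abs_def]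
      by (intro D.small_intros smS smH)
    show "(\<Sum>i\<le>degree p. c i z * exp (g1 z) ^ i) = 0" for z
    proof -
      have "(\<Sum>i\<le>degree p. coeff p i * (H (z + of_nat i) * exp (g (z + of_nat i) - g z))) * exp (g z) = 0"
        using p(2)[of z] by (subst (asm) shift_op_mult_exp[OF refl])
      then show ?thesis by (simp add: exp_eq c_def mult.assoc)
    qed
  qed simp
  then have "H (z + of_nat (degree p)) = 0" for z
    using p(1) by (auto simp: c_def S_def)
  from this[of "_ - of_nat (degree p)"] have "H z = 0" for z by simp
  then show False using H(2) by auto
qed

text \<open>The positive part of Re g is controlled by exp g, the negative part by exp (-g); by the
  mean value property the two characteristics differ only by Re (g 0).\<close>

lemma abs_Re_le_nev_T:
  assumes g: "g holomorphic_on UNIV" and R: "2 * cmod v + 1 \<le> R"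
  shows "\<bar>Re (g v)\<bar> \<le> 3 * nev_T R (\<lambda>z. exp (g z)) + 3 * \<bar>Re (g 0)\<bar>"
proof -
  have v: "cmod v < R" "R > 0" and R0: "(R + cmod v) / (R - cmod v) \<le> 3"
    using R norm_ge_zero[of v] by (auto simp: divide_le_eq simp del: norm_ge_zero)
  have pos: "max 0 (Re (h v)) \<le> 3 * nev_T R (\<lambda>z. exp (h z))" if h: "h holomorphic_on UNIV" for h
  proof -
    have e: "(\<lambda>z. exp (h z)) holomorphic_on UNIV" by (intro holomorphic_intros h)
    have "lnp (cmod (exp (h v))) \<le> (R + cmod v) / (R - cmod v) * nev_T R (\<lambda>z. exp (h z))"
      by (rule lnp_le_nev_T[OF e v(1)])
    also have "\<dots> \<le> 3 * nev_T R (\<lambda>z. exp (h z))"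
      using v by (intro mult_right_mono R0 nev_T_nonneg e) auto
    finally show ?thesis by simp
  qed
  have m: "(\<lambda>z. - g z) holomorphic_on UNIV" by (intro holomorphic_intros g)
  have "2 * nev_T R (\<lambda>z. exp (g z)) - Re (g 0) = 2 * nev_T R (\<lambda>z. exp (- g z)) + Re (g 0)"
    using circ_mean_abs_Re[OF g v(2)] circ_mean_abs_Re[OF m v(2)] by simp
  then have "nev_T R (\<lambda>z. exp (- g z)) = nev_T R (\<lambda>z. exp (g z)) - Re (g 0)" by simp
  then show ?thesis using pos[OF g] pos[OF m] by auto
qed

text \<open>The hyper-order of exp g becomes an order for \<open>g\<close>: |Re g| is at most
  exponential in r^\<sigma>, and a coefficient estimate on unit circles carries this over to
  derivatives.\<close>

lemma exp_growth_higher_deriv: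
  assumes g: "g holomorphic_on UNIV" and "0 < \<sigma>" "0 < d"
    and growth: "eventually (\<lambda>r. nev_T r (\<lambda>z. exp (g z)) \<le> exp (r powr \<sigma>)) at_top"
  shows "exp_growth \<sigma> ((deriv ^^ d) g)"
proof -
  obtain r0 where r0: "\<And>r. r \<ge> r0 \<Longrightarrow> nev_T r (\<lambda>z. exp (g z)) \<le> exp (r powr \<sigma>)"
    using growth by (auto simp: eventually_at_top_linorder)
  define D where "D = 3 + \<bar>r0\<bar>"
  define B where "B = fact d * (2 * (3 + 3 * \<bar>Re (g 0)\<bar>))"
  have "cmod ((deriv ^^ d) g z) \<le> B * exp (D powr \<sigma> * (1 + cmod z) powr \<sigma>)" for z
  proof -
    define R where "R = D * (1 + cmod z)"
    have "2 * cmod z + 3 + \<bar>r0\<bar> \<le> 3 + 3 * cmod z + \<bar>r0\<bar> + \<bar>r0\<bar> * cmod z" by simp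
    then have R: "2 * cmod z + 3 + \<bar>r0\<bar> \<le> R" by (simp add: R_def D_def algebra_simps)
    have "nev_T R (\<lambda>z. exp (g z)) \<le> exp (R powr \<sigma>)"
      using R norm_ge_zero[of z] by (intro r0) linarith
    also have "R powr \<sigma> = D powr \<sigma> * (1 + cmod z) powr \<sigma>" by (simp add: R_def D_def powr_mult)
    finally have N: "nev_T R (\<lambda>z. exp (g z)) \<le> exp (D powr \<sigma> * (1 + cmod z) powr \<sigma>)" .
    define Y where "Y = exp (D powr \<sigma> * (1 + cmod z) powr \<sigma>)"
    have Y: "Y \<ge> 1" by (simp add: Y_def)
    have "circ_mean 1 (\<lambda>w. \<bar>Re (g (w + z))\<bar>) \<le> circ_mean 1 (\<lambda>w. (3 + 3 * \<bar>Re (g 0)\<bar>) * Y)"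
    proof (rule circ_mean_mono)
      fix w :: complex assume "cmod w = 1"
      then have "2 * cmod (w + z) + 1 \<le> R"
        using norm_triangle_ineq[of w z] R by linarith
      from abs_Re_le_nev_T[OF g this] N
      have "\<bar>Re (g (w + z))\<bar> \<le> 3 * Y + 3 * \<bar>Re (g 0)\<bar> * 1" by (simp add: Y_def)
      also have "\<dots> \<le> 3 * Y + 3 * \<bar>Re (g 0)\<bar> * Y" using Y by (intro add_left_mono mult_left_mono) auto
      finally show "\<bar>Re (g (w + z))\<bar> \<le> (3 + 3 * \<bar>Re (g 0)\<bar>) * Y" by (simp add: algebra_simps)
    qed (auto intro!: continuous_intros entire_continuous_on entire_shift g)
    then have "cmod ((deriv ^^ d) (\<lambda>w. g (w + z)) 0) / fact d * 1 ^ d \<le> 2 * ((3 + 3 * \<bar>Re (g 0)\<bar>) * Y)"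
      using taylor_coeff_le_circ_mean_Re[OF entire_shift[OF g] assms(3), of 1 z] by simp
    then have "cmod ((deriv ^^ d) g z) / fact d \<le> 2 * ((3 + 3 * \<bar>Re (g 0)\<bar>) * Y)"
      by (simp add: higher_deriv_entire_shift[OF g])
    then show ?thesis by (simp add: B_def Y_def pos_divide_le_eq algebra_simps)
  qed
  moreover have "exp_growth \<sigma> (\<lambda>z. of_real B * of_real (exp (D powr \<sigma> * (1 + cmod z) powr \<sigma>)))"
    by (intro exp_growth_mult exp_growth_const assms(2) exp_growthI[of _ "D powr \<sigma>"]) (simp del: of_real_exp)
  then obtain C where "\<And>z. cmod (complex_of_real B * complex_of_real (exp (D powr \<sigma> * (1 + cmod z) powr \<sigma>))) \<le> exp (C * (1 + cmod z) powr \<sigma>)"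
    unfolding exp_growth_def by blast
  then have "\<And>z. B * exp (D powr \<sigma> * (1 + cmod z) powr \<sigma>) \<le> exp (C * (1 + cmod z) powr \<sigma>)"
    unfolding of_real_mult[symmetric] norm_of_real by (meson abs_le_D1)
  ultimately show ?thesis by (meson exp_growthI order_trans)
qed

lemma entire_eq_poly:
  assumes g: "g holomorphic_on UNIV" and high: "\<And>j. d < j \<Longrightarrow> (deriv ^^ j) g 0 = 0"
  obtains P where "degree P \<le> d" "\<And>z. g z = poly P z"
proof -
  define P where "P = (\<Sum>i\<le>d. monom ((deriv ^^ i) g 0 / fact i) i)"
  have "g z = poly P z" for z
  proof -
    have "(\<lambda>n. (deriv ^^ n) g 0 / fact n * (z - 0) ^ n) sums g z"
      by (rule holomorphic_power_series[where r = "cmod z + 1"])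
         (use holomorphic_on_subset[OF g] in \<open>auto simp: add_nonneg_pos\<close>)
    moreover have "(\<lambda>n. (deriv ^^ n) g 0 / fact n * (z - 0) ^ n) sums (\<Sum>n\<le>d. (deriv ^^ n) g 0 / fact n * (z - 0) ^ n)"
      by (rule sums_finite) (use high in auto)
    ultimately have "g z = (\<Sum>n\<le>d. (deriv ^^ n) g 0 / fact n * (z - 0) ^ n)" by (rule sums_unique2)
    then show ?thesis by (simp add: P_def poly_sum poly_monom)
  qed
  moreover have "degree P \<le> d"
    unfolding P_def by (intro degree_sum_le order_trans[OF degree_monom_le]) auto
  ultimately show ?thesis using that by blast
qed

text \<open>A derivative of \<open>g\<close> of order \<open>d\<close> > \<open>s\<close> has zero
  difference, hence is periodic. Its order is at most \<sigma> < 1, so it is constant, and the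
  higher derivatives of \<open>g\<close> vanish.\<close>

lemma polynomial_if_difference_polynomial:
  assumes g: "g holomorphic_on UNIV" and \<sigma>: "0 < \<sigma>" "\<sigma> < 1"
    and growth: "eventually (\<lambda>r. nev_T r (\<lambda>z. exp (g z)) \<le> exp (r powr \<sigma>)) at_top"
    and diff: "\<And>j. 0 < j \<Longrightarrow> s < real j \<Longrightarrow> (deriv ^^ j) (\<lambda>z. g (z + 1) - g z) 0 = 0"
  obtains P where "\<And>z. g z = poly P z"
proof -
  define d where "d = nat \<lceil>s\<rceil> + 1"
  have d: "0 < d" "s < real d" unfolding d_def by linarith+
  define G where "G = (deriv ^^ d) g"
  define K where "K = (deriv ^^ d) (\<lambda>z. g (z + 1) - g z)"
  have dg: "(\<lambda>z. g (z + 1) - g z) holomorphic_on UNIV" by (intro holomorphic_intros entire_shift g)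
  have G: "G holomorphic_on UNIV" unfolding G_def by (intro holomorphic_higher_deriv g) auto
  have K: "K holomorphic_on UNIV" unfolding K_def by (intro holomorphic_higher_deriv dg) auto
  have K0: "(deriv ^^ i) K 0 = 0" for i
  proof -
    have "(deriv ^^ i) K = (deriv ^^ (i + d)) (\<lambda>z. g (z + 1) - g z)" by (simp add: K_def funpow_add)
    then show ?thesis using diff[of "i + d"] d by simp
  qed
  have "K z = K 0" for z by (rule holomorphic_fun_eq_const_on_connected[OF K]) (use K0 in auto)
  then have "K z = 0" for z using K0[of 0] by simp
  then have period: "G (z + 1) = G z" for z
    using higher_deriv_entire_diff_shift[OF g, of d 1 z] by (simp add: K_def G_def)
  have "G z = G 0" for z
    by (rule periodic_small_growth_constant[OF G _ \<sigma> period])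
       (unfold G_def, rule exp_growth_higher_deriv[OF g \<sigma>(1) d(1) growth])
  then have "G = (\<lambda>_. G 0)" by auto
  then have "(deriv ^^ j) g 0 = 0" if "j > d" for j
  proof -
    have "(deriv ^^ (j - d + d)) g = (deriv ^^ (j - d)) G" by (simp add: G_def funpow_add)
    then have "(deriv ^^ j) g = (deriv ^^ (j - d)) G" using that by simp
    also have "\<dots> = (deriv ^^ (j - d)) (\<lambda>_. G 0)" using \<open>G = (\<lambda>_. G 0)\<close> by simp
    finally show ?thesis using that by (simp add: higher_deriv_const)
  qed
  from entire_eq_poly[OF g this] show ?thesis using that by blast
qed


section \<open>Polynomial exponents have degree one\<close>

lemma higher_deriv_poly: "(deriv ^^ j) (poly P) = poly ((pderiv ^^ j) P)"
  by (induction j) (auto intro!: DERIV_imp_deriv poly_DERIV)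

lemma poly_growth:
  fixes q :: "complex poly"
  assumes "degree q \<le> d"
  obtains C where "C \<ge> 0" "\<And>w. cmod (poly q w) \<le> C * (1 + cmod w) ^ d"
proof -
  define C where "C = (\<Sum>i\<le>degree q. cmod (coeff q i))"
  have "cmod (poly q w) \<le> C * (1 + cmod w) ^ d" for w
  proof -
    have "cmod (poly q w) \<le> (\<Sum>i\<le>degree q. cmod (coeff q i) * (1 + cmod w) ^ d)"
      unfolding poly_altdef
    proof (rule sum_norm_le)
      fix i assume i: "i \<in> {..degree q}"
      have "cmod w ^ i \<le> (1 + cmod w) ^ i" by (intro power_mono) auto
      also have "\<dots> \<le> (1 + cmod w) ^ d" using i assms by (intro power_increasing) auto
      finally show "cmod (coeff q i * w ^ i) \<le> cmod (coeff q i) * (1 + cmod w) ^ d"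
        by (simp add: norm_mult norm_power mult_left_mono)
    qed
    then show ?thesis by (simp add: C_def sum_distrib_right)
  qed
  then show ?thesis using that[of C] by (simp add: C_def sum_nonneg)
qed

lemma degree_shift_difference:
  fixes P :: "complex poly"
  shows "degree (pcompose P [:t, 1:] - P) \<le> degree P - 1"
proof (rule degree_le, intro allI impI)
  fix i assume i: "degree P - 1 < i"
  have deg: "degree (pcompose P [:t, 1:]) = degree P" by (simp add: degree_pcompose)
  have lead: "coeff (pcompose P [:t, 1:]) (degree P) = lead_coeff P"
    using lead_coeff_comp[of "[:t, 1:]" P] by (simp add: deg)
  show "coeff (pcompose P [:t, 1:] - P) i = 0"
  proof (cases "i = degree P")
    case True
    then show ?thesis using lead by simp
  next
    case False
    then have "degree P < i" using i by simp
    then show ?thesis using deg by (simp add: coeff_eq_0)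
  qed
qed

text \<open>Solving for the highest shift shows that the sum of |F| over a window of
  \<open>degree p\<close> consecutive points grows by at most the factor L per unit step. Going back
  \<open>m\<close> steps costs only L^m.\<close>

lemma backward_recurrence_bound:
  assumes p: "0 < degree p" and eq: "\<And>z. shift_op p F z = 0"
  shows "\<exists>L\<ge>1. \<forall>z m. cmod (F z) \<le> L ^ m * (\<Sum>i<degree p. cmod (F (z - of_nat m + of_nat i)))"
proof -
  define n where "n = degree p"
  define l where "l = coeff p n"
  have l: "l \<noteq> 0" using p by (auto simp: l_def n_def)
  define L where "L = 1 + (\<Sum>i<n. cmod (coeff p i / l))"
  define \<Phi> where "\<Phi> z = (\<Sum>i<n. cmod (F (z + of_nat i)))" for z
  have top: "cmod (F (z + of_nat n)) \<le> (L - 1) * \<Phi> z" for z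
  proof -
    have "(\<Sum>i<n. coeff p i * F (z + of_nat i)) + l * F (z + of_nat n) = 0"
      using eq[of z] unfolding shift_op_def n_def[symmetric] l_def
      by (simp flip: lessThan_Suc_atMost)
    then have "l * F (z + of_nat n) = - (\<Sum>i<n. coeff p i * F (z + of_nat i))"
      by (simp add: add_eq_0_iff)
    then have "F (z + of_nat n) = - (\<Sum>i<n. coeff p i / l * F (z + of_nat i))"
      using l by (simp add: sum_divide_distrib[symmetric] field_simps sum_distrib_left)
    then have "cmod (F (z + of_nat n)) = cmod (\<Sum>i<n. coeff p i / l * F (z + of_nat i))"
      by (metis norm_minus_cancel)
    also have "\<dots> \<le> (\<Sum>i<n. cmod (coeff p i / l) * \<Phi> z)"
    proof (rule sum_norm_le)
      fix i assume "i \<in> {..<n}"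
      then have "cmod (F (z + of_nat i)) \<le> \<Phi> z"
        unfolding \<Phi>_def by (intro member_le_sum) auto
      then show "cmod (coeff p i / l * F (z + of_nat i)) \<le> cmod (coeff p i / l) * \<Phi> z"
        unfolding norm_mult by (intro mult_left_mono) auto
    qed
    finally show ?thesis by (simp add: L_def sum_distrib_right)
  qed
  have step: "\<Phi> (z + 1) \<le> L * \<Phi> z" for z
  proof -
    have "\<Phi> (z + 1) = (\<Sum>i<n. cmod (F (z + of_nat (Suc i))))" by (simp add: \<Phi>_def add_ac)
    also have "\<dots> \<le> cmod (F (z + of_nat 0)) + (\<Sum>i<n. cmod (F (z + of_nat (Suc i))))" by simp
    also have "\<dots> = (\<Sum>i<Suc n. cmod (F (z + of_nat i)))" by (simp only: sum.lessThan_Suc_shift)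
    also have "\<dots> = \<Phi> z + cmod (F (z + of_nat n))" by (simp add: \<Phi>_def)
    finally show ?thesis using top[of z] by (simp add: algebra_simps)
  qed
  have L1: "L \<ge> 1" by (simp add: L_def sum_nonneg)
  have "\<Phi> (z + of_nat m) \<le> L ^ m * \<Phi> z" for z m
  proof (induction m)
    case (Suc m)
    have "\<Phi> (z + of_nat (Suc m)) \<le> L * \<Phi> (z + of_nat m)"
      using step[of "z + of_nat m"] by (simp add: add_ac)
    also have "\<dots> \<le> L * (L ^ m * \<Phi> z)" using L1 by (intro mult_left_mono Suc) auto
    finally show ?case by (simp add: mult.assoc)
  qed simp
  from this[of "_ - of_nat _"] have iter: "\<Phi> z \<le> L ^ m * \<Phi> (z - of_nat m)" for z m
    by (metis diff_add_cancel)
  have "cmod (F z) \<le> L ^ m * \<Phi> (z - of_nat m)" for z m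
  proof -
    have "cmod (F (z + of_nat 0)) \<le> \<Phi> z"
      unfolding \<Phi>_def using p by (intro member_le_sum[of 0]) (auto simp: n_def)
    then show ?thesis using iter[of z m] by simp
  qed
  then show ?thesis using L1 by (intro exI[of _ L]) (simp add: \<Phi>_def n_def)
qed

lemma circ_mean_min_0_Re:
  assumes "h holomorphic_on UNIV" "r > 0"
  shows "circ_mean r (\<lambda>z. min 0 (Re (h z))) = (Re (h 0) - circ_mean r (\<lambda>z. \<bar>Re (h z)\<bar>)) / 2"
proof -
  have c: "continuous_on S (\<lambda>z. Re (h z))" for S by (intro continuous_intros entire_continuous_on assms)
  have "circ_mean r (\<lambda>z. min 0 (Re (h z))) = circ_mean r (\<lambda>z. (1/2) * (Re (h z) - \<bar>Re (h z)\<bar>))"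
    by (intro circ_mean_cong) (use assms in auto)
  also have "\<dots> = (1/2) * (circ_mean r (\<lambda>z. Re (h (0 + z))) - circ_mean r (\<lambda>z. \<bar>Re (h z)\<bar>))"
    unfolding circ_mean_cmult using assms(2)
    by (subst circ_mean_diff) (auto intro!: continuous_intros c)
  also have "circ_mean r (\<lambda>z. Re (h (0 + z))) = Re (h 0)"
    by (rule circ_mean_Re_holomorphic[OF assms(1)]) (use assms in auto)
  finally show ?thesis by simp
qed

text \<open>In P (z + t) - P z the coefficient of z^k' is (k' + 1) t times the leading coefficient
  of \<open>P\<close>, and the mean of |Re| dominates each Taylor term.\<close>

lemma circ_mean_abs_Re_shift_poly_ge:
  fixes P :: "complex poly"
  assumes "degree P = Suc k'" "k' > 0" "r > 0"
  shows "real (Suc k') * cmod (lead_coeff P) * cmod t * r ^ k' \<le>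
    2 * circ_mean r (\<lambda>z. \<bar>Re (poly P (z + t) - poly P z)\<bar>)"
proof -
  have hol: "poly P holomorphic_on UNIV" by (intro holomorphic_intros)
  define R where "R = (pderiv ^^ k') P"
  have "degree R = 1" using assms(1) by (simp add: R_def degree_higher_pderiv)
  have R1: "coeff R 1 = fact (Suc k') * lead_coeff P"
  proof -
    have "coeff R 1 = pochhammer (of_nat (Suc 1)) k' * coeff P (1 + k')"
      unfolding R_def by (rule coeff_higher_pderiv)
    also have "pochhammer (of_nat (Suc 1)) k' = (fact (Suc k') :: complex)"
      by (simp add: pochhammer_fact pochhammer_rec)
    finally show ?thesis using assms(1) by simp
  qed
  have "poly R t - poly R 0 = coeff R 1 * t"
    using \<open>degree R = 1\<close> by (simp add: poly_altdef)
  then have "(deriv ^^ k') (\<lambda>z. poly P (z + t) - poly P z) 0 = fact (Suc k') * lead_coeff P * t"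
    unfolding higher_deriv_entire_diff_shift[OF hol] higher_deriv_poly R_def[symmetric] R1 by simp
  then have "cmod ((deriv ^^ k') (\<lambda>z. poly P (z + t) - poly P z) 0) / fact k' = real (Suc k') * cmod (lead_coeff P) * cmod t"
    by (simp add: norm_mult del: of_nat_Suc)
  then show ?thesis
    using taylor_coeff_le_circ_mean_Re[of "\<lambda>z. poly P (z + t) - poly P z" k' r] assms
    by (simp add: holomorphic_intros)
qed

text \<open>The recurrence bounds \<open>H exp P\<close> at \<open>z\<close> by its values near \<open>z - m\<close>, so \<open>ln |H z|\<close> is essentially
  at most \<open>Re (P (z - m) - P z)\<close>. On the circle of radius \<open>8 m\<close> the negative part of this has mean of
  order \<open>m ^ degree P\<close>, which contradicts Jensen's inequality for \<open>H\<close>.\<close>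
lemma difference_equation_degree_le_1:
  fixes P :: "complex poly"
  assumes H: "H holomorphic_on UNIV" "H \<noteq> (\<lambda>_. 0)" "exp_growth s H"
    and s: "0 < s" "s < real (degree P)"
    and p: "0 < degree p" and eq: "\<And>z. shift_op p (\<lambda>z. H z * exp (poly P z)) z = 0"
  shows "degree P \<le> 1"
proof (rule ccontr)
  assume "\<not> degree P \<le> 1"
  then obtain k where k: "degree P = Suc k" "k > 0" by (cases "degree P") auto
  define a where "a = cmod (lead_coeff P)"
  have "P \<noteq> 0" using k(1) by auto
  then have a: "a > 0" by (simp add: a_def)
  define n where "n = degree p"
  have n: "n > 0" using p by (simp add: n_def)
  obtain L where L: "L \<ge> 1" "\<And>z m. cmod (H z * exp (poly P z)) \<le>
      L ^ m * (\<Sum>i<n. cmod (H (z - of_nat m + of_nat i) * exp (poly P (z - of_nat m + of_nat i))))"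
    using backward_recurrence_bound[OF p eq] unfolding n_def by blast
  obtain C0 where C0: "C0 \<ge> 0" "\<And>z. cmod (H z) \<le> exp (C0 * (1 + cmod z) powr s)"
    using H(3) by (metis exp_growthE)
  have "\<exists>C. C \<ge> 0 \<and> (\<forall>w. cmod (poly P (w + of_nat i) - poly P w) \<le> C * (1 + cmod w) ^ k)" for i
  proof -
    have "degree (pcompose P [:of_nat i, 1:] - P) \<le> k"
      using degree_shift_difference[of P "of_nat i"] k by simp
    then obtain C where "C \<ge> 0" "\<And>w. cmod (poly (pcompose P [:of_nat i, 1:] - P) w) \<le> C * (1 + cmod w) ^ k"
      using poly_growth by blast
    then show ?thesis by (auto simp: poly_pcompose add.commute intro!: exI[of _ C])
  qed
  then obtain Ci where Ci: "\<And>i. Ci i \<ge> 0"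
     "\<And>i w. cmod (poly P (w + of_nat i) - poly P w) \<le> Ci i * (1 + cmod w) ^ k" by metis
  define C1 where "C1 = (\<Sum>i<n. Ci i)"
  have C1: "C1 \<ge> 0" "\<And>i. i < n \<Longrightarrow> Ci i \<le> C1"
    unfolding C1_def by (auto intro!: sum_nonneg Ci member_le_sum)
  have "degree (P - monom (lead_coeff P) (Suc k)) \<le> k"
  proof (rule degree_le, intro allI impI)
    fix i assume "k < i"
    then show "coeff (P - monom (lead_coeff P) (Suc k)) i = 0"
      using k coeff_eq_0[of P i] by (cases "i = Suc k") auto
  qed
  then obtain C2 where C2: "C2 \<ge> 0" "\<And>w. cmod (poly (P - monom (lead_coeff P) (Suc k)) w) \<le> C2 * (1 + cmod w) ^ k"
    using poly_growth by blast
  obtain c0 where c0: "\<forall>r \<phi>. r \<ge> 1 \<longrightarrow> continuous_on (sphere 0 r) \<phi> \<longrightarrow>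
      (\<forall>w. cmod w = r \<longrightarrow> cmod (H w) \<le> exp (\<phi> w)) \<longrightarrow> c0 \<le> circ_mean r \<phi>"
    using jensen_lower_bound[OF H(1,2)] by blast
  define C3 where "C3 = cmod (poly P 0) - 2 * c0"
  \<comment> \<open>All contributions of lower order than m^(k+1): the recurrence constant, the
    number of terms, the growth of \<open>H\<close>, and the variation of \<open>P\<close> over the
    window.\<close>
  define E where "E m = real m * ln L + ln (real n) + C0 * ((10 + real n) * real m) powr s + C1 * (10 * real m) ^ k" for m :: nat
  \<comment> \<open>On the circle of radius 8m the mean of |Re h| is at least 8 a m^(k+1), because
    (k + 1) 8^k \<ge> 16. The value Re (h 0) can compensate at most one a m^(k+1), up to lower
    order, so seven remain.\<close>
  have main: "7 * a * real m ^ Suc k \<le> 2 * E m + C2 * (2 * real m) ^ k + C3" if m: "m \<ge> 1" for m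
  proof -
    define r where "r = 8 * real m"
    have r: "r \<ge> 1" "r > 0" using m by (simp_all add: r_def)
    define h where "h z = poly P (z + (- of_nat m)) - poly P z" for z
    have h: "h holomorphic_on UNIV" unfolding h_def by (intro holomorphic_intros)
    have Rc: "continuous_on S (\<lambda>z. Re (h z))" for S by (intro continuous_intros entire_continuous_on h)
    have E0: "C0 * (1 + r) powr s \<le> E m"
    proof -
      have "C0 * (1 + r) powr s \<le> C0 * ((10 + real n) * real m) powr s"
        using C0(1) s m by (intro mult_left_mono powr_mono2) (auto simp: r_def algebra_simps intro: add_increasing)
      moreover have "0 \<le> real m * ln L" "0 \<le> ln (real n)" "0 \<le> C1 * (10 * real m) ^ k"
        using L(1) n C1 by auto
      ultimately show ?thesis unfolding E_def by linarith
    qed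
    \<comment> \<open>Two bounds meet here: the growth of \<open>H\<close> alone gives exp (E m),
      the recurrence gives exp (E m + Re (h z)). Their minimum isolates the negative part of Re
      h.\<close>
    have "cmod (H z) \<le> exp (E m + min 0 (Re (h z)))" if z: "cmod z = r" for z
    proof -
      define w where "w = z - of_nat m"
      have w: "1 + cmod w \<le> 10 * real m"
        using norm_triangle_ineq4[of z "of_nat m"] z m by (simp add: w_def r_def)
      have bound: "cmod (H (w + of_nat i) * exp (poly P (w + of_nat i))) \<le>
          exp (C0 * ((10 + real n) * real m) powr s + C1 * (10 * real m) ^ k + Re (poly P w))" if i: "i < n" for i
      proof -
        have "real n * 1 \<le> real n * real m" using m by (intro mult_left_mono) auto
        moreover have "cmod (w + of_nat i) \<le> cmod w + real i"
          using norm_triangle_ineq[of w "of_nat i"] by simp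
        moreover have "real i \<le> real n" using i by simp
        moreover have "(10 + real n) * real m = 10 * real m + real n * real m" by (rule distrib_right)
        ultimately have "1 + cmod (w + of_nat i) \<le> (10 + real n) * real m" using w by linarith
        then have "C0 * (1 + cmod (w + of_nat i)) powr s \<le> C0 * ((10 + real n) * real m) powr s"
          using C0(1) s by (intro mult_left_mono powr_mono2) auto
        then have 1: "cmod (H (w + of_nat i)) \<le> exp (C0 * ((10 + real n) * real m) powr s)"
          using C0(2)[of "w + of_nat i"] by (meson exp_le_cancel_iff order_trans)
        have "Re (poly P (w + of_nat i) - poly P w) \<le> cmod (poly P (w + of_nat i) - poly P w)"
          by (rule complex_Re_le_cmod)
        also have "\<dots> \<le> Ci i * (1 + cmod w) ^ k" by (rule Ci)
        also have "\<dots> \<le> C1 * (10 * real m) ^ k"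
          using C1 i w by (intro mult_mono power_mono) auto
        finally have 2: "Re (poly P (w + of_nat i)) \<le> C1 * (10 * real m) ^ k + Re (poly P w)" by simp
        have "cmod (H (w + of_nat i) * exp (poly P (w + of_nat i))) \<le>
            exp (C0 * ((10 + real n) * real m) powr s) * exp (C1 * (10 * real m) ^ k + Re (poly P w))"
          unfolding norm_mult norm_exp_eq_Re using 1 2 by (intro mult_mono) auto
        then show ?thesis by (simp add: exp_add mult.assoc)
      qed
      have "cmod (H z * exp (poly P z)) \<le> L ^ m * (\<Sum>i<n. cmod (H (w + of_nat i) * exp (poly P (w + of_nat i))))"
        unfolding w_def by (rule L(2))
      also have "\<dots> \<le> L ^ m * (\<Sum>i<n. exp (C0 * ((10 + real n) * real m) powr s + C1 * (10 * real m) ^ k + Re (poly P w)))"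
        using L(1) by (intro mult_left_mono sum_mono bound) auto
      also have "\<dots> = L ^ m * real n * exp (C0 * ((10 + real n) * real m) powr s + C1 * (10 * real m) ^ k + Re (poly P w))"
        by simp
      also have "\<dots> = exp (real m * ln L) * exp (ln (real n)) *
          exp (C0 * ((10 + real n) * real m) powr s + C1 * (10 * real m) ^ k + Re (poly P w))"
        using L(1) n by (simp add: exp_of_nat_mult)
      also have "\<dots> = exp (E m + Re (poly P w))"
        unfolding E_def exp_add[symmetric] by (simp add: add_ac)
      finally have "cmod (H z) * exp (Re (poly P z)) \<le> exp (E m + Re (poly P w))"
        by (simp add: norm_mult)
      then have "cmod (H z) \<le> exp (E m + Re (poly P w)) / exp (Re (poly P z))"
        by (simp add: pos_le_divide_eq)
      also have "\<dots> = exp (E m + Re (h z))" by (simp add: h_def w_def exp_add exp_diff)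
      finally have "cmod (H z) \<le> exp (E m + Re (h z))" .
      moreover have "cmod (H z) \<le> exp (E m)"
        using C0(2)[of z] E0 z by (meson exp_le_cancel_iff order_trans order_refl)
      ultimately show ?thesis by (auto simp: min_def)
    qed
    note majorant = this
    have "continuous_on (sphere 0 r) (\<lambda>z. E m + min 0 (Re (h z)))" by (intro continuous_intros Rc)
    from c0[rule_format, OF r(1) this majorant]
    have "c0 \<le> circ_mean r (\<lambda>z. E m + min 0 (Re (h z)))" .
    also have "\<dots> = E m + (Re (h 0) - circ_mean r (\<lambda>z. \<bar>Re (h z)\<bar>)) / 2"
      using r by (subst circ_mean_add) (auto intro!: continuous_intros Rc simp: circ_mean_min_0_Re[OF h])
    finally have 1: "circ_mean r (\<lambda>z. \<bar>Re (h z)\<bar>) \<le> Re (h 0) + 2 * E m - 2 * c0" by (simp add: field_simps)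
    have "Re (h 0) \<le> cmod (h 0)" by (rule complex_Re_le_cmod)
    also have "\<dots> \<le> cmod (poly P (- of_nat m)) + cmod (poly P 0)"
      unfolding h_def by (simp add: norm_triangle_ineq4)
    also have "poly P (- of_nat m) = poly (monom (lead_coeff P) (Suc k)) (- of_nat m) +
        poly (P - monom (lead_coeff P) (Suc k)) (- of_nat m)" by simp
    also have "cmod \<dots> \<le> a * real m ^ Suc k + C2 * (1 + real m) ^ k"
      using C2(2)[of "- of_nat m"]
      by (intro norm_triangle_mono) (simp_all add: poly_monom a_def norm_mult norm_power del: power_Suc)
    also have "C2 * (1 + real m) ^ k \<le> C2 * (2 * real m) ^ k"
      using m C2(1) by (intro mult_left_mono power_mono) auto
    finally have 2: "Re (h 0) \<le> a * real m ^ Suc k + C2 * (2 * real m) ^ k + cmod (poly P 0)" by simp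
    have "real (Suc k) * a * cmod (- complex_of_nat m) * r ^ k \<le> 2 * circ_mean r (\<lambda>z. \<bar>Re (h z)\<bar>)"
      unfolding h_def a_def by (rule circ_mean_abs_Re_shift_poly_ge[OF k r(2)])
    moreover have "2 * 8 * (a * real m ^ Suc k) \<le> real (Suc k) * 8 ^ k * (a * real m ^ Suc k)"
    proof (intro mult_right_mono mult_mono)
      have "(8::real) ^ 1 \<le> 8 ^ k" using k(2) by (intro power_increasing) auto
      then show "(8::real) \<le> 8 ^ k" by simp
    qed (use k(2) a in auto)
    ultimately have "16 * (a * real m ^ Suc k) \<le> 2 * circ_mean r (\<lambda>z. \<bar>Re (h z)\<bar>)"
      by (simp add: r_def power_mult_distrib mult_ac)
    then show ?thesis using 1 2 unfolding C3_def by linarith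
  qed
  define K where "K = real (Suc k)"
  have K: "1 < K" "s < K" "real k < K" "0 < K" using k s by (simp_all add: K_def)
  \<comment> \<open>Each of the five error groups is eventually at most a m^(k+1), against seven on
    the other side.\<close>
  have "eventually (\<lambda>x. (2 * ln L / a) * x powr 1 \<le> x powr K) at_top"
    "eventually (\<lambda>x. ((2 * ln (real n) + C3) / a) * x powr 0 \<le> x powr K) at_top"
    "eventually (\<lambda>x. (2 * C0 * (10 + real n) powr s / a) * x powr s \<le> x powr K) at_top"
    "eventually (\<lambda>x. (2 * C1 * 10 ^ k / a) * x powr real k \<le> x powr K) at_top"
    "eventually (\<lambda>x. (C2 * 2 ^ k / a) * x powr real k \<le> x powr K) at_top"
    by (intro eventually_powr_le K)+
  then have "eventually (\<lambda>m::nat.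
      (2 * ln L / a) * real m powr 1 \<le> real m powr K \<and>
      ((2 * ln (real n) + C3) / a) * real m powr 0 \<le> real m powr K \<and>
      (2 * C0 * (10 + real n) powr s / a) * real m powr s \<le> real m powr K \<and>
      (2 * C1 * 10 ^ k / a) * real m powr real k \<le> real m powr K \<and>
      (C2 * 2 ^ k / a) * real m powr real k \<le> real m powr K) at_top"
    by (intro eventually_conj) (erule eventually_compose_filterlim[OF _ filterlim_real_sequentially])+
  then have "eventually (\<lambda>m::nat. False) at_top"
    using eventually_ge_at_top[of 1]
  proof eventually_elim
    case (elim m)
    define X where "X = a * real m ^ Suc k"
    have mK: "real m powr K = real m ^ Suc k" unfolding K_def using elim by (intro powr_realpow) auto
    have mk: "real m powr real k = real m ^ k" using elim by (intro powr_realpow) auto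
    have X: "X > 0" using a elim by (simp add: X_def)
    have t1: "2 * (real m * ln L) \<le> X" using elim a unfolding mK X_def by (simp add: field_simps)
    have t2: "2 * ln (real n) + C3 \<le> X" using elim a unfolding mK X_def by (simp add: field_simps)
    have "((10 + real n) * real m) powr s = (10 + real n) powr s * real m powr s" by (simp add: powr_mult)
    then have t3: "2 * (C0 * ((10 + real n) * real m) powr s) \<le> X"
      using elim a unfolding mK X_def by (simp add: field_simps)
    have t4: "2 * (C1 * (10 * real m) ^ k) \<le> X"
      using elim a unfolding mK mk X_def by (simp add: field_simps power_mult_distrib)
    have t5: "C2 * (2 * real m) ^ k \<le> X"
      using elim a unfolding mK mk X_def by (simp add: field_simps power_mult_distrib)
    have "7 * X \<le> 2 * E m + C2 * (2 * real m) ^ k + C3"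
      using main[of m] elim by (simp add: X_def mult.assoc)
    then show False using t1 t2 t3 t4 t5 X unfolding E_def distrib_left by linarith
  qed
  then show False by simp
qed

text \<open>Conjugation by exp (\<gamma> z) replaces the shift E by e^\<gamma> E.\<close>

lemma shift_op_power_exp:
  "shift_op ([:-1, 1:] ^ n) (\<lambda>z. H z * exp (b + \<gamma> * z)) z =
    exp (b + \<gamma> * z) * shift_op ([:-1, exp \<gamma>:] ^ n) H z"
proof (induction n arbitrary: z)
  case (Suc n)
  have "exp (b + \<gamma> * (z + 1)) = exp (b + \<gamma> * z) * exp \<gamma>"
    by (simp add: algebra_simps exp_add)
  then show ?case unfolding power_Suc shift_op_linear_mult Suc by (simp add: algebra_simps)
qed simp

lemma difference_equation_exp_linear:
  assumes g: "g holomorphic_on UNIV" and \<sigma>: "0 < \<sigma>" "\<sigma> < 1"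
    and growth: "eventually (\<lambda>r. nev_T r (\<lambda>z. exp (g z)) \<le> exp (r powr \<sigma>)) at_top"
    and k: "s < real k" "(deriv ^^ k) g 0 \<noteq> 0"
    and H: "H holomorphic_on UNIV" "H \<noteq> (\<lambda>_. 0)" "exp_growth s H" "0 < s"
    and eq: "\<And>z. fdiff n (\<lambda>z. H z * exp (g z)) z = \<epsilon> * (H z * exp (g z))"
    and n: "n > 0" and \<epsilon>: "\<epsilon> \<noteq> 0"
  obtains q \<gamma> where "q \<noteq> 0" "\<gamma> \<noteq> 0" "\<And>z. H z * exp (g z) = q * exp (\<gamma> * z)"
proof -
  define p :: "complex poly" where "p = [:-1, 1:] ^ n - [:\<epsilon>:]"
  have "degree ([:-1, 1:] ^ n :: complex poly) = n" by (simp add: degree_power_eq)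
  then have degp: "degree p = n" unfolding p_def diff_conv_add_uminus using n
    by (subst degree_add_eq_left) auto
  have p: "0 < degree p" "p \<noteq> 0" using degp n by auto
  have eqp: "shift_op p (\<lambda>z. H z * exp (g z)) z = 0" for z
    using eq[of z] by (simp add: p_def shift_op_diff fdiff_eq_shift_op shift_op_pCons)
  obtain P where P: "\<And>z. g z = poly P z"
    using polynomial_if_difference_polynomial[OF g \<sigma> growth difference_coefficient_eq_0[OF g \<sigma> growth H p(2) eqp]] by blast
  have gP: "g = poly P" using P by auto
  have "k \<le> degree P"
  proof (rule ccontr)
    assume "\<not> k \<le> degree P"
    then have "coeff ((pderiv ^^ k) P) 0 = 0" by (simp add: coeff_higher_pderiv coeff_eq_0)
    then show False using k(2) by (simp add: gP higher_deriv_poly poly_0_coeff_0)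
  qed
  then have sP: "s < real (degree P)" using k(1) by linarith
  have "degree P \<le> 1"
    by (rule difference_equation_degree_le_1[OF H(1,2,3,4) sP p(1)]) (use eqp in \<open>simp add: gP\<close>)
  then have deg: "degree P = 1" "s < 1" using sP H(4) by (cases "degree P"; simp)+
  define b where "b = coeff P 0"
  define \<gamma> where "\<gamma> = coeff P 1"
  have \<gamma>: "\<gamma> \<noteq> 0" using deg(1) by (metis \<gamma>_def leading_coeff_0_iff degree_0 zero_neq_one)
  have gb: "g z = b + \<gamma> * z" for z
    unfolding P poly_altdef deg(1) by (simp add: b_def \<gamma>_def)
  define p' where "p' = [:-1, exp \<gamma>:] ^ n - [:\<epsilon>:]"
  have eqH: "shift_op p' H z = 0" for z
  proof -
    have "exp (b + \<gamma> * z) * shift_op ([:-1, exp \<gamma>:] ^ n) H z = \<epsilon> * (H z * exp (b + \<gamma> * z))"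
      using eq[of z] unfolding gb fdiff_eq_shift_op shift_op_power_exp .
    then have "exp (b + \<gamma> * z) * shift_op p' H z = 0"
      by (simp add: p'_def shift_op_diff shift_op_pCons algebra_simps)
    then show ?thesis by simp
  qed
  \<comment> \<open>A double root at 1 would require both (e^\<gamma> - 1)^n = \<epsilon> and n
    (e^\<gamma> - 1)^(n-1) e^\<gamma> = 0, which is impossible for \<epsilon> \<noteq> 0.\<close>
  have simple: "poly p' 1 \<noteq> 0 \<or> poly (pderiv p') 1 \<noteq> 0"
  proof (rule ccontr)
    assume *: "\<not> ?thesis"
    then have "(exp \<gamma> - 1) ^ n = \<epsilon>" by (simp add: p'_def poly_power)
    then have "exp \<gamma> - 1 \<noteq> 0" using \<epsilon> n by (auto simp: power_0_left)
    moreover have "poly (pderiv p') 1 = of_nat n * (exp \<gamma> - 1) ^ (n - 1) * exp \<gamma>"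
    proof -
      obtain n' where n': "n = Suc n'" using n by (cases n) auto
      have "pderiv p' = pderiv ([:-1, exp \<gamma>:] ^ Suc n')"
        unfolding p'_def pderiv_diff n' by (simp add: pderiv_pCons del: power_Suc)
      also have "\<dots> = smult (of_nat (Suc n')) ([:-1, exp \<gamma>:] ^ n') * pderiv [:-1, exp \<gamma>:]"
        by (rule pderiv_power_Suc)
      finally show ?thesis by (simp add: n' pderiv_pCons poly_power)
    qed
    ultimately show False using * n by simp
  qed
  have const: "H z = H 0" for z
    by (rule shift_op_eq_0_imp_constant[OF H(1,3,4) deg(2) eqH simple])
  have "H 0 \<noteq> 0" using H(2) const by (metis ext)
  show ?thesis
  proof (rule that[of "H 0 * exp b" \<gamma>])
    show "H z * exp (g z) = H 0 * exp b * exp (\<gamma> * z)" for z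
      using const[of z] by (simp add: gb exp_add)
  qed (use \<open>H 0 \<noteq> 0\<close> \<gamma> in auto)
qed


section \<open>Orders, exceptional sets and shared values\<close>

lemma zero_exponent_nonneg: "0 \<le> zero_exponent h"
  unfolding zero_exponent_def
proof (rule le_Limsup)
  show "\<forall>\<^sub>F r in at_top. 0 \<le> ereal (lnp (zero_count r h) / ln r)"
    using eventually_gt_at_top[of 1] by eventually_elim simp
qed simp

lemma nev_order_le:
  assumes "s \<ge> 0" "eventually (\<lambda>r. nev_T r f \<le> r powr s) at_top"
  shows "nev_order f \<le> ereal s"
  unfolding nev_order_def
proof (rule Limsup_bounded)
  show "\<forall>\<^sub>F r in at_top. ereal (lnp (nev_T r f) / ln r) \<le> ereal s"
    using assms(2) eventually_gt_at_top[of 1]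
  proof eventually_elim
    case (elim r)
    have "lnp (nev_T r f) \<le> s * ln r"
      using elim assms(1) by (subst lnp_le_iff) (auto simp: powr_def)
    then show ?case using elim(2) by (simp add: divide_le_eq)
  qed
qed

lemma nev_T_le_powr_of_order:
  assumes "nev_order f < ereal s"
  shows "eventually (\<lambda>r. nev_T r f \<le> r powr s) at_top"
proof -
  have "eventually (\<lambda>r. ereal (lnp (nev_T r f) / ln r) < ereal s) at_top"
    using assms unfolding nev_order_def by (rule Limsup_lessD)
  then show ?thesis
    using eventually_gt_at_top[of 1]
  proof eventually_elim
    case (elim r)
    then have "lnp (nev_T r f) \<le> s * ln r" by (simp add: divide_less_eq)
    then have "exp (lnp (nev_T r f)) \<le> r powr s" using elim(2) by (simp add: powr_def)
    then show ?case using le_exp_lnp order_trans by blast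
  qed
qed

lemma nev_T_le_exp_of_hyper_order:
  assumes "hyper_order f < ereal s"
  shows "eventually (\<lambda>r. nev_T r f \<le> exp (r powr s)) at_top"
proof -
  have "eventually (\<lambda>r. ereal (lnp (lnp (nev_T r f)) / ln r) < ereal s) at_top"
    using assms unfolding hyper_order_def by (rule Limsup_lessD)
  then show ?thesis
    using eventually_gt_at_top[of 1]
  proof eventually_elim
    case (elim r)
    then have "lnp (lnp (nev_T r f)) \<le> s * ln r" by (simp add: divide_less_eq)
    then have "exp (lnp (lnp (nev_T r f))) \<le> r powr s" using elim(2) by (simp add: powr_def)
    then have "lnp (nev_T r f) \<le> r powr s" using le_exp_lnp order_trans by blast
    then show ?case by (subst (asm) lnp_le_iff) auto
  qed
qed

lemma exp_growth_of_order_less_1: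
  assumes "c holomorphic_on UNIV" "nev_order c < 1"
  obtains s where "0 < s" "s < 1" "exp_growth s c"
proof -
  obtain x where x: "nev_order c < ereal x" "ereal x < 1" using ereal_dense2[OF assms(2)] by blast
  define s where "s = max x (1/2)"
  have s: "0 < s" "s < 1" using x(2) by (auto simp: s_def)
  have "ereal x \<le> ereal s" by (simp add: s_def)
  with x(1) have "nev_order c < ereal s" by (rule less_le_trans)
  then have "eventually (\<lambda>r. nev_T r c \<le> r powr s) at_top" by (rule nev_T_le_powr_of_order)
  then obtain r0 where "\<And>r. r \<ge> r0 \<Longrightarrow> nev_T r c \<le> 1 * r powr s"
    by (auto simp: eventually_at_top_linorder)
  then show ?thesis using exp_growth_of_nev_T[OF assms(1) s(1)] s that by blast
qed

text \<open>Every interval of a fixed length L meets the complement of \<open>E\<close>;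
  monotonicity of the characteristic carries the bound back from such a point, and t > s absorbs the
  displacement.\<close>

lemma nev_order_le_of_nonexceptional_bound:
  assumes f: "f holomorphic_on UNIV" and E: "E \<in> sets lebesgue" "emeasure lebesgue E < \<infinity>"
    and s: "0 \<le> s" "s < t" and C: "C \<ge> 0"
    and le: "\<And>r. r \<ge> R \<Longrightarrow> r \<notin> E \<Longrightarrow> nev_T r f \<le> C * (1 + r) powr s"
  shows "nev_order f \<le> ereal t"
proof (rule nev_order_le)
  obtain L where L: "L > 0" "\<And>x y. L \<le> y - x \<Longrightarrow> \<exists>r'. x \<le> r' \<and> r' \<le> y \<and> r' \<notin> E"
    using nonexceptional_radius[OF E] by blast
  have "eventually (\<lambda>r. C * ((1 + L) + 1 * r) powr s \<le> r powr t) at_top"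
    using s L by (intro eventually_affine_powr_le) auto
  then show "eventually (\<lambda>r. nev_T r f \<le> r powr t) at_top"
    using eventually_ge_at_top[of R] eventually_gt_at_top[of 0]
  proof eventually_elim
    case (elim r)
    obtain r' where r': "r \<le> r'" "r' \<le> r + L" "r' \<notin> E" using L(2)[where x = r and y = "r + L"] by auto
    have "nev_T r f \<le> nev_T r' f" using elim r' by (intro nev_T_mono f) auto
    also have "\<dots> \<le> C * (1 + r') powr s" using elim r' by (intro le) auto
    also have "\<dots> \<le> C * ((1 + L) + 1 * r) powr s"
      using C s r' elim by (intro mult_left_mono powr_mono2) auto
    finally show ?case using elim(1) by linarith
  qed
qed (use s in auto)

text \<open>If \<open>f\<close> were small with respect to itself, T \<le> T/2 off the exceptional
  set would give T \<le> 0 there, hence order 0.\<close>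

lemma small_fun_neq_self:
  assumes "f holomorphic_on UNIV" "small_fun a f" "0 < nev_order f"
  shows "f \<noteq> a"
proof
  assume fa: "f = a"
  obtain E where E: "E \<in> sets lebesgue" "emeasure lebesgue E < \<infinity>"
    "\<And>\<epsilon>. \<epsilon> > 0 \<Longrightarrow> \<exists>R. \<forall>r\<ge>R. r \<notin> E \<longrightarrow> nev_T r f \<le> \<epsilon> * nev_T r f"
    using assms(2) fa by (auto simp: small_fun_def)
  obtain R where R: "\<And>r. r \<ge> R \<Longrightarrow> r \<notin> E \<Longrightarrow> nev_T r f \<le> 1/2 * nev_T r f"
    using E(3)[of "1/2"] by auto
  obtain t where t: "0 < ereal t" "ereal t < nev_order f" using ereal_dense2[OF assms(3)] by blast
  have "nev_order f \<le> ereal t"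
  proof (rule nev_order_le_of_nonexceptional_bound[OF assms(1) E(1,2), of 0 t 0 R])
    show "nev_T r f \<le> 0 * (1 + r) powr 0" if "R \<le> r" "r \<notin> E" for r using R[OF that] by simp
  qed (use t in auto)
  then show False using t(2) by simp
qed

section \<open>Zero multiplicities and shared pairs\<close>

lemma entire_mult_neq_0:
  assumes "f holomorphic_on UNIV" "h holomorphic_on UNIV" "f \<noteq> (\<lambda>_. 0)" "h \<noteq> (\<lambda>_. 0)"
  shows "(\<lambda>z. f z * h z) \<noteq> (\<lambda>_. 0)"
proof
  assume "(\<lambda>z. f z * h z) = (\<lambda>_. 0)"
  then have "f z * h z = 0" for z by (rule fun_cong)
  then show False using entire_mult_eq_0[OF assms(1,2)] assms(3,4) by blast
qed

lemma zero_mult_entire: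
  assumes "h holomorphic_on UNIV" "h \<noteq> (\<lambda>_. 0)"
  shows "zero_mult h z = enat (nat (zorder h z))"
proof (cases "h z = 0")
  case True
  then show ?thesis using assms(2) by (simp add: zero_mult_def)
next
  case False
  then have "zorder h z = 0"
    using entire_zorder_ge_0[OF assms] entire_zorder_pos_iff[OF assms] by (metis order_le_less)
  then show ?thesis using False by (simp add: zero_mult_def zero_enat_def)
qed

lemma zero_mult_zero_fun: "zero_mult (\<lambda>_. 0) z = \<infinity>"
  by (simp add: zero_mult_def)

text \<open>\<open>zero_mult\<close> is infinite for the zero function, so sharing with \<open>F - a\<close>, \<open>F - b\<close> nonzero
  forces \<open>G - a\<close>, \<open>G - b\<close> to be nonzero.\<close>
lemma share_CM_pair_exp:
  assumes hol: "F holomorphic_on UNIV" "G holomorphic_on UNIV" "a holomorphic_on UNIV" "b holomorphic_on UNIV"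
    and ab: "a \<noteq> b" and ne: "F \<noteq> a" "F \<noteq> b" and share: "share_CM {a, b} F G"
  obtains Q where "Q holomorphic_on UNIV"
    "\<And>z. (G z - a z) * (G z - b z) = exp (Q z) * ((F z - a z) * (F z - b z))"
proof -
  have share': "zero_mult (\<lambda>w. F w - a w) z + zero_mult (\<lambda>w. F w - b w) z =
      zero_mult (\<lambda>w. G w - a w) z + zero_mult (\<lambda>w. G w - b w) z" for z
    using share ab by (simp add: share_CM_def)
  have F: "(\<lambda>w. F w - a w) \<noteq> (\<lambda>_. 0)" "(\<lambda>w. F w - b w) \<noteq> (\<lambda>_. 0)"
    using ne by (auto simp: fun_eq_iff)
  have Fh: "(\<lambda>w. F w - a w) holomorphic_on UNIV" "(\<lambda>w. F w - b w) holomorphic_on UNIV"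
    and Gh: "(\<lambda>w. G w - a w) holomorphic_on UNIV" "(\<lambda>w. G w - b w) holomorphic_on UNIV"
    by (intro holomorphic_intros hol)+
  note FM = zero_mult_entire[OF Fh(1) F(1)] zero_mult_entire[OF Fh(2) F(2)]
  have fin: "zero_mult (\<lambda>w. G w - a w) 0 + zero_mult (\<lambda>w. G w - b w) 0 \<noteq> \<infinity>"
    unfolding share'[of 0, symmetric] FM by simp
  have G: "(\<lambda>w. G w - a w) \<noteq> (\<lambda>_. 0)" "(\<lambda>w. G w - b w) \<noteq> (\<lambda>_. 0)"
  proof -
    show "(\<lambda>w. G w - a w) \<noteq> (\<lambda>_. 0)"
    proof
      assume "(\<lambda>w. G w - a w) = (\<lambda>_. 0)"
      then show False using fin by (simp add: zero_mult_zero_fun)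
    qed
    show "(\<lambda>w. G w - b w) \<noteq> (\<lambda>_. 0)"
    proof
      assume "(\<lambda>w. G w - b w) = (\<lambda>_. 0)"
      then show False using fin by (simp add: zero_mult_zero_fun)
    qed
  qed
  note GM = zero_mult_entire[OF Gh(1) G(1)] zero_mult_entire[OF Gh(2) G(2)]
  have FF: "(\<lambda>w. (F w - a w) * (F w - b w)) holomorphic_on UNIV" "(\<lambda>w. (F w - a w) * (F w - b w)) \<noteq> (\<lambda>_. 0)"
    by (intro holomorphic_intros hol entire_mult_neq_0 Fh F)+
  have GG: "(\<lambda>w. (G w - a w) * (G w - b w)) holomorphic_on UNIV" "(\<lambda>w. (G w - a w) * (G w - b w)) \<noteq> (\<lambda>_. 0)"
    by (intro holomorphic_intros hol entire_mult_neq_0 Gh G)+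
  have zo: "zorder (\<lambda>w. (G w - a w) * (G w - b w)) z = zorder (\<lambda>w. (F w - a w) * (F w - b w)) z" for z
    using share'[of z] entire_zorder_ge_0[OF Fh(1) F(1), of z] entire_zorder_ge_0[OF Fh(2) F(2), of z]
      entire_zorder_ge_0[OF Gh(1) G(1), of z] entire_zorder_ge_0[OF Gh(2) G(2), of z]
    unfolding FM GM entire_zorder_mult[OF Fh(1) F(1) Fh(2) F(2)] entire_zorder_mult[OF Gh(1) G(1) Gh(2) G(2)]
    by simp
  show ?thesis
  proof (rule entire_eq_exp_mult[OF GG(1) FF(1) _ zo])
    show "(G z - a z) * (G z - b z) = 0 \<longleftrightarrow> (F z - a z) * (F z - b z) = 0" for z
      using entire_zorder_pos_iff[OF GG, of z] entire_zorder_pos_iff[OF FF, of z] zo[of z] by simp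
  qed (rule that)
qed

lemma eventually_powr_le_exp:
  fixes s \<sigma> :: real
  assumes "0 \<le> s" "0 < \<sigma>"
  shows "eventually (\<lambda>r. C * (1 + r) powr s \<le> exp (r powr \<sigma>)) at_top"
proof -
  define \<tau> where "\<tau> = \<sigma> / 2"
  have \<tau>: "0 < \<tau>" "\<tau> < \<sigma>" using assms by (simp_all add: \<tau>_def)
  have "eventually (\<lambda>r. C * (1 + 1 * r) powr s \<le> r powr (s + 1)) at_top"
    using assms by (intro eventually_affine_powr_le) auto
  moreover have "eventually (\<lambda>r. ((s + 1) / \<tau>) * r powr \<tau> \<le> r powr \<sigma>) at_top"
    using \<tau> by (intro eventually_powr_le)
  ultimately show ?thesis
    using eventually_gt_at_top[of 0]
  proof eventually_elim
    case (elim r)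
    have "(s + 1) * ln r \<le> (s + 1) * (r powr \<tau> / \<tau>)"
      using assms(1) ln_le_powr_div[OF elim(3) \<tau>(1)] by (intro mult_left_mono) auto
    also have "\<dots> \<le> r powr \<sigma>" using elim(2) by simp
    finally have "r powr (s + 1) \<le> exp (r powr \<sigma>)" using elim(3) by (simp add: powr_def)
    then show ?case using elim(1) by simp
  qed
qed

lemma fdiff_holomorphic:
  assumes "f holomorphic_on UNIV"
  shows "fdiff n f holomorphic_on UNIV"
  using assms by (induction n) (auto intro!: holomorphic_intros entire_shift)

lemma fdiff_add: "fdiff n (\<lambda>z. f z + h z) z = fdiff n f z + fdiff n h z"
  by (induction n arbitrary: z) auto

lemma fdiff_exp: "fdiff n (\<lambda>z. q * exp (\<gamma> * z)) z = (exp \<gamma> - 1) ^ n * (q * exp (\<gamma> * z))"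
  by (induction n arbitrary: z) (auto simp: algebra_simps exp_add)

text \<open>The characteristic polynomial (x - 1)^n - 1 takes the value -1 at x = 1.\<close>

lemma fdiff_eq_self_imp_eq_0:
  assumes "c holomorphic_on UNIV" "exp_growth s c" "0 < s" "s < 1" "0 < n" "\<And>z. fdiff n c z = c z"
  shows "c z = 0"
proof (rule shift_op_eq_0_imp_eq_0[OF assms(1-4)])
  show "shift_op ([:-1, 1:] ^ n - 1) c z = 0" for z
    using assms(6)[of z] by (simp add: shift_op_diff fdiff_eq_shift_op)
  show "poly ([:-1, 1:] ^ n - 1) 1 \<noteq> (0::complex)" using assms(5) by (simp add: poly_power power_0_left)
qed

text \<open>\<open>g\<close> has a coefficient of index larger than the growth exponent \<open>s\<close> of \<open>H\<close>, as otherwise the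
  order of \<open>f\<close> would be at most \<open>s\<close>.\<close>
lemma large_coefficient_exists:
  assumes f: "f holomorphic_on UNIV" and c: "c holomorphic_on UNIV" "small_fun c f"
    and g: "g holomorphic_on UNIV" and H: "H holomorphic_on UNIV" "exp_growth s H"
    and F: "\<And>z. f z - c z = H z * exp (g z)" and s: "0 < s" "ereal s < nev_order f"
  shows "\<exists>k. s < real k \<and> (deriv ^^ k) g 0 \<noteq> 0"
proof (rule ccontr)
  assume "\<not> ?thesis"
  then have high: "(deriv ^^ k) g 0 = 0" if "s < real k" for k using that by blast
  define d where "d = nat \<lfloor>s\<rfloor>"
  have d: "real d \<le> s" "s < real (Suc d)" using s(1) unfolding d_def by linarith+
  have "(deriv ^^ j) g 0 = 0" if "d < j" for j using that d by (intro high) simp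
  then obtain P where P: "degree P \<le> d" "\<And>z. g z = poly P z"
    using entire_eq_poly[OF g] by blast
  obtain C where C: "C \<ge> 0" "\<And>w. cmod (poly P w) \<le> C * (1 + cmod w) ^ d"
    using poly_growth[OF P(1)] by blast
  have "exp_growth s (\<lambda>z. exp (g z))"
  proof (rule exp_growthI)
    fix z
    have "Re (g z) \<le> C * (1 + cmod z) ^ d"
      using C(2)[of z] complex_Re_le_cmod[of "poly P z"] by (simp add: P(2))
    also have "(1 + cmod z) ^ d = (1 + cmod z) powr real d" by (simp add: powr_realpow add_pos_nonneg)
    also have "C * (1 + cmod z) powr real d \<le> C * (1 + cmod z) powr s"
      using C(1) d by (intro mult_left_mono powr_mono) auto
    finally show "cmod (exp (g z)) \<le> exp (C * (1 + cmod z) powr s)" by simp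
  qed
  then have "exp_growth s (\<lambda>z. H z * exp (g z))" by (intro exp_growth_mult H)
  moreover have "(\<lambda>z. H z * exp (g z)) holomorphic_on UNIV" by (intro holomorphic_intros H g)
  ultimately obtain B where B: "B \<ge> 0" "\<And>r. r \<ge> 0 \<Longrightarrow> nev_T r (\<lambda>z. H z * exp (g z)) \<le> B * (1 + r) powr s"
    using exp_growth_nev_T by blast
  obtain E where E: "E \<in> sets lebesgue" "emeasure lebesgue E < \<infinity>"
    "\<And>\<epsilon>. \<epsilon> > 0 \<Longrightarrow> \<exists>R. \<forall>r\<ge>R. r \<notin> E \<longrightarrow> nev_T r c \<le> \<epsilon> * nev_T r f"
    using c(2) by (auto simp: small_fun_def)
  obtain R where R: "\<And>r. r \<ge> R \<Longrightarrow> r \<notin> E \<Longrightarrow> nev_T r c \<le> 1/2 * nev_T r f"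
    using E(3)[of "1/2"] by auto
  have ff: "f = (\<lambda>z. H z * exp (g z) + c z)" using F by (auto simp: fun_eq_iff algebra_simps)
  have le: "nev_T r f \<le> (2 * B + 2 * ln 2) * (1 + r) powr s" if r: "r \<ge> max R 0" "r \<notin> E" for r
  proof -
    have "nev_T r f \<le> nev_T r (\<lambda>z. H z * exp (g z)) + nev_T r c + ln 2"
      unfolding ff using r by (intro nev_T_add holomorphic_intros H g c) auto
    then have "nev_T r f \<le> 2 * (B * (1 + r) powr s) + 2 * ln 2 * 1"
      using B(2)[of r] R[of r] r by simp
    moreover have "2 * ln 2 * 1 \<le> 2 * ln 2 * (1 + r) powr s"
      using r s by (intro mult_left_mono ge_one_powr_ge_zero) auto
    ultimately show ?thesis by (simp only: distrib_right mult.assoc)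
  qed
  obtain t where t: "ereal s < ereal t" "ereal t < nev_order f" using ereal_dense2[OF s(2)] by blast
  have "nev_order f \<le> ereal t"
    by (rule nev_order_le_of_nonexceptional_bound[where R = "max R 0", OF f E(1,2) _ _ _ le]) (use s t B in auto)
  then show False using t(2) by simp
qed

text \<open>exp g is the entire quotient (f - c) / H, so its characteristic is at most that of
  \<open>f\<close> plus terms of finite order.\<close>

lemma nev_T_exp_growth:
  assumes f: "f holomorphic_on UNIV" and c: "c holomorphic_on UNIV" "exp_growth s' c" "0 < s'"
    and g: "g holomorphic_on UNIV" and H: "H holomorphic_on UNIV" "exp_growth s H" "H \<noteq> (\<lambda>_. 0)" "0 < s"
    and F: "\<And>z. f z - c z = H z * exp (g z)"
    and growth: "eventually (\<lambda>r. nev_T r f \<le> exp (r powr \<sigma>)) at_top" and \<sigma>: "0 < \<sigma>" "\<sigma> < \<sigma>'"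
  shows "eventually (\<lambda>r. nev_T r (\<lambda>z. exp (g z)) \<le> exp (r powr \<sigma>')) at_top"
proof -
  obtain B where B: "\<And>r. r \<ge> 0 \<Longrightarrow> nev_T r H \<le> B * (1 + r) powr s"
    using exp_growth_nev_T[OF H(2,1)] by blast
  obtain B' where B': "\<And>r. r \<ge> 0 \<Longrightarrow> nev_T r c \<le> B' * (1 + r) powr s'"
    using exp_growth_nev_T[OF c(2,1)] by blast
  have fc: "(\<lambda>z. f z - c z) holomorphic_on UNIV" and eg: "(\<lambda>z. exp (g z)) holomorphic_on UNIV"
    by (intro holomorphic_intros f c g)+
  obtain C where C: "\<And>r. r \<ge> 1 \<Longrightarrow> nev_T r (\<lambda>z. exp (g z)) \<le> nev_T r (\<lambda>z. f z - c z) + nev_T r H + C"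
    using nev_T_factor_le[OF fc H(1) eg F H(3)] by blast
  have "eventually (\<lambda>r. ln 4 * r powr 0 \<le> r powr \<sigma>) at_top" using \<sigma> by (intro eventually_powr_le) auto
  moreover have "eventually (\<lambda>r. 2 * r powr \<sigma> \<le> r powr \<sigma>') at_top" using \<sigma> by (intro eventually_powr_le) auto
  moreover have "eventually (\<lambda>r. B * (1 + r) powr s \<le> exp (r powr \<sigma>)) at_top"
    "eventually (\<lambda>r. B' * (1 + r) powr s' \<le> exp (r powr \<sigma>)) at_top"
    "eventually (\<lambda>r. (C + ln 2) * (1 + r) powr 0 \<le> exp (r powr \<sigma>)) at_top"
    using H(4) c(3) \<sigma> by (intro eventually_powr_le_exp; simp)+
  ultimately show ?thesis
    using growth eventually_ge_at_top[of 1]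
  proof eventually_elim
    case (elim r)
    have "nev_T r (\<lambda>z. f z - c z) \<le> nev_T r f + nev_T r c + ln 2"
      using elim by (intro nev_T_diff f c) auto
    then have "nev_T r (\<lambda>z. exp (g z)) \<le> nev_T r f + nev_T r c + nev_T r H + (C + ln 2)"
      using C[of r] elim by simp
    also have "\<dots> \<le> 4 * exp (r powr \<sigma>)" using elim B[of r] B'[of r] by simp
    also have "\<dots> = exp (ln 4 + r powr \<sigma>)" by (simp add: exp_add)
    also have "\<dots> \<le> exp (r powr \<sigma>')" using elim by simp
    finally show ?case .
  qed
qed

theorem theorem3:
  fixes n :: nat and f a b c :: "complex \<Rightarrow> complex"
  assumes "n > 0"
    and "f holomorphic_on UNIV"
    and "hyper_order f < 1"
    and "a holomorphic_on UNIV" and "b holomorphic_on UNIV" and "c holomorphic_on UNIV"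
    and "small_fun a f" and "small_fun b f" and "small_fun c f"
    and "zero_exponent (\<lambda>z. f z - c z) < nev_order f"
    and "nev_order c < 1"
    and "a \<noteq> b"
    and "fdiff n f \<noteq> (\<lambda>_. 0)"
    and "share_CM {a, b} f (fdiff n f)"
  shows "\<exists>p \<gamma> :: complex. p \<noteq> 0 \<and> \<gamma> \<noteq> 0 \<and> (\<forall>z. f z = c z + p * exp (\<gamma> * z)) \<and>
     (((exp \<gamma> - 1) ^ n = 1 \<and> c = (\<lambda>_. 0) \<and> fdiff n f = f) \<or>
      ((exp \<gamma> - 1) ^ n = -1 \<and> fdiff n (\<lambda>z. f z - c z) = (\<lambda>z. - (f z - c z)) \<and>
       (\<forall>z. fdiff n c z + c z = a z + b z)))"
proof -
  note hol = assms(2,4,5,6)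
  define F where "F z = f z - c z" for z
  have F: "F holomorphic_on UNIV" unfolding F_def by (intro holomorphic_intros hol)
  \<comment> \<open>\<open>s\<close> lies below the order of \<open>f\<close>, so that
    \<open>g\<close> must have a coefficient beyond it; \<tau> leaves room between the zero exponent
    and \<open>s\<close> for the canonical product.\<close>
  obtain s where s1: "zero_exponent F < ereal s" "ereal s < nev_order f"
    using ereal_dense2[OF assms(10)] unfolding F_def by blast
  obtain \<tau> where \<tau>: "zero_exponent F < ereal \<tau>" "ereal \<tau> < ereal s"
    using ereal_dense2[OF s1(1)] by blast
  have "0 < ereal \<tau>" using zero_exponent_nonneg \<tau>(1) by (rule le_less_trans)
  then have s: "0 < \<tau>" "\<tau> < s" "0 < s" using \<tau>(2) by auto
  have order_pos: "0 < nev_order f" using s(3) s1(2) by (metis ereal_less(2) less_trans)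
  note neq = small_fun_neq_self[OF hol(1) _ order_pos]
  have F0: "F \<noteq> (\<lambda>_. 0)" using neq[OF assms(9)] by (auto simp: F_def fun_eq_iff)
  obtain H g where H: "H holomorphic_on UNIV" and g: "g holomorphic_on UNIV"
    and Hs: "exp_growth s H" and FH: "\<And>z. F z = H z * exp (g z)"
    using hadamard_factorization[OF F F0 \<tau>(1) s(1,2)] by blast
  have H0: "H \<noteq> (\<lambda>_. 0)" using F0 FH by (auto simp: fun_eq_iff)
  obtain k where kc: "s < real k" "(deriv ^^ k) g 0 \<noteq> 0"
    using large_coefficient_exists[OF hol(1,4) assms(9) g H Hs FH[unfolded F_def] s(3) s1(2)] by blast
  obtain s' where s': "0 < s'" "s' < 1" "exp_growth s' c"
    using exp_growth_of_order_less_1[OF hol(4) assms(11)] by blast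
  obtain x where x: "hyper_order f < ereal x" "ereal x < 1" using ereal_dense2[OF assms(3)] by blast
  \<comment> \<open>The maximum with 1/2 ensures positivity; \<sigma> lies between \<sigma>0 and 1
    to absorb the passage from \<open>f\<close> to exp g.\<close>
  define \<sigma>0 where "\<sigma>0 = max x (1/2)"
  define \<sigma> where "\<sigma> = (1 + \<sigma>0) / 2"
  have \<sigma>c: "0 < \<sigma>0" "\<sigma>0 < \<sigma>" "0 < \<sigma>" "\<sigma> < 1" using x(2) by (auto simp: \<sigma>0_def \<sigma>_def)
  have "ereal x \<le> ereal \<sigma>0" by (simp add: \<sigma>0_def)
  with x(1) have "hyper_order f < ereal \<sigma>0" by (rule less_le_trans)
  from nev_T_exp_growth[OF hol(1,4) s'(3,1) g H Hs H0 s(3) FH[unfolded F_def] nev_T_le_exp_of_hyper_order[OF this] \<sigma>c(1,2)]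
  have growth: "eventually (\<lambda>r. nev_T r (\<lambda>z. exp (g z)) \<le> exp (r powr \<sigma>)) at_top" .
  have k0: "k > 0" using kc(1) s(3) by (cases k) auto
  interpret small_functions g \<sigma> k
    by unfold_locales (use g \<sigma>c growth kc k0 in auto)
  have smH: "small H" by (rule small_of_exp_growth[OF H Hs s(3) kc(1)])
  have smc: "small c" by (rule small_of_exp_growth[OF hol(4) s'(3,1)]) (use s'(2) k0 in linarith)
  \<comment> \<open>That \<open>f\<close> is moderate turns smallness of \<open>a\<close> and
    \<open>b\<close> relative to \<open>f\<close> into smallness relative to exp g. For
    \<open>c\<close> its order below 1 \<le> k is enough.\<close>
  have "moderate (\<lambda>z. H z * exp (g z) + c z)" by (intro moderate_intros smH smc)
  moreover have f_eq: "f = (\<lambda>z. H z * exp (g z) + c z)"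
    using FH by (auto simp: F_def fun_eq_iff algebra_simps)
  ultimately have "moderate f" by simp
  then have smab: "small a" "small b" using small_of_small_fun hol assms(7,8) by blast+
  define M where "M z = (\<Sum>i\<le>degree ([:-1, 1:] ^ n :: complex poly).
    coeff ([:-1, 1:] ^ n) i * (H (z + of_nat i) * exp (g (z + of_nat i) - g z)))" for z
  have smM: "small M" unfolding M_def[abs_def] by (intro small_intros smH small_exp_g_shift)
  have fF: "fdiff n F z = M z * exp (g z)" for z
    unfolding fdiff_eq_shift_op M_def by (rule shift_op_mult_exp[OF FH])
  have smc': "small (fdiff n c)"
    unfolding fdiff_eq_shift_op shift_op_def[abs_def] by (intro small_intros smc)
  define A B d where "A z = a z - c z" and "B z = b z - c z" and "d z = fdiff n c z - c z" for z
  have smABd: "small A" "small B" "small d"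
    unfolding A_def[abs_def] B_def[abs_def] d_def[abs_def] by (intro small_intros smab smc smc')+
  have "fdiff n f z = fdiff n F z + fdiff n c z" for z
    using fdiff_add[of n F c z] by (simp add: F_def)
  then have ff: "fdiff n f z = M z * exp (g z) + d z + c z" for z by (simp add: fF d_def)
  have fz: "f z = H z * exp (g z) + c z" for z by (simp add: f_eq)
  obtain Q where Q: "Q holomorphic_on UNIV"
    "\<And>z. (fdiff n f z - a z) * (fdiff n f z - b z) = exp (Q z) * ((f z - a z) * (f z - b z))"
    using share_CM_pair_exp[OF hol(1) fdiff_holomorphic[OF hol(1)] hol(2,3) assms(12) neq[OF assms(7)] neq[OF assms(8)] assms(14)]
    by blast
  have "(M = H \<and> d = (\<lambda>_. 0)) \<or> (M = (\<lambda>z. - H z) \<and> d = (\<lambda>z. A z + B z))"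
  proof (rule shared_pair_identity[OF smM smH smABd Q(1) H0])
    show "A \<noteq> B" using assms(12) by (auto simp: A_def B_def fun_eq_iff)
    show "(M z * exp (g z) + (d z - A z)) * (M z * exp (g z) + (d z - B z)) =
        exp (Q z) * ((H z * exp (g z) - A z) * (H z * exp (g z) - B z))" for z
      using Q(2)[of z] by (simp add: ff fz A_def B_def algebra_simps)
    have "\<not> (\<forall>z. (f z - a z) * (f z - b z) = 0)"
    proof
      assume "\<forall>z. (f z - a z) * (f z - b z) = 0"
      then have "(\<lambda>z. f z - a z) = (\<lambda>_. 0) \<or> (\<lambda>z. f z - b z) = (\<lambda>_. 0)"
        by (intro entire_mult_eq_0 holomorphic_intros hol) auto
      then show False using neq[OF assms(7)] neq[OF assms(8)] by (auto simp: fun_eq_iff)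
    qed
    then show "\<exists>z. (H z * exp (g z) - A z) * (H z * exp (g z) - B z) \<noteq> 0"
      by (simp add: fz A_def B_def algebra_simps)
  qed
  \<comment> \<open>A common sign \<epsilon> merges the alternatives, so that one linear equation
    for H exp g covers both.\<close>
  then obtain \<epsilon> :: complex where \<epsilon>: "\<epsilon> = 1 \<or> \<epsilon> = -1" and M: "\<And>z. M z = \<epsilon> * H z"
    and d: "\<epsilon> = 1 \<Longrightarrow> d = (\<lambda>_. 0)" "\<epsilon> = -1 \<Longrightarrow> d = (\<lambda>z. A z + B z)"
  proof (elim disjE conjE)
    assume "M = H" "d = (\<lambda>_. 0)"
    then show thesis by (intro that[of 1]) auto
  next
    assume "M = (\<lambda>z. - H z)" "d = (\<lambda>z. A z + B z)"
    then show thesis by (intro that[of "-1"]) auto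
  qed
  have \<epsilon>0: "\<epsilon> \<noteq> 0" using \<epsilon> by auto
  have "F = (\<lambda>z. H z * exp (g z))" using FH by auto
  then have eqF: "fdiff n (\<lambda>z. H z * exp (g z)) z = \<epsilon> * (H z * exp (g z))" for z
    using fF[of z] M[of z] by simp
  obtain p \<gamma> where p: "p \<noteq> 0" "\<gamma> \<noteq> 0" "\<And>z. H z * exp (g z) = p * exp (\<gamma> * z)"
    using difference_equation_exp_linear[OF g \<sigma>c(3,4) growth kc H H0 Hs s(3) eqF assms(1) \<epsilon>0] by blast
  have f_cp: "f z = c z + p * exp (\<gamma> * z)" for z using fz[of z] p(3)[of z] by simp
  have pow: "(exp \<gamma> - 1) ^ n = \<epsilon>"
    using eqF[of 0] p(1) unfolding p(3) fdiff_exp by simp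
  have F_eq: "(\<lambda>z. f z - c z) = (\<lambda>z. H z * exp (g z))" using fz by simp
  show ?thesis
  proof (rule exI[of _ p], rule exI[of _ \<gamma>], intro conjI allI p(1,2) f_cp)
    from \<epsilon> show "((exp \<gamma> - 1) ^ n = 1 \<and> c = (\<lambda>_. 0) \<and> fdiff n f = f) \<or>
      ((exp \<gamma> - 1) ^ n = -1 \<and> fdiff n (\<lambda>z. f z - c z) = (\<lambda>z. - (f z - c z)) \<and>
       (\<forall>z. fdiff n c z + c z = a z + b z))"
    proof
      assume e: "\<epsilon> = 1"
      have "fdiff n c z = c z" for z using fun_cong[OF d(1)[OF e], of z] by (simp add: d_def)
      then have c0: "c z = 0" for z by (rule fdiff_eq_self_imp_eq_0[OF hol(4) s'(3,1,2) assms(1)])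
      then have "f = (\<lambda>z. H z * exp (g z))" using fz by auto
      then have "fdiff n f = f" using eqF e by auto
      then show ?thesis using pow e c0 by auto
    next
      assume e: "\<epsilon> = -1"
      have "fdiff n c z + c z = a z + b z" for z
        using fun_cong[OF d(2)[OF e], of z] by (simp add: d_def A_def B_def algebra_simps)
      moreover have "fdiff n (\<lambda>z. f z - c z) z = - (f z - c z)" for z
        unfolding F_eq using eqF[of z] e fz[of z] by simp
      then have "fdiff n (\<lambda>z. f z - c z) = (\<lambda>z. - (f z - c z))" by (rule ext)
      ultimately show ?thesis using pow e by auto
    qed
  qed
qed


end
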